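(* Let $\mathbf{G}=\{G_n\}_{n=1}^\infty$ be a weakly convergent sequence of finite connected $(X,S)$-graphs with vertex degree bound $d$, and let $\mathbf{B}=\{B_n\}_{n=1}^\infty$ be a weakly convergent operator sequence on $\mathbf{G}$ such that every $B_n$ is self-adjoint. Let $\mu_{B_n}$ be the probability measure on $\mathbb{R}$ with $\mu_{B_n}((-\infty,\lambda])=N_{B_n}(\lambda)$, and let $\mu_{[\mathbf{B}]}$ be the spectral measure of the limit operator $[\mathbf{B}]\in N_{\mathbf{G}}$. Then the measures $\mu_{B_n}$ converge weakly to $\mu_{[\mathbf{B}]}$. Thus for every continuity point $\lambda$ of $N_{[\mathbf{B}]}$, $$\lim_{n\to\infty}N_{B_n}(\lambda)=\operatorname{Tr}_{\mathbf{G}}(E^{[\mathbf{B}]}_\lambda).$$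
   Context: $X,S$ are finite sets. **$(X,S)$-graphs and weak convergence.** An $(X,S)$-graph is a finite simple graph with vertices colored by $X$ and directed edges colored by $S$ (both directions of each edge get a color). $B_r(x)$ is the subgraph spanned by the vertices at distance $\le r$ from $x$, rooted at $x$. $\mathcal{A}(d,r,X,S)$ is the finite set of rooted color-preserving isomorphism classes of connected rooted $(X,S)$-graphs with degrees $\le d$ and all vertices at distance $\le r$ from the root. $p_G(\alpha)$ is the proportion of vertices $z$ of $G$ such that $B_r(z)$ represents $\alpha$. A sequence $\mathbf{G}=\{G_n\}$ of finite connected $(X,S)$-graphs with degrees $\le d$ and $|V(G_n)|\to\infty$ is weakly convergent if $\lim_n p_{G_n}(\alpha)$ exists for all $r\ge1$, $\alpha\in\mathcal{A}(d,r,X,S)$. **Weakly convergent operator sequences.** An invariant function on $\alpha$ is a real function on the vertices of a representative of $\alpha$ invariant under its rooted colored automorphisms. A sequence of kernels $\mathbf{A}=\{A_n:V(G_n)\times V(G_n)\to\mathbb{R}\}$ (acting by $A_nf(x)=\sum_yA_n(x,y)f(y)$) is a weakly convergent operator sequence on $\mathbf{G}$ if (i) there is $m_{\mathbf{A}}>0$ with $|A_n(x,y)|\le m_{\mathbf{A}}$ for all $n,x,y$; (ii) there is $s_{\mathbf{A}}>0$ with $A_n(x,y)=0$ whenever $d_{G_n}(x,y)>s_{\mathbf{A}}$; (iii) for the same $s_{\mathbf{A}}$, for every $\alpha\in\mathcal{A}(d,s_{\mathbf{A}},X,S)$ with $\lim_np_{G_n}(\alpha)\ne0$ there is an invariant function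 $f^{\mathbf{A}}_\alpha$ on $\alpha$ such that for all $n$ and $x\in V(G_n)$, if $B_{s_{\mathbf{A}}}(x)$ represents $\alpha$ then $A_n(x,\cdot)$ on $B_{s_{\mathbf{A}}}(x)$ corresponds to $f^{\mathbf{A}}_\alpha$. These sequences form a unital $*$-algebra $\mathcal{P}_{\mathbf{G}}$ under termwise operations, with $A_n^*(x,y)=A_n(y,x)$. **Trace and von Neumann algebra.** $\operatorname{Tr}_{\mathbf{G}}(\mathbf{A})=\lim_n\frac1{|V(G_n)|}\operatorname{Tr}(A_n)$ (the limit exists). $\mathcal{N}_{\mathbf{G}}\subset\mathcal{P}_{\mathbf{G}}$ is the ideal of nulloperators: those $\mathbf{B}$ for which $f^{\mathbf{B}}_\alpha=0$ for all $\alpha\in\mathcal{A}(d,s_{\mathbf{B}},X,S)$ with $\lim_n p_{G_n}(\alpha)\ne0$. $\mathcal{P}_{\mathbf{G}}/\mathcal{N}_{\mathbf{G}}$ is a pre-Hilbert space with $\langle[\mathbf{A}],[\mathbf{B}]\rangle=\operatorname{Tr}_{\mathbf{G}}(\mathbf{B}^*\mathbf{A})$, and $L_{[\mathbf{A}]}[\mathbf{B}]=[\mathbf{A}\mathbf{B}]$ defines a representation by bounded operators, extended to the Hilbert space completion. $N_{\mathbf{G}}$ is the weak closure of $\{L_{[\mathbf{A}]}\}$; $\operatorname{Tr}_{\mathbf{G}}$ extends to $N_{\mathbf{G}}$ by $\operatorname{Tr}_{\mathbf{G}}(T)=\langle T\mathbf{1},\mathbf{1}\rangle$, with $\mathbf{1}$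 the class of the sequence of identity operators. The limit operator of $\mathbf{A}$ is $[\mathbf{A}]$, viewed as $L_{[\mathbf{A}]}\in N_{\mathbf{G}}$. **Spectral data.** For $\mathbf{B}$ with all $B_n$ self-adjoint, $[\mathbf{B}]$ is a bounded self-adjoint operator; $E^{[\mathbf{B}]}_\lambda=\chi_{(-\infty,\lambda]}([\mathbf{B}])$ is its spectral projection, and $\mu_{[\mathbf{B}]}$ is the probability measure on $\mathbb{R}$ with $\mu_{[\mathbf{B}]}((-\infty,\lambda])=N_{[\mathbf{B}]}(\lambda):=\operatorname{Tr}_{\mathbf{G}}(E^{[\mathbf{B}]}_\lambda)$. $N_{B_n}(\lambda)$ is the number of eigenvalues of $B_n$ (with multiplicity) not larger than $\lambda$ divided by $|V(G_n)|$. *)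

theory Defs
  imports
    "HOL-Probability.Weak_Convergence"
    "HOL-Library.Extended_Nat"
    "Jordan_Normal_Form.Char_Poly"
begin

section \<open>Coloured graphs and weak convergence\<close>

text \<open>
  The finite colour sets \<open>X\<close> and \<open>S\<close> are the finite types \<open>'x\<close> and \<open>'s\<close>.  A simple graph is
  given by a symmetric irreflexive relation, so that the two directions of an edge are two pairs,
  each with its own colour.  Colours outside \<open>verts\<close> and \<open>edges\<close> carry no meaning and are never
  looked at.
\<close>

record ('v, 'x, 's) xs_graph =
  verts :: "'v set"
  edges :: "('v \<times> 'v) set"
  vcol :: "'v \<Rightarrow> 'x"
  ecol :: "'v \<times> 'v \<Rightarrow> 's"

definition wf_graph :: "('v, 'x::finite, 's::finite) xs_graph \<Rightarrow> bool" where
  "wf_graph G \<longleftrightarrow>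
     finite (verts G) \<and> edges G \<subseteq> verts G \<times> verts G \<and> sym (edges G) \<and> irrefl (edges G)"

text \<open>Path-length distance; it is \<open>\<infinity>\<close> (the infimum of the empty set) if there is no path.\<close>

definition gdist :: "('v, 'x, 's) xs_graph \<Rightarrow> 'v \<Rightarrow> 'v \<Rightarrow> enat" where
  "gdist G x y = (INF k\<in>{k. (x, y) \<in> edges G ^^ k}. enat k)"

definition connected_graph :: "('v, 'x, 's) xs_graph \<Rightarrow> bool" where
  "connected_graph G \<longleftrightarrow>
     verts G \<noteq> {} \<and> (\<forall>x\<in>verts G. \<forall>y\<in>verts G. gdist G x y < \<infinity>)"

definition degree_bound :: "nat \<Rightarrow> ('v, 'x, 's) xs_graph \<Rightarrow> bool" where
  "degree_bound d G \<longleftrightarrow> (\<forall>x\<in>verts G. card (edges G `` {x}) \<le> d)"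

definition gball :: "('v, 'x, 's) xs_graph \<Rightarrow> nat \<Rightarrow> 'v \<Rightarrow> ('v, 'x, 's) xs_graph" where
  "gball G r x =
     (let U = {y \<in> verts G. gdist G x y \<le> enat r}
      in G\<lparr>verts := U, edges := edges G \<inter> (U \<times> U)\<rparr>)"

type_synonym ('v, 'x, 's) rooted = "('v, 'x, 's) xs_graph \<times> 'v"

definition rooted_iso ::
  "('v \<Rightarrow> 'w) \<Rightarrow> ('v, 'x, 's) rooted \<Rightarrow> ('w, 'x, 's) rooted \<Rightarrow> bool" where
  "rooted_iso \<phi> p q \<longleftrightarrow>
     (case p of (G, a) \<Rightarrow> case q of (H, b) \<Rightarrow>
        bij_betw \<phi> (verts G) (verts H) \<and> \<phi> a = b \<and>
        (\<forall>u\<in>verts G. \<forall>v\<in>verts G. (u, v) \<in> edges G \<longleftrightarrow> (\<phi> u, \<phi> v) \<in> edges H) \<and>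
        (\<forall>u\<in>verts G. vcol H (\<phi> u) = vcol G u) \<and>
        (\<forall>(u, v)\<in>edges G. ecol H (\<phi> u, \<phi> v) = ecol G (u, v)))"

text \<open>
  The set \<open>\<A>(d,r,X,S)\<close>.  Every finite graph has an isomorphic copy with vertices in \<open>nat\<close>, so
  isomorphism classes are formed among rooted graphs on \<open>nat\<close>.
\<close>

definition rooted_graphs :: "nat \<Rightarrow> nat \<Rightarrow> (nat, 'x::finite, 's::finite) rooted set" where
  "rooted_graphs d r =
     {(H, a). wf_graph H \<and> connected_graph H \<and> degree_bound d H \<and> a \<in> verts H \<and>
              (\<forall>u\<in>verts H. gdist H a u \<le> enat r)}"

definition rooted_iso_rel ::
  "nat \<Rightarrow> nat \<Rightarrow> ((nat, 'x::finite, 's::finite) rooted \<times> (nat, 'x, 's) rooted) set" where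
  "rooted_iso_rel d r =
     {(p, q). p \<in> rooted_graphs d r \<and> q \<in> rooted_graphs d r \<and> (\<exists>\<phi>. rooted_iso \<phi> p q)}"

definition ball_types :: "nat \<Rightarrow> nat \<Rightarrow> (nat, 'x::finite, 's::finite) rooted set set" where
  "ball_types d r = rooted_graphs d r // rooted_iso_rel d r"

definition represents :: "('v, 'x, 's) rooted \<Rightarrow> (nat, 'x, 's) rooted set \<Rightarrow> bool" where
  "represents q \<alpha> \<longleftrightarrow> (\<exists>p\<in>\<alpha>. \<exists>\<phi>. rooted_iso \<phi> q p)"

definition ball_freq ::
  "('v, 'x, 's) xs_graph \<Rightarrow> nat \<Rightarrow> (nat, 'x, 's) rooted set \<Rightarrow> real" where
  "ball_freq G r \<alpha> =
     real (card {z \<in> verts G. represents (gball G r z, z) \<alpha>}) / real (card (verts G))"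

definition lim_freq ::
  "(nat \<Rightarrow> ('v, 'x, 's) xs_graph) \<Rightarrow> nat \<Rightarrow> (nat, 'x, 's) rooted set \<Rightarrow> real" where
  "lim_freq G r \<alpha> = lim (\<lambda>n. ball_freq (G n) r \<alpha>)"

definition weakly_convergent ::
  "nat \<Rightarrow> (nat \<Rightarrow> ('v, 'x::finite, 's::finite) xs_graph) \<Rightarrow> bool" where
  "weakly_convergent d G \<longleftrightarrow>
     (\<forall>n. wf_graph (G n) \<and> connected_graph (G n) \<and> degree_bound d (G n)) \<and>
     filterlim (\<lambda>n. card (verts (G n))) at_top sequentially \<and>
     (\<forall>r\<ge>1. \<forall>\<alpha>\<in>ball_types d r. convergent (\<lambda>n. ball_freq (G n) r \<alpha>))"


section \<open>Weakly convergent operator sequences\<close>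

text \<open>
  A kernel on a vertex set \<open>V\<close> is a function on all pairs that vanishes outside \<open>V \<times> V\<close>; this
  makes kernels on \<open>V\<close> equal as functions iff they are equal on \<open>V \<times> V\<close>.
\<close>

type_synonym 'v kernel_seq = "nat \<Rightarrow> 'v \<Rightarrow> 'v \<Rightarrow> real"

definition kernels_on :: "(nat \<Rightarrow> ('v, 'x, 's) xs_graph) \<Rightarrow> 'v kernel_seq set" where
  "kernels_on G = {A. \<forall>n x y. x \<notin> verts (G n) \<or> y \<notin> verts (G n) \<longrightarrow> A n x y = 0}"

text \<open>
  An invariant function on \<open>\<alpha>\<close> is given by a representative \<open>p \<in> \<alpha>\<close> together with a function on its
  vertices that is invariant under the rooted coloured automorphisms of \<open>p\<close>.
\<close>

definition invariant_function :: "('v, 'x, 's) rooted \<Rightarrow> ('v \<Rightarrow> real) \<Rightarrow> bool" where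
  "invariant_function p f \<longleftrightarrow>
     (\<forall>\<phi>. rooted_iso \<phi> p p \<longrightarrow> (\<forall>u\<in>verts (fst p). f (\<phi> u) = f u))"

definition corresponds ::
  "(nat \<Rightarrow> ('v, 'x, 's) xs_graph) \<Rightarrow> nat \<Rightarrow> 'v kernel_seq \<Rightarrow>
   (nat, 'x, 's) rooted \<Rightarrow> (nat \<Rightarrow> real) \<Rightarrow> bool" where
  "corresponds G s A p f \<longleftrightarrow>
     (\<forall>n. \<forall>x\<in>verts (G n). \<forall>\<phi>. rooted_iso \<phi> (gball (G n) s x, x) p \<longrightarrow>
        (\<forall>y\<in>verts (gball (G n) s x). A n x y = f (\<phi> y)))"

definition operator_seq_range ::
  "nat \<Rightarrow> (nat \<Rightarrow> ('v, 'x::finite, 's::finite) xs_graph) \<Rightarrow> nat \<Rightarrow> 'v kernel_seq \<Rightarrow> bool" where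
  "operator_seq_range d G s A \<longleftrightarrow>
     A \<in> kernels_on G \<and>
     (\<exists>m>0. \<forall>n. \<forall>x\<in>verts (G n). \<forall>y\<in>verts (G n). \<bar>A n x y\<bar> \<le> m) \<and>
     (\<forall>n. \<forall>x\<in>verts (G n). \<forall>y\<in>verts (G n). gdist (G n) x y > enat s \<longrightarrow> A n x y = 0) \<and>
     (\<forall>\<alpha>\<in>ball_types d s. lim_freq G s \<alpha> \<noteq> 0 \<longrightarrow>
        (\<exists>p\<in>\<alpha>. \<exists>f. invariant_function p f \<and> corresponds G s A p f))"

definition operator_seqs ::
  "nat \<Rightarrow> (nat \<Rightarrow> ('v, 'x::finite, 's::finite) xs_graph) \<Rightarrow> 'v kernel_seq set" where
  "operator_seqs d G = {A. \<exists>s>0. operator_seq_range d G s A}"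

definition null_seqs ::
  "nat \<Rightarrow> (nat \<Rightarrow> ('v, 'x::finite, 's::finite) xs_graph) \<Rightarrow> 'v kernel_seq set" where
  "null_seqs d G =
     {A. \<exists>s>0. operator_seq_range d G s A \<and>
         (\<forall>\<alpha>\<in>ball_types d s. lim_freq G s \<alpha> \<noteq> 0 \<longrightarrow>
            (\<exists>p\<in>\<alpha>. corresponds G s A p (\<lambda>_. 0)))}"

definition ks_add :: "'v kernel_seq \<Rightarrow> 'v kernel_seq \<Rightarrow> 'v kernel_seq" where
  "ks_add A B = (\<lambda>n x y. A n x y + B n x y)"

definition ks_scale :: "real \<Rightarrow> 'v kernel_seq \<Rightarrow> 'v kernel_seq" where
  "ks_scale c A = (\<lambda>n x y. c * A n x y)"

definition ks_mult ::
  "(nat \<Rightarrow> ('v, 'x, 's) xs_graph) \<Rightarrow> 'v kernel_seq \<Rightarrow> 'v kernel_seq \<Rightarrow> 'v kernel_seq" where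
  "ks_mult G A B = (\<lambda>n x y. \<Sum>z\<in>verts (G n). A n x z * B n z y)"

definition ks_adj :: "'v kernel_seq \<Rightarrow> 'v kernel_seq" where
  "ks_adj A = (\<lambda>n x y. A n y x)"

definition ks_one :: "(nat \<Rightarrow> ('v, 'x, 's) xs_graph) \<Rightarrow> 'v kernel_seq" where
  "ks_one G = (\<lambda>n x y. if x = y \<and> x \<in> verts (G n) then 1 else 0)"

definition ks_trace :: "(nat \<Rightarrow> ('v, 'x, 's) xs_graph) \<Rightarrow> 'v kernel_seq \<Rightarrow> real" where
  "ks_trace G A = lim (\<lambda>n. (\<Sum>x\<in>verts (G n). A n x x) / real (card (verts (G n))))"


section \<open>Real inner product spaces with explicit carrier\<close>

text \<open>
  The Hilbert space below depends on the graph sequence, hence it is a set and not a type.  Maps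
  between such spaces are functions of which only the values on \<open>pts\<close> matter.
\<close>

record 'a ip_space =
  pts :: "'a set"
  vadd :: "'a \<Rightarrow> 'a \<Rightarrow> 'a"
  vscale :: "real \<Rightarrow> 'a \<Rightarrow> 'a"
  ip :: "'a \<Rightarrow> 'a \<Rightarrow> real"

definition ip_norm :: "'a ip_space \<Rightarrow> 'a \<Rightarrow> real" where
  "ip_norm H x = sqrt (ip H x x)"

definition ip_dist :: "'a ip_space \<Rightarrow> 'a \<Rightarrow> 'a \<Rightarrow> real" where
  "ip_dist H x y = ip_norm H (vadd H x (vscale H (-1) y))"

definition bounded_operator :: "'a ip_space \<Rightarrow> ('a \<Rightarrow> 'a) \<Rightarrow> bool" where
  "bounded_operator H T \<longleftrightarrow>
     (\<forall>x\<in>pts H. T x \<in> pts H) \<and>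
     (\<forall>x\<in>pts H. \<forall>y\<in>pts H. T (vadd H x y) = vadd H (T x) (T y)) \<and>
     (\<forall>c. \<forall>x\<in>pts H. T (vscale H c x) = vscale H c (T x)) \<and>
     (\<exists>K. \<forall>x\<in>pts H. ip_norm H (T x) \<le> K * ip_norm H x)"

definition selfadjoint_operator :: "'a ip_space \<Rightarrow> ('a \<Rightarrow> 'a) \<Rightarrow> bool" where
  "selfadjoint_operator H T \<longleftrightarrow>
     bounded_operator H T \<and> (\<forall>x\<in>pts H. \<forall>y\<in>pts H. ip H (T x) y = ip H x (T y))"

definition orthogonal_projection :: "'a ip_space \<Rightarrow> ('a \<Rightarrow> 'a) \<Rightarrow> bool" where
  "orthogonal_projection H P \<longleftrightarrow>
     selfadjoint_operator H P \<and> (\<forall>x\<in>pts H. P (P x) = P x)"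

text \<open>
  Hilbert space completion by Cauchy sequences modulo sequences of distance tending to \<open>0\<close>.
\<close>

definition cauchy_seqs :: "'a ip_space \<Rightarrow> (nat \<Rightarrow> 'a) set" where
  "cauchy_seqs H =
     {u. (\<forall>i. u i \<in> pts H) \<and>
         (\<forall>\<epsilon>>0. \<exists>N. \<forall>i\<ge>N. \<forall>j\<ge>N. ip_dist H (u i) (u j) < \<epsilon>)}"

definition cauchy_rel :: "'a ip_space \<Rightarrow> ((nat \<Rightarrow> 'a) \<times> (nat \<Rightarrow> 'a)) set" where
  "cauchy_rel H =
     {(u, v). u \<in> cauchy_seqs H \<and> v \<in> cauchy_seqs H \<and>
              (\<lambda>i. ip_dist H (u i) (v i)) \<longlonglongrightarrow> 0}"

definition ip_completion :: "'a ip_space \<Rightarrow> (nat \<Rightarrow> 'a) set ip_space" where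
  "ip_completion H =
     \<lparr>pts = cauchy_seqs H // cauchy_rel H,
      vadd = (\<lambda>U V. \<Union>u\<in>U. \<Union>v\<in>V. cauchy_rel H `` {\<lambda>i. vadd H (u i) (v i)}),
      vscale = (\<lambda>c U. \<Union>u\<in>U. cauchy_rel H `` {\<lambda>i. vscale H c (u i)}),
      ip = (\<lambda>U V. the_elem (\<Union>u\<in>U. \<Union>v\<in>V. {lim (\<lambda>i. ip H (u i) (v i))}))\<rparr>"

definition completion_embed :: "'a ip_space \<Rightarrow> 'a \<Rightarrow> (nat \<Rightarrow> 'a) set" where
  "completion_embed H x = cauchy_rel H `` {\<lambda>_. x}"

text \<open>Continuous extension of a bounded operator to the completion.\<close>

definition completion_map ::
  "'a ip_space \<Rightarrow> ('a \<Rightarrow> 'a) \<Rightarrow> (nat \<Rightarrow> 'a) set \<Rightarrow> (nat \<Rightarrow> 'a) set" where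
  "completion_map H T U = (\<Union>u\<in>U. cauchy_rel H `` {\<lambda>i. T (u i)})"


section \<open>Spectral projections\<close>

definition projection_valued_measure ::
  "'a ip_space \<Rightarrow> (real set \<Rightarrow> 'a \<Rightarrow> 'a) \<Rightarrow> bool" where
  "projection_valued_measure H P \<longleftrightarrow>
     (\<forall>A\<in>sets borel. orthogonal_projection H (P A)) \<and>
     (\<forall>x\<in>pts H. P UNIV x = x) \<and>
     (\<forall>A\<in>sets borel. \<forall>B\<in>sets borel. \<forall>x\<in>pts H. P (A \<inter> B) x = P A (P B x)) \<and>
     (\<forall>A :: nat \<Rightarrow> real set. range A \<subseteq> sets borel \<longrightarrow> disjoint_family A \<longrightarrow>
        (\<forall>x\<in>pts H. (\<lambda>k. ip H (P (A k) x) x) sums ip H (P (\<Union>k. A k) x) x))"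

definition pvm_scalar_measure ::
  "'a ip_space \<Rightarrow> (real set \<Rightarrow> 'a \<Rightarrow> 'a) \<Rightarrow> 'a \<Rightarrow> real measure" where
  "pvm_scalar_measure H P x =
     measure_of UNIV (sets borel) (\<lambda>A. ennreal (ip H (P A x) x))"

text \<open>
  \<open>P\<close> is the spectral measure of the self-adjoint operator \<open>T\<close>, i.e. \<open>T = \<integral> t dP(t)\<close> weakly.  As
  both sides are self-adjoint, it suffices to compare quadratic forms.
\<close>

definition spectral_resolution ::
  "'a ip_space \<Rightarrow> ('a \<Rightarrow> 'a) \<Rightarrow> (real set \<Rightarrow> 'a \<Rightarrow> 'a) \<Rightarrow> bool" where
  "spectral_resolution H T P \<longleftrightarrow>
     selfadjoint_operator H T \<and> projection_valued_measure H P \<and>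
     (\<forall>x\<in>pts H. integrable (pvm_scalar_measure H P x) (\<lambda>t. t) \<and>
        ip H (T x) x = (\<integral>t. t \<partial>pvm_scalar_measure H P x))"

text \<open>
  The operator \<open>\<chi>\<^sub>A(T)\<close>.  The choice is harmless: by the spectral theorem a spectral resolution of a
  bounded self-adjoint operator on a Hilbert space exists, and its values on Borel sets are unique
  as operators on \<open>pts H\<close>.
\<close>

definition spectral_projection ::
  "'a ip_space \<Rightarrow> ('a \<Rightarrow> 'a) \<Rightarrow> real set \<Rightarrow> 'a \<Rightarrow> 'a" where
  "spectral_projection H T = (SOME P. spectral_resolution H T P)"


section \<open>The von Neumann algebra of a weakly convergent graph sequence\<close>

definition null_rel ::
  "nat \<Rightarrow> (nat \<Rightarrow> ('v, 'x::finite, 's::finite) xs_graph) \<Rightarrow>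
   ('v kernel_seq \<times> 'v kernel_seq) set" where
  "null_rel d G =
     {(A, B). A \<in> operator_seqs d G \<and> B \<in> operator_seqs d G \<and>
              ks_add A (ks_scale (-1) B) \<in> null_seqs d G}"

definition op_class ::
  "nat \<Rightarrow> (nat \<Rightarrow> ('v, 'x::finite, 's::finite) xs_graph) \<Rightarrow> 'v kernel_seq \<Rightarrow>
   'v kernel_seq set" where
  "op_class d G A = null_rel d G `` {A}"

definition pre_hilbert ::
  "nat \<Rightarrow> (nat \<Rightarrow> ('v, 'x::finite, 's::finite) xs_graph) \<Rightarrow> 'v kernel_seq set ip_space" where
  "pre_hilbert d G =
     \<lparr>pts = operator_seqs d G // null_rel d G,
      vadd = (\<lambda>C D. \<Union>A\<in>C. \<Union>B\<in>D. op_class d G (ks_add A B)),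
      vscale = (\<lambda>c C. \<Union>A\<in>C. op_class d G (ks_scale c A)),
      ip = (\<lambda>C D. the_elem (\<Union>A\<in>C. \<Union>B\<in>D. {ks_trace G (ks_mult G (ks_adj B) A)}))\<rparr>"

definition left_mult ::
  "nat \<Rightarrow> (nat \<Rightarrow> ('v, 'x::finite, 's::finite) xs_graph) \<Rightarrow> 'v kernel_seq set \<Rightarrow>
   'v kernel_seq set \<Rightarrow> 'v kernel_seq set" where
  "left_mult d G C D = (\<Union>A\<in>C. \<Union>B\<in>D. op_class d G (ks_mult G A B))"

type_synonym 'v gns = "(nat \<Rightarrow> 'v kernel_seq set) set"

definition gns_space ::
  "nat \<Rightarrow> (nat \<Rightarrow> ('v, 'x::finite, 's::finite) xs_graph) \<Rightarrow> 'v gns ip_space" where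
  "gns_space d G = ip_completion (pre_hilbert d G)"

definition limit_operator ::
  "nat \<Rightarrow> (nat \<Rightarrow> ('v, 'x::finite, 's::finite) xs_graph) \<Rightarrow> 'v kernel_seq \<Rightarrow>
   'v gns \<Rightarrow> 'v gns" where
  "limit_operator d G A = completion_map (pre_hilbert d G) (left_mult d G (op_class d G A))"

text \<open>Closure of the operators \<open>L\<^bsub>[A]\<^esub>\<close> in the weak operator topology.\<close>

definition vn_algebra ::
  "nat \<Rightarrow> (nat \<Rightarrow> ('v, 'x::finite, 's::finite) xs_graph) \<Rightarrow> ('v gns \<Rightarrow> 'v gns) set" where
  "vn_algebra d G =
     {T. bounded_operator (gns_space d G) T \<and>
         (\<forall>F \<epsilon>. finite F \<longrightarrow> F \<subseteq> pts (gns_space d G) \<times> pts (gns_space d G) \<longrightarrow> \<epsilon> > 0 \<longrightarrow>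
            (\<exists>A\<in>operator_seqs d G. \<forall>(x, y)\<in>F.
               \<bar>ip (gns_space d G) (T x) y - ip (gns_space d G) (limit_operator d G A x) y\<bar> < \<epsilon>))}"

definition vn_one ::
  "nat \<Rightarrow> (nat \<Rightarrow> ('v, 'x::finite, 's::finite) xs_graph) \<Rightarrow> 'v gns" where
  "vn_one d G = completion_embed (pre_hilbert d G) (op_class d G (ks_one G))"

definition vn_trace ::
  "nat \<Rightarrow> (nat \<Rightarrow> ('v, 'x::finite, 's::finite) xs_graph) \<Rightarrow> ('v gns \<Rightarrow> 'v gns) \<Rightarrow> real" where
  "vn_trace d G T = ip (gns_space d G) (T (vn_one d G)) (vn_one d G)"


section \<open>Spectral distribution functions\<close>

text \<open>
  Matrix of a kernel on a finite set \<open>V\<close> in an enumeration of \<open>V\<close>; its eigenvalues and their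
  multiplicities do not depend on the enumeration.
\<close>

definition kernel_mat :: "'v set \<Rightarrow> ('v \<Rightarrow> 'v \<Rightarrow> real) \<Rightarrow> real mat" where
  "kernel_mat V A =
     mat (card V) (card V) (\<lambda>(i, j). A (from_nat_into V i) (from_nat_into V j))"

definition eigenvalue_distribution ::
  "'v set \<Rightarrow> ('v \<Rightarrow> 'v \<Rightarrow> real) \<Rightarrow> real \<Rightarrow> real" where
  "eigenvalue_distribution V A t =
     real (\<Sum>\<theta>\<in>{\<theta>. eigenvalue (kernel_mat V A) \<theta> \<and> \<theta> \<le> t}.
             Polynomial.order \<theta> (char_poly (kernel_mat V A))) / real (card V)"

definition spectral_projection_upto ::
  "nat \<Rightarrow> (nat \<Rightarrow> ('v, 'x::finite, 's::finite) xs_graph) \<Rightarrow> 'v kernel_seq \<Rightarrow> real \<Rightarrow>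
   'v gns \<Rightarrow> 'v gns" where
  "spectral_projection_upto d G B t =
     spectral_projection (gns_space d G) (limit_operator d G B) {..t}"

definition limit_spectral_distribution ::
  "nat \<Rightarrow> (nat \<Rightarrow> ('v, 'x::finite, 's::finite) xs_graph) \<Rightarrow> 'v kernel_seq \<Rightarrow> real \<Rightarrow> real" where
  "limit_spectral_distribution d G B t = vn_trace d G (spectral_projection_upto d G B t)"

text \<open>The probability measure on the real line with distribution function \<open>F\<close>.\<close>

definition distribution_with_cdf :: "(real \<Rightarrow> real) \<Rightarrow> real measure" where
  "distribution_with_cdf F = (THE M. real_distribution M \<and> (\<forall>t. measure M {..t} = F t))"

end

theory Submission
  imports Defs "HOL-Probability.Helly_Selection"
begin

text \<open>
  The powers of \<open>B\<close> are again weakly convergent operator sequences, so the \<open>j\<close>-th moment of the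
  eigenvalue distribution of \<open>B\<^sub>n\<close>, which is the normalized trace of \<open>B\<^sub>n\<^sup>j\<close>, converges to
  \<open>\<langle>[B]\<^sup>j 1, 1\<rangle>\<close>.  All eigenvalues lie in one interval \<open>[-K, K]\<close>, because \<open>B\<close> is uniformly bounded
  and the balls of radius \<open>s\<close> have bounded size; on such an interval convergence of moments is weak
  convergence.

  It remains to see that the moments \<open>\<langle>[B]\<^sup>j 1, 1\<rangle>\<close> are those of the spectral measure of \<open>[B]\<close>, and
  here the finite matrices also yield the spectral theorem.  For every vector \<open>x\<close> of the completion,
  \<open>\<langle>[B]\<^sup>j x, x\<rangle>\<close> is a limit of moments of atomic measures on \<open>[-K, K]\<close>, hence by Helly's theorem
  the moment sequence of a measure \<open>\<mu> x\<close>.  Since \<open>\<parallel>p([B]) x\<parallel>\<close> is the norm of \<open>p\<close> in \<open>L\<^sup>2(\<mu> x)\<close>,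
  approximating an indicator function by polynomials in \<open>L\<^sup>2(\<mu> x)\<close> produces the spectral projections.
  An arbitrary spectral resolution \<open>P\<close> has the same distribution functions, by comparing the sign of
  \<open>[B] - a\<close> on the ranges of \<open>P(A)\<close> and of its complement.
\<close>

section \<open>Measures on a bounded interval and their moments\<close>

text \<open>\<open>spectral_projection\<close> is a choice, so the claim contains the spectral
  theorem: a resolution must exist for the choice to mean anything, and the chosen one need not be
  the constructed one. Equality on half-lines suffices, because only distribution functions are
  compared. The Hilbert space is a set depending on \<open>G\<close> with operations given by a
  record, so its theory is developed from the inner product alone. Positivity comes from the
  matrices: <[B]^j [A], [A]> is a limit in n of moments of positive combinations of point masses at
  the eigenvalues of B_n. Being such a limit survives both the limit in n and the passage to Cauchy
  sequences. The constant \<open>K\<close> bounds the absolute row sums of all B_n; for a kernel of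
  range s bounded by m it is (d+1)^s m. On the side of graphs the obstacle is that vertices of rare
  ball type obey no invariance condition. They are kept as exceptional vertices, and it is shown
  that they never occur near a root whose larger ball has a frequent type, so that products and
  adjoints remain determined by ball types.\<close>

definition supported_measure :: "real \<Rightarrow> real measure \<Rightarrow> bool" where
  "supported_measure K M \<longleftrightarrow> finite_borel_measure M \<and> (AE t in M. \<bar>t\<bar> \<le> K)"

lemma supported_AE:
  assumes "supported_measure K M" "\<And>t. \<bar>t\<bar> \<le> K \<Longrightarrow> P t"
  shows "AE t in M. P t"
  using assms by (auto simp: supported_measure_def elim: eventually_mono)

lemma supported_measurable:
  assumes "supported_measure K M" "f \<in> borel_measurable borel"
  shows "f \<in> borel_measurable M"
  using assms
  by (auto simp: supported_measure_def finite_borel_measure_def finite_borel_measure_axioms_def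
      cong: measurable_cong_sets)

lemma supported_integrable:
  fixes f :: "real \<Rightarrow> real"
  assumes M: "supported_measure K M" and f: "f \<in> borel_measurable borel"
    and b: "\<And>t. \<bar>t\<bar> \<le> K \<Longrightarrow> \<bar>f t\<bar> \<le> C"
  shows "integrable M f"
proof -
  interpret finite_borel_measure M using M by (simp add: supported_measure_def)
  have "AE t in M. norm (f t) \<le> C"
    using b by (intro supported_AE[OF M]) auto
  then show ?thesis
    by (intro integrable_const_bound[of _ C] supported_measurable[OF M f])
qed

lemma continuous_bounded_on_interval:
  fixes f :: "real \<Rightarrow> real"
  assumes "continuous_on UNIV f"
  obtains C where "\<And>t. \<bar>t\<bar> \<le> K \<Longrightarrow> \<bar>f t\<bar> \<le> C"
proof -
  have "compact (f ` {-K..K})"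
    using assms by (intro compact_continuous_image) (auto intro: continuous_on_subset)
  then have "bounded (f ` {-K..K})" by (rule compact_imp_bounded)
  then obtain C where "\<forall>t\<in>{-K..K}. \<bar>f t\<bar> \<le> C"
    by (auto simp: bounded_iff)
  then show ?thesis using that[of C] by (simp add: abs_le_iff)
qed

lemma supported_integrable_continuous:
  fixes f :: "real \<Rightarrow> real"
  assumes M: "supported_measure K M" and f: "continuous_on UNIV f"
  shows "integrable M f"
proof -
  obtain C where "\<And>t. \<bar>t\<bar> \<le> K \<Longrightarrow> \<bar>f t\<bar> \<le> C"
    using continuous_bounded_on_interval[OF f] by blast
  then show ?thesis
    by (rule supported_integrable[OF M borel_measurable_continuous_onI[OF f]])
qed

lemma supported_integral_bound:
  fixes f g :: "real \<Rightarrow> real"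
  assumes M: "supported_measure K M" and f: "integrable M f" and g: "integrable M g"
    and b: "\<And>t. \<bar>t\<bar> \<le> K \<Longrightarrow> \<bar>f t - g t\<bar> \<le> C"
  shows "\<bar>integral\<^sup>L M f - integral\<^sup>L M g\<bar> \<le> C * measure M UNIV"
proof -
  interpret finite_borel_measure M using M by (simp add: supported_measure_def)
  have "\<bar>integral\<^sup>L M f - integral\<^sup>L M g\<bar> = \<bar>\<integral>t. f t - g t \<partial>M\<bar>"
    using f g by simp
  also have "\<dots> \<le> (\<integral>t. \<bar>f t - g t\<bar> \<partial>M)" by (rule integral_abs_bound)
  also have "\<dots> \<le> (\<integral>t. C \<partial>M)"
    using b f g by (intro integral_mono_AE supported_AE[OF M]) auto
  also have "\<dots> = C * measure M UNIV" by (simp add: borel_UNIV)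
  finally show ?thesis .
qed

text \<open>Weierstrass approximation in terms of \<open>poly\<close>, so that integrals reduce to
  finitely many moments by \<open>integral_poly_moments\<close>.\<close>

lemma polynomial_approximation:
  fixes f :: "real \<Rightarrow> real"
  assumes f: "continuous_on UNIV f" and e: "\<epsilon> > 0"
  obtains p where "\<And>t. \<bar>t\<bar> \<le> K \<Longrightarrow> \<bar>f t - poly p t\<bar> < \<epsilon>"
proof -
  have "continuous_on {-K..K} f" using f by (rule continuous_on_subset) simp
  then obtain g where g: "real_polynomial_function g" "\<And>x. x \<in> {-K..K} \<Longrightarrow> \<bar>f x - g x\<bar> < \<epsilon>"
    using Stone_Weierstrass_real_polynomial_function[of "{-K..K}" f \<epsilon>] e by auto
  obtain a n where an: "g = (\<lambda>x. \<Sum>i\<le>n. a i * x ^ i)"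
    using real_polynomial_function_imp_sum[OF g(1)] by auto
  have "poly (\<Sum>i\<le>n. monom (a i) i) t = g t" for t
    by (simp add: an poly_sum poly_monom)
  then show ?thesis using g(2) that[of "\<Sum>i\<le>n. monom (a i) i"] by (auto simp: abs_le_iff)
qed

lemma integral_poly_moments:
  assumes M: "supported_measure K M"
  shows "(\<integral>t. poly p t \<partial>M) = (\<Sum>j\<le>degree p. coeff p j * (\<integral>t. t ^ j \<partial>M))"
  unfolding poly_altdef
  by (subst Bochner_Integration.integral_sum)
    (auto intro!: supported_integrable_continuous[OF M] continuous_intros)

text \<open>On the common interval a test function is uniformly close to a polynomial, with an error
  that is the same for every n; the integral of the polynomial is a finite combination of
  moments.\<close>

lemma weak_conv_from_moments:
  assumes mu: "\<And>n. supported_measure K (\<mu> n)" "\<And>n. real_distribution (\<mu> n)"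
    and M: "supported_measure K M" "real_distribution M"
    and mom: "\<And>j. (\<lambda>n. \<integral>t. t ^ j \<partial>\<mu> n) \<longlonglongrightarrow> (\<integral>t. t ^ j \<partial>M)"
  shows "weak_conv_m \<mu> M"
proof (rule integral_bdd_continuous_conv_imp_weak_conv)
  show "real_distribution (\<mu> n)" for n by (rule mu)
  show "real_distribution M" by (rule M)
  fix f :: "real \<Rightarrow> real"
  assume "\<And>x. isCont f x"
  then have f: "continuous_on UNIV f" by (simp add: continuous_on_eq_continuous_at)
  have P: "(\<lambda>n. \<integral>t. poly p t \<partial>\<mu> n) \<longlonglongrightarrow> (\<integral>t. poly p t \<partial>M)" for p
    unfolding integral_poly_moments[OF mu(1)] integral_poly_moments[OF M(1)]
    by (intro tendsto_intros mom)
  show "(\<lambda>n. integral\<^sup>L (\<mu> n) f) \<longlonglongrightarrow> integral\<^sup>L M f"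
  proof (rule LIMSEQ_I)
    fix e :: real assume e: "0 < e"
    obtain p where p: "\<And>t. \<bar>t\<bar> \<le> K \<Longrightarrow> \<bar>f t - poly p t\<bar> < e/4"
      using polynomial_approximation[OF f, of "e/4"] e by auto
    obtain N where N: "\<And>n. n \<ge> N \<Longrightarrow> \<bar>(\<integral>t. poly p t \<partial>\<mu> n) - (\<integral>t. poly p t \<partial>M)\<bar> < e/4"
      using LIMSEQ_D[OF P, of "e/4"] e by auto
    have cp: "continuous_on UNIV (poly p)" by (intro continuous_intros)
    have b: "\<bar>integral\<^sup>L \<nu> f - (\<integral>t. poly p t \<partial>\<nu>)\<bar> \<le> e/4"
      if "supported_measure K \<nu>" "real_distribution \<nu>" for \<nu>
    proof -
      interpret real_distribution \<nu> by fact
      have "measure \<nu> UNIV = 1" using prob_space by (simp add: borel_UNIV)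
      then show ?thesis
        using supported_integral_bound[OF that(1) supported_integrable_continuous[OF that(1) f]
            supported_integrable_continuous[OF that(1) cp], of "e/4"] p
        by (auto simp: less_imp_le)
    qed
    have "norm (integral\<^sup>L (\<mu> n) f - integral\<^sup>L M f) < e" if "n \<ge> N" for n
      using b[OF mu, of n] b[OF M] N[OF that] e unfolding real_norm_def by argo
    then show "\<exists>N. \<forall>n\<ge>N. norm (integral\<^sup>L (\<mu> n) f - integral\<^sup>L M f) < e" by blast
  qed
qed

text \<open>Weak convergence tests only bounded continuous functions. The support is detected by a
  function \<open>h\<close> that vanishes exactly on the interval, and an unbounded \<open>f\<close>
  is replaced by its composition with clipping to [-K, K].\<close>

lemma weak_conv_supported:
  fixes f :: "real \<Rightarrow> real"
  assumes mu: "\<And>n. supported_measure K (\<mu> n)" "\<And>n. real_distribution (\<mu> n)"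
    and M: "real_distribution M" and conv: "weak_conv_m \<mu> M" and K: "0 \<le> K"
  shows "supported_measure K M"
    and "continuous_on UNIV f \<Longrightarrow> (\<lambda>n. \<integral>t. f t \<partial>\<mu> n) \<longlonglongrightarrow> (\<integral>t. f t \<partial>M)"
proof -
  interpret real_distribution M by fact
  define h where "h t = min 1 (max 0 (\<bar>t\<bar> - K))" for t :: real
  have hm: "h \<in> borel_measurable borel" unfolding h_def[abs_def] by measurable
  have "(\<lambda>n. \<integral>t. h t \<partial>\<mu> n) \<longlonglongrightarrow> (\<integral>t. h t \<partial>M)"
    by (rule weak_conv_imp_integral_bdd_continuous_conv[OF mu(2) M conv, of _ 1])
      (auto simp: h_def intro!: continuous_intros)
  moreover have "(\<integral>t. h t \<partial>\<mu> n) = 0" for n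
  proof -
    have "(\<integral>t. h t \<partial>\<mu> n) = (\<integral>t. 0 \<partial>\<mu> n)"
      by (intro integral_cong_AE supported_AE[OF mu(1)] supported_measurable[OF mu(1)] hm)
        (auto simp: h_def)
    then show ?thesis by simp
  qed
  ultimately have "(\<integral>t. h t \<partial>M) = 0" by (simp add: LIMSEQ_const_iff)
  moreover have "integrable M h"
    using hm by (intro integrable_const_bound[of _ 1]) (auto simp: h_def)
  ultimately have "AE t in M. h t = 0"
    by (subst (asm) integral_nonneg_eq_0_iff_AE) (auto simp: h_def)
  then have "AE t in M. \<bar>t\<bar> \<le> K"
    by (rule eventually_mono) (auto simp: h_def min_def max_def split: if_splits)
  then show sM: "supported_measure K M"
    by (simp add: supported_measure_def finite_borel_measure_M)
  assume f: "continuous_on UNIV f"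
  define g where "g t = f (max (-K) (min K t))" for t
  have cg: "continuous_on UNIV g"
    unfolding g_def by (intro continuous_on_compose2[OF f] continuous_intros) auto
  obtain C where C: "\<And>t. \<bar>t\<bar> \<le> K \<Longrightarrow> \<bar>f t\<bar> \<le> C"
    using continuous_bounded_on_interval[OF f] by blast
  have "norm (g t) \<le> C" for t unfolding g_def real_norm_def by (rule C) (use K in auto)
  then have "(\<lambda>n. \<integral>t. g t \<partial>\<mu> n) \<longlonglongrightarrow> (\<integral>t. g t \<partial>M)"
    using cg
    by (intro weak_conv_imp_integral_bdd_continuous_conv[OF mu(2) M conv, of _ C])
      (auto simp: continuous_on_eq_continuous_at)
  moreover have "(\<integral>t. g t \<partial>\<nu>) = (\<integral>t. f t \<partial>\<nu>)" if s: "supported_measure K \<nu>" for \<nu>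
  proof (rule integral_cong_AE)
    show "AE t in \<nu>. g t = f t"
      by (rule supported_AE[OF s]) (auto simp: g_def max_def min_def abs_le_iff dest: antisym)
  qed (use f cg in \<open>auto intro!: supported_measurable[OF s] borel_measurable_continuous_onI\<close>)
  ultimately show "(\<lambda>n. \<integral>t. f t \<partial>\<mu> n) \<longlonglongrightarrow> (\<integral>t. f t \<partial>M)"
    using mu(1) sM by simp
qed

section \<open>Atomic measures and the moment problem on an interval\<close>

definition atomic_measure :: "nat \<Rightarrow> (nat \<Rightarrow> real) \<Rightarrow> (nat \<Rightarrow> real) \<Rightarrow> real measure" where
  "atomic_measure N w l = distr (point_measure {..<N} (\<lambda>i. ennreal (w i))) borel l"

text \<open>Weights live on indices and not on values, so coinciding atoms \<open>l i\<close> are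
  not grouped; this is how eigenvalue multiplicities enter.\<close>

lemma atomic_measure:
  assumes w: "\<And>i. i < N \<Longrightarrow> 0 \<le> w i"
  shows "f \<in> borel_measurable borel \<Longrightarrow>
      (\<integral>t. f t \<partial>atomic_measure N w l) = (\<Sum>i<N. w i * (f (l i) :: real))"
    and "measure (atomic_measure N w l) {..t} = (\<Sum>i\<in>{i. i < N \<and> l i \<le> t}. w i)"
    and "(\<Sum>i<N. w i) = 1 \<Longrightarrow> real_distribution (atomic_measure N w l)"
    and "(\<And>i. i < N \<Longrightarrow> \<bar>l i\<bar> \<le> K) \<Longrightarrow> supported_measure K (atomic_measure N w l)"
proof -
  let ?P = "point_measure {..<N} (\<lambda>i. ennreal (w i))"
  have l: "l \<in> ?P \<rightarrow>\<^sub>M borel" by (simp add: point_measure_def)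
  have em: "emeasure ?P X = ennreal (\<Sum>i\<in>X. w i)" if "X \<subseteq> {..<N}" for X
    using that w by (subst emeasure_point_measure_finite) (auto intro!: sum_ennreal simp: finite_subset)
  have fin: "finite_measure ?P"
    by (rule finite_measureI) (simp add: em space_point_measure)
  show "(\<integral>t. f t \<partial>atomic_measure N w l) = (\<Sum>i<N. w i * f (l i))"
    if "f \<in> borel_measurable borel"
    unfolding atomic_measure_def integral_distr[OF l that]
    by (subst lebesgue_integral_point_measure_finite) (auto simp: w)
  have "measure (atomic_measure N w l) {..t} = measure ?P {i. i < N \<and> l i \<le> t}"
    unfolding atomic_measure_def
    by (subst measure_distr[OF l]) (auto simp: space_point_measure intro!: arg_cong[where f = "measure _"])
  also have "\<dots> = (\<Sum>i\<in>{i. i < N \<and> l i \<le> t}. w i)"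
    unfolding measure_def by (subst em) (auto intro!: sum_nonneg enn2real_ennreal w)
  finally show "measure (atomic_measure N w l) {..t} = (\<Sum>i\<in>{i. i < N \<and> l i \<le> t}. w i)" .
  show "real_distribution (atomic_measure N w l)" if "(\<Sum>i<N. w i) = 1"
  proof -
    interpret prob_space ?P by (rule prob_spaceI) (simp add: em space_point_measure that)
    show ?thesis unfolding atomic_measure_def using l by (intro real_distribution_distr) simp
  qed
  show "supported_measure K (atomic_measure N w l)" if "\<And>i. i < N \<Longrightarrow> \<bar>l i\<bar> \<le> K"
    unfolding supported_measure_def
  proof
    show "finite_borel_measure (atomic_measure N w l)"
      unfolding finite_borel_measure_def finite_borel_measure_axioms_def atomic_measure_def
      using finite_measure.finite_measure_distr[OF fin l] by simp
    show "AE t in atomic_measure N w l. \<bar>t\<bar> \<le> K"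
      unfolding atomic_measure_def using that
      by (subst AE_distr_iff[OF l]) (auto simp: AE_point_measure)
  qed
qed

definition moment_sequence :: "real \<Rightarrow> real measure \<Rightarrow> (nat \<Rightarrow> real) \<Rightarrow> bool" where
  "moment_sequence K M m \<longleftrightarrow> supported_measure K M \<and> (\<forall>j. (\<integral>t. t ^ j \<partial>M) = m j)"

text \<open>The pointwise closure of the moment sequences of atomic measures on [-K, K]. Closure
  under limits is then elementary, and a measure is produced only once, after all limits have been
  taken.\<close>

definition approximable_moments :: "real \<Rightarrow> (nat \<Rightarrow> real) \<Rightarrow> bool" where
  "approximable_moments K m \<longleftrightarrow> (\<forall>J. \<forall>\<epsilon>>0. \<exists>N w l. (\<forall>i<N. 0 \<le> w i \<and> \<bar>l i\<bar> \<le> K) \<and>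
     (\<forall>j\<le>J. \<bar>(\<Sum>i<(N::nat). w i * l i ^ j) - m j\<bar> < \<epsilon>))"

lemma approximable_moments_limit:
  assumes "\<And>n. approximable_moments K (m n)" and lim: "\<And>j. (\<lambda>n. m n j) \<longlonglongrightarrow> m' j"
  shows "approximable_moments K m'"
  unfolding approximable_moments_def
proof (intro allI impI)
  fix J and e :: real assume e: "0 < e"
  have "\<forall>\<^sub>F n in sequentially. \<forall>j\<in>{..J}. \<bar>m n j - m' j\<bar> < e/2"
    using e tendstoD[OF lim, of "e/2"] by (intro eventually_ball_finite) (auto simp: dist_real_def)
  then obtain n where n: "\<forall>j\<in>{..J}. \<bar>m n j - m' j\<bar> < e/2" by (auto simp: eventually_sequentially)
  obtain N w l where *: "\<forall>i<N. 0 \<le> w i \<and> \<bar>l i\<bar> \<le> K"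
    "\<forall>j\<le>J. \<bar>(\<Sum>i<(N::nat). w i * l i ^ j) - m n j\<bar> < e/2"
    using assms(1)[of n, unfolded approximable_moments_def, rule_format, of "e/2" J] e by auto
  have "\<forall>j\<le>J. \<bar>(\<Sum>i<(N::nat). w i * l i ^ j) - m' j\<bar> < e"
  proof (intro allI impI)
    fix j assume "j \<le> J"
    with * n have "\<bar>(\<Sum>i<(N::nat). w i * l i ^ j) - m n j\<bar> < e/2" "\<bar>m n j - m' j\<bar> < e/2" by auto
    then show "\<bar>(\<Sum>i<(N::nat). w i * l i ^ j) - m' j\<bar> < e" by argo
  qed
  with * show "\<exists>N w l. (\<forall>i<N. 0 \<le> w i \<and> \<bar>l i\<bar> \<le> K) \<and>
     (\<forall>j\<le>J. \<bar>(\<Sum>i<(N::nat). w i * l i ^ j) - m' j\<bar> < e)" by blast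
qed

text \<open>After normalization the approximating atomic measures are probability measures on one
  interval, hence tight. A weak limit of a subsequence has the right moments up to the factor
  \<open>m 0\<close>, which a constant density restores.\<close>

lemma moment_sequence_exists:
  assumes m: "approximable_moments K m" and K: "0 \<le> K"
  shows "\<exists>M. moment_sequence K M m"
proof -
  have "\<forall>k. \<exists>N w l. (\<forall>i<N. 0 \<le> w i \<and> \<bar>l i\<bar> \<le> K) \<and>
     (\<forall>j\<le>k. \<bar>(\<Sum>i<(N::nat). w i * l i ^ j) - m j\<bar> < inverse (real (Suc k)))"
    using m unfolding approximable_moments_def by simp
  from choice[OF this] obtain N where "\<forall>k. \<exists>w l. (\<forall>i<N k. 0 \<le> w i \<and> \<bar>l i\<bar> \<le> K) \<and>
     (\<forall>j\<le>k. \<bar>(\<Sum>i<(N k::nat). w i * l i ^ j) - m j\<bar> < inverse (real (Suc k)))" ..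
  from choice[OF this] obtain w where "\<forall>k. \<exists>l. (\<forall>i<N k. 0 \<le> w k i \<and> \<bar>l i\<bar> \<le> K) \<and>
     (\<forall>j\<le>k. \<bar>(\<Sum>i<(N k::nat). w k i * l i ^ j) - m j\<bar> < inverse (real (Suc k)))" ..
  from choice[OF this] obtain l where *: "\<forall>k. (\<forall>i<N k. 0 \<le> w k i \<and> \<bar>l k i\<bar> \<le> K) \<and>
     (\<forall>j\<le>k. \<bar>(\<Sum>i<(N k::nat). w k i * l k i ^ j) - m j\<bar> < inverse (real (Suc k)))" ..
  have w: "\<And>k i. i < N k \<Longrightarrow> 0 \<le> w k i" and l: "\<And>k i. i < N k \<Longrightarrow> \<bar>l k i\<bar> \<le> K"
    and ap: "\<And>j k. j \<le> k \<Longrightarrow> \<bar>(\<Sum>i<N k. w k i * l k i ^ j) - m j\<bar> < inverse (real (Suc k))"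
    using * by auto
  have lim: "(\<lambda>k. \<Sum>i<N k. w k i * l k i ^ j) \<longlonglongrightarrow> m j" for j
  proof -
    have "(\<lambda>k. (\<Sum>i<N k. w k i * l k i ^ j) - m j) \<longlonglongrightarrow> 0"
    proof (rule Lim_null_comparison[OF _ LIMSEQ_inverse_real_of_nat])
      show "\<forall>\<^sub>F k in sequentially. norm ((\<Sum>i<N k. w k i * l k i ^ j) - m j) \<le> inverse (real (Suc k))"
        unfolding real_norm_def
        by (rule eventually_sequentiallyI[of j], rule less_imp_le, rule ap)
    qed
    then show ?thesis by (simp add: LIM_zero_iff)
  qed
  define W where "W k = (\<Sum>i<N k. w k i)" for k
  have W: "W \<longlonglongrightarrow> m 0" using lim[of 0] by (simp add: W_def[abs_def])
  have W0: "0 \<le> W k" for k by (auto simp: W_def intro: sum_nonneg w)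
  have "0 \<le> m 0" by (rule LIMSEQ_le_const[OF W]) (use W0 in auto)
  show ?thesis
  \<comment> \<open>Mass 0 cannot be normalized. In that case all moments vanish, since the j-th one
    is bounded by the mass times K^j, and the null measure serves.\<close>
  proof (cases "m 0 = 0")
    case True
    have "m j = 0" for j
    proof -
      have le: "norm (\<Sum>i<N k. w k i * l k i ^ j) \<le> W k * K ^ j" for k
        unfolding W_def sum_distrib_right real_norm_def using w l
        by (intro sum_abs[THEN order_trans] sum_mono)
          (auto simp: abs_mult power_abs intro!: mult_left_mono power_mono)
      have "(\<lambda>k. W k * K ^ j) \<longlonglongrightarrow> 0"
        using tendsto_mult_right[OF W, of "K ^ j"] True by simp
      then have "(\<lambda>k. \<Sum>i<N k. w k i * l k i ^ j) \<longlonglongrightarrow> 0"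
        by (rule Lim_null_comparison[OF always_eventually[OF allI[OF le]]])
      then show ?thesis by (rule LIMSEQ_unique[OF lim])
    qed
    moreover have "finite_borel_measure (null_measure borel)"
      unfolding finite_borel_measure_def finite_borel_measure_axioms_def
      by (simp add: finite_measureI)
    moreover have "AE t in null_measure borel. \<bar>t\<bar> \<le> K"
      by (rule AE_I[of _ _ UNIV]) simp_all
    ultimately have "moment_sequence K (null_measure borel) m"
      by (simp add: moment_sequence_def supported_measure_def)
    then show ?thesis by blast
  next
    case False
    with \<open>0 \<le> m 0\<close> have m0: "0 < m 0" by simp
    have "\<forall>\<^sub>F k in sequentially. 0 < W k" by (rule order_tendstoD(1)[OF W m0])
    then obtain k0 where k0: "\<And>k. k \<ge> k0 \<Longrightarrow> 0 < W k"
      unfolding eventually_sequentially by blast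
    \<comment> \<open>The masses \<open>W k\<close> are known to be positive only from
      \<open>k0\<close> on, hence the shift.\<close>
    define \<mu> where "\<mu> k = atomic_measure (N (k + k0)) (\<lambda>i. w (k + k0) i / W (k + k0)) (l (k + k0))" for k
    have nn: "i < N (k + k0) \<Longrightarrow> 0 \<le> w (k + k0) i / W (k + k0)" for k i
      using w W0 by simp
    have rd: "real_distribution (\<mu> k)" for k
      unfolding \<mu>_def
      by (rule atomic_measure(3)[OF nn]) (use k0[of "k + k0"] in
          \<open>auto simp: sum_divide_distrib[symmetric] W_def[symmetric]\<close>)
    have sp: "supported_measure K (\<mu> k)" for k
      unfolding \<mu>_def by (rule atomic_measure(4)[OF nn]) (auto intro: l)
    have mom: "(\<lambda>k. \<integral>t. t ^ j \<partial>\<mu> k) \<longlonglongrightarrow> m j / m 0" for j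
    proof -
      have "(\<integral>t. t ^ j \<partial>\<mu> k) = (\<Sum>i<N (k+k0). w (k+k0) i * l (k+k0) i ^ j) / W (k + k0)" for k
        unfolding \<mu>_def by (subst atomic_measure(1)[OF nn]) (auto simp: sum_divide_distrib)
      moreover have "(\<lambda>k. (\<Sum>i<N k. w k i * l k i ^ j) / W k) \<longlonglongrightarrow> m j / m 0"
        using lim W m0 by (intro tendsto_divide) auto
      ultimately show ?thesis using LIMSEQ_ignore_initial_segment[where k = k0] by simp
    qed
    have t: "tight \<mu>"
      unfolding tight_def
    proof (intro conjI allI impI rd)
      fix e :: real assume e: "0 < e"
      \<comment> \<open>\<open>tight\<close> is phrased with half-open intervals, so the left end is
        moved below -K to keep a possible atom there.\<close>
      have "measure (\<mu> n) {-K-1<..K} = 1" for n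
      proof -
        interpret real_distribution "\<mu> n" by (rule rd)
        have "AE t in \<mu> n. t \<in> {-K-1<..K}"
          by (rule supported_AE[OF sp]) auto
        then show ?thesis by (subst prob_eq_1) auto
      qed
      then show "\<exists>a b. a < b \<and> (\<forall>n. 1 - e < measure (\<mu> n) {a<..b})"
        using e K by (intro exI[of _ "-K-1"] exI[of _ K]) auto
    qed
    obtain r M where r: "strict_mono (r :: nat \<Rightarrow> nat)" and M: "real_distribution M"
      and conv: "weak_conv_m (\<mu> \<circ> id \<circ> r) M"
      using tight_imp_convergent_subsubsequence[OF t strict_mono_id] by (elim exE conjE)
    have c: "weak_conv_m (\<lambda>k. \<mu> (r k)) M" using conv by (simp add: comp_def)
    note wc = weak_conv_supported[OF sp rd M c K]
    interpret R: real_distribution M by (rule M)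
    have MM: "(\<integral>t. t ^ j \<partial>M) = m j / m 0" for j
    proof -
      have cj: "continuous_on UNIV (\<lambda>t::real. t ^ j)"
        by (rule continuous_on_power[OF continuous_on_id])
      have "(\<lambda>k. \<integral>t. t ^ j \<partial>\<mu> (r k)) \<longlonglongrightarrow> m j / m 0"
        using LIMSEQ_subseq_LIMSEQ[OF mom[of j] r] by (simp add: comp_def)
      then show ?thesis by (rule LIMSEQ_unique[OF wc(2)[OF cj]])
    qed
    define M' where "M' = density M (\<lambda>_. ennreal (m 0))"
    have "finite_borel_measure M'"
      unfolding finite_borel_measure_def finite_borel_measure_axioms_def M'_def
      by (auto intro!: finite_measureI simp: emeasure_density R.emeasure_eq_measure
          ennreal_mult_eq_top_iff)
    moreover have "AE t in M'. \<bar>t\<bar> \<le> K"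
      unfolding M'_def by (subst AE_density) (auto intro: supported_AE[OF wc(1)])
    moreover have "(\<integral>t. t ^ j \<partial>M') = m j" for j
      unfolding M'_def using m0 MM by (subst integral_density) auto
    ultimately show ?thesis unfolding moment_sequence_def supported_measure_def by blast
  qed
qed


section \<open>Polynomial approximation of indicators in L^2\<close>

definition bounded_measurable_on :: "real \<Rightarrow> (real \<Rightarrow> real) \<Rightarrow> bool" where
  "bounded_measurable_on K f \<longleftrightarrow>
     f \<in> borel_measurable borel \<and> (\<exists>C. \<forall>t. \<bar>t\<bar> \<le> K \<longrightarrow> \<bar>f t\<bar> \<le> C)"

lemma bounded_measurable_on_integrable:
  "supported_measure K M \<Longrightarrow> bounded_measurable_on K f \<Longrightarrow> integrable M f"
  unfolding bounded_measurable_on_def using supported_integrable by blast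

lemma bounded_measurable_on_continuous:
  assumes "continuous_on UNIV f" shows "bounded_measurable_on K f"
proof -
  obtain C where "\<And>t. \<bar>t\<bar> \<le> K \<Longrightarrow> \<bar>f t\<bar> \<le> C"
    using continuous_bounded_on_interval[OF assms] by blast
  then show ?thesis
    using borel_measurable_continuous_onI[OF assms] by (auto simp: bounded_measurable_on_def)
qed

lemma bounded_measurable_on_poly: "bounded_measurable_on K (poly p)"
  by (intro bounded_measurable_on_continuous continuous_intros)

lemma bounded_measurable_on_indicator:
  "A \<in> sets borel \<Longrightarrow> bounded_measurable_on K (indicator A)"
  unfolding bounded_measurable_on_def by (auto intro!: exI[of _ 1] simp: indicator_def)

lemma bounded_measurable_on_arith:
  assumes "bounded_measurable_on K f" "bounded_measurable_on K g"
  shows "bounded_measurable_on K (\<lambda>t. f t + g t)" "bounded_measurable_on K (\<lambda>t. f t - g t)"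
    "bounded_measurable_on K (\<lambda>t. f t * g t)"
proof -
  obtain C D where C: "\<And>t. \<bar>t\<bar> \<le> K \<Longrightarrow> \<bar>f t\<bar> \<le> C" and D: "\<And>t. \<bar>t\<bar> \<le> K \<Longrightarrow> \<bar>g t\<bar> \<le> D"
    using assms by (auto simp: bounded_measurable_on_def)
  have "\<bar>f t * g t\<bar> \<le> \<bar>C\<bar> * \<bar>D\<bar>" if "\<bar>t\<bar> \<le> K" for t
    unfolding abs_mult using C[OF that] D[OF that] by (intro mult_mono) auto
  moreover have "\<bar>f t + g t\<bar> \<le> C + D" "\<bar>f t - g t\<bar> \<le> C + D" if "\<bar>t\<bar> \<le> K" for t
    using C[OF that] D[OF that] by auto
  ultimately show "bounded_measurable_on K (\<lambda>t. f t + g t)" "bounded_measurable_on K (\<lambda>t. f t - g t)"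
    "bounded_measurable_on K (\<lambda>t. f t * g t)"
    using assms unfolding bounded_measurable_on_def by auto
qed

lemma bounded_measurable_on_square_diff:
  "bounded_measurable_on K f \<Longrightarrow> bounded_measurable_on K g \<Longrightarrow>
    bounded_measurable_on K (\<lambda>t. (f t - g t)\<^sup>2)"
  unfolding power2_eq_square by (intro bounded_measurable_on_arith)

text \<open>One polynomial must serve all measures in \<open>F\<close>: linearity of the spectral
  projections is proved by applying the same polynomials to x, y and x + y.\<close>

definition poly_l2_approximable :: "real measure set \<Rightarrow> (real \<Rightarrow> real) \<Rightarrow> bool" where
  "poly_l2_approximable F f \<longleftrightarrow> (\<forall>\<epsilon>>0. \<exists>p. \<forall>M\<in>F. (\<integral>t. (poly p t - f t)\<^sup>2 \<partial>M) < \<epsilon>)"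

text \<open>Stands in for the triangle inequality in L^2, by way of 2 |f| |g| \<le> f^2 +
  g^2.\<close>

lemma integral_square_add_le:
  assumes M: "supported_measure K M" and f: "bounded_measurable_on K f"
    and g: "bounded_measurable_on K g" and h: "bounded_measurable_on K h"
    and le: "\<And>t. \<bar>t\<bar> \<le> K \<Longrightarrow> \<bar>h t\<bar> \<le> \<bar>f t\<bar> + \<bar>g t\<bar>"
  shows "(\<integral>t. (h t)\<^sup>2 \<partial>M) \<le> 2 * (\<integral>t. (f t)\<^sup>2 \<partial>M) + 2 * (\<integral>t. (g t)\<^sup>2 \<partial>M)"
proof -
  have i: "integrable M (\<lambda>t. (u t)\<^sup>2)" if "bounded_measurable_on K u" for u
    unfolding power2_eq_square
    using that by (intro bounded_measurable_on_integrable[OF M] bounded_measurable_on_arith)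
  have "(\<integral>t. (h t)\<^sup>2 \<partial>M) \<le> (\<integral>t. 2 * (f t)\<^sup>2 + 2 * (g t)\<^sup>2 \<partial>M)"
  proof (rule integral_mono_AE)
    show "AE t in M. (h t)\<^sup>2 \<le> 2 * (f t)\<^sup>2 + 2 * (g t)\<^sup>2"
    proof (rule supported_AE[OF M])
      fix t assume "\<bar>t\<bar> \<le> K"
      then have "(h t)\<^sup>2 \<le> (\<bar>f t\<bar> + \<bar>g t\<bar>)\<^sup>2"
        using le[of t] abs_le_square_iff[of "h t" "\<bar>f t\<bar> + \<bar>g t\<bar>"] by simp
      moreover have "0 \<le> (\<bar>f t\<bar> - \<bar>g t\<bar>)\<^sup>2" by simp
      ultimately show "(h t)\<^sup>2 \<le> 2 * (f t)\<^sup>2 + 2 * (g t)\<^sup>2"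
        by (simp add: power2_sum power2_diff)
    qed
  qed (use i f g h in auto)
  also have "\<dots> = 2 * (\<integral>t. (f t)\<^sup>2 \<partial>M) + 2 * (\<integral>t. (g t)\<^sup>2 \<partial>M)"
    using i f g by simp
  finally show ?thesis .
qed

lemma poly_l2_approximable_closure:
  assumes F: "\<And>M. M \<in> F \<Longrightarrow> supported_measure K M" and f: "bounded_measurable_on K f"
    and app: "\<And>\<epsilon>. 0 < \<epsilon> \<Longrightarrow> \<exists>g. bounded_measurable_on K g \<and> poly_l2_approximable F g \<and>
      (\<forall>M\<in>F. (\<integral>t. (g t - f t)\<^sup>2 \<partial>M) < \<epsilon>)"
  shows "poly_l2_approximable F f"
  unfolding poly_l2_approximable_def
proof (intro allI impI)
  fix e :: real assume e: "0 < e"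
  \<comment> \<open>Quarters, because \<open>integral_square_add_le\<close> doubles both
    errors.\<close>
  obtain g where g: "bounded_measurable_on K g" "poly_l2_approximable F g"
    "\<And>M. M \<in> F \<Longrightarrow> (\<integral>t. (g t - f t)\<^sup>2 \<partial>M) < e/4"
    using app[of "e/4"] e by auto
  obtain p where p: "\<And>M. M \<in> F \<Longrightarrow> (\<integral>t. (poly p t - g t)\<^sup>2 \<partial>M) < e/4"
    using g(2)[unfolded poly_l2_approximable_def, rule_format, of "e/4"] e by auto
  have "(\<integral>t. (poly p t - f t)\<^sup>2 \<partial>M) < e" if M: "M \<in> F" for M
  proof -
    have "(\<integral>t. (poly p t - f t)\<^sup>2 \<partial>M)
      \<le> 2 * (\<integral>t. (poly p t - g t)\<^sup>2 \<partial>M) + 2 * (\<integral>t. (g t - f t)\<^sup>2 \<partial>M)"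
      by (rule integral_square_add_le[OF F[OF M]])
        (auto intro!: bounded_measurable_on_arith bounded_measurable_on_poly f g)
    with p[OF M] g(3)[OF M] show ?thesis by argo
  qed
  then show "\<exists>p. \<forall>M\<in>F. (\<integral>t. (poly p t - f t)\<^sup>2 \<partial>M) < e" by blast
qed

lemma poly_l2_approximable_add:
  assumes F: "\<And>M. M \<in> F \<Longrightarrow> supported_measure K M"
    and f: "bounded_measurable_on K f" "poly_l2_approximable F f"
    and g: "bounded_measurable_on K g" "poly_l2_approximable F g"
  shows "poly_l2_approximable F (\<lambda>t. f t + g t)"
  unfolding poly_l2_approximable_def
proof (intro allI impI)
  fix e :: real assume e: "0 < e"
  obtain p where p: "\<And>M. M \<in> F \<Longrightarrow> (\<integral>t. (poly p t - f t)\<^sup>2 \<partial>M) < e/4"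
    using f(2)[unfolded poly_l2_approximable_def, rule_format, of "e/4"] e by auto
  obtain q where q: "\<And>M. M \<in> F \<Longrightarrow> (\<integral>t. (poly q t - g t)\<^sup>2 \<partial>M) < e/4"
    using g(2)[unfolded poly_l2_approximable_def, rule_format, of "e/4"] e by auto
  have "(\<integral>t. (poly (p + q) t - (f t + g t))\<^sup>2 \<partial>M) < e" if M: "M \<in> F" for M
  proof -
    have "(\<integral>t. (poly (p + q) t - (f t + g t))\<^sup>2 \<partial>M)
      \<le> 2 * (\<integral>t. (poly p t - f t)\<^sup>2 \<partial>M) + 2 * (\<integral>t. (poly q t - g t)\<^sup>2 \<partial>M)"
      by (rule integral_square_add_le[OF F[OF M]])
        (auto intro!: bounded_measurable_on_arith bounded_measurable_on_poly f g)
    with p[OF M] q[OF M] show ?thesis by argo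
  qed
  then show "\<exists>p. \<forall>M\<in>F. (\<integral>t. (poly p t - (f t + g t))\<^sup>2 \<partial>M) < e" by blast
qed

lemma poly_l2_approximable_continuous:
  assumes F: "\<And>M. M \<in> F \<Longrightarrow> supported_measure K M" and fin: "finite F"
    and f: "continuous_on UNIV f"
  shows "poly_l2_approximable F f"
  unfolding poly_l2_approximable_def
proof (intro allI impI)
  fix e :: real assume e: "0 < e"
  define S where "S = (\<Sum>M\<in>F. measure M UNIV) + 1"
  have "0 \<le> (\<Sum>M\<in>F. measure M UNIV)" by (rule sum_nonneg) simp
  moreover have "measure M UNIV \<le> (\<Sum>M\<in>F. measure M UNIV)" if "M \<in> F" for M
    using that fin by (intro member_le_sum) auto
  ultimately have S: "0 < S" "\<And>M. M \<in> F \<Longrightarrow> measure M UNIV < S"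
    unfolding S_def by fastforce+
  \<comment> \<open>A uniform error \<delta> costs at most \<delta>^2 S = e/2 in every measure of
    \<open>F\<close>.\<close>
  define \<delta> where "\<delta> = sqrt (e / (2 * S))"
  have \<delta>: "0 < \<delta>" "\<delta>\<^sup>2 = e / (2 * S)" using e S by (auto simp: \<delta>_def)
  obtain p where p: "\<And>t. \<bar>t\<bar> \<le> K \<Longrightarrow> \<bar>f t - poly p t\<bar> < \<delta>"
    using polynomial_approximation[OF f \<delta>(1)] by blast
  have "(\<integral>t. (poly p t - f t)\<^sup>2 \<partial>M) < e" if M: "M \<in> F" for M
  proof -
    note sM = F[OF M]
    have "\<bar>(\<integral>t. (poly p t - f t)\<^sup>2 \<partial>M) - (\<integral>t. 0 \<partial>M)\<bar> \<le> \<delta>\<^sup>2 * measure M UNIV"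
    proof (rule supported_integral_bound[OF sM])
      show "integrable M (\<lambda>t. (poly p t - f t)\<^sup>2)"
        by (intro bounded_measurable_on_integrable[OF sM] bounded_measurable_on_square_diff
            bounded_measurable_on_poly bounded_measurable_on_continuous f)
      fix t assume "\<bar>t\<bar> \<le> K"
      from p[OF this] show "\<bar>(poly p t - f t)\<^sup>2 - 0\<bar> \<le> \<delta>\<^sup>2"
        using \<delta>(1) by (simp add: abs_le_square_iff[symmetric] abs_minus_commute)
    qed simp
    also have "\<dots> \<le> \<delta>\<^sup>2 * S" using S(2)[OF M] by (intro mult_left_mono) auto
    also have "\<dots> < e" using e S(1) by (simp add: \<delta>(2))
    finally show ?thesis by simp
  qed
  then show "\<exists>p. \<forall>M\<in>F. (\<integral>t. (poly p t - f t)\<^sup>2 \<partial>M) < e" by blast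
qed

text \<open>The error is dominated by indicators of sets that decrease to the empty set, so
  continuity from above makes it small for each measure; since \<open>F\<close> is finite, one index
  works for all of them.\<close>

lemma poly_l2_approximable_indicator_seq:
  assumes F: "\<And>M. M \<in> F \<Longrightarrow> supported_measure K M" and fin: "finite F"
    and A: "A \<in> sets borel"
    and g: "\<And>n::nat. bounded_measurable_on K (g n)" "\<And>n. poly_l2_approximable F (g n)"
    and D: "\<And>n. D n \<in> sets borel" "\<And>n t. \<bar>g n t - indicator A t\<bar> \<le> (indicator (D n) t :: real)"
    and dec: "decseq D" "(\<Inter>n. D n) = {}"
  shows "poly_l2_approximable F (indicator A)"
proof (rule poly_l2_approximable_closure[OF F bounded_measurable_on_indicator[OF A]])
  fix e :: real assume e: "0 < e"
  have "\<forall>\<^sub>F n in sequentially. \<forall>M\<in>F. (\<integral>t. (g n t - indicator A t)\<^sup>2 \<partial>M) < e"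
  proof (rule eventually_ball_finite[OF fin], rule ballI)
    fix M assume "M \<in> F"
    note sM = F[OF this]
    interpret finite_borel_measure M using sM by (simp add: supported_measure_def)
    have "(\<lambda>n. measure M (D n)) \<longlonglongrightarrow> measure M (\<Inter>n. D n)"
      by (rule finite_Lim_measure_decseq) (use D dec in auto)
    then have "\<forall>\<^sub>F n in sequentially. measure M (D n) < e"
      by (rule order_tendstoD) (use dec e in simp)
    then show "\<forall>\<^sub>F n in sequentially. (\<integral>t. (g n t - indicator A t)\<^sup>2 \<partial>M) < e"
    proof eventually_elim
      case (elim n)
      have "(\<integral>t. (g n t - indicator A t)\<^sup>2 \<partial>M) \<le> (\<integral>t. indicator (D n) t \<partial>M)"
      proof (rule integral_mono)
        show "integrable M (\<lambda>t. (g n t - indicator A t)\<^sup>2)"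
          by (intro bounded_measurable_on_integrable[OF sM] bounded_measurable_on_square_diff
              bounded_measurable_on_indicator g A)
        show "integrable M (\<lambda>t. indicator (D n) t :: real)"
          by (intro bounded_measurable_on_integrable[OF sM] bounded_measurable_on_indicator D)
        fix t
        have "(g n t - indicator A t)\<^sup>2 \<le> (indicator (D n) t :: real)\<^sup>2"
          using D(2)[of n t] by (simp add: abs_le_square_iff[symmetric])
        then show "(g n t - indicator A t)\<^sup>2 \<le> (indicator (D n) t :: real)"
          by (cases "t \<in> D n") simp_all
      qed
      with elim show ?case by (simp add: borel_UNIV)
    qed
  qed
  then obtain n where "\<forall>M\<in>F. (\<integral>t. (g n t - indicator A t)\<^sup>2 \<partial>M) < e"
    by (auto simp: eventually_sequentially)
  then show "\<exists>g. bounded_measurable_on K g \<and> poly_l2_approximable F g \<and>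
      (\<forall>M\<in>F. (\<integral>t. (g t - indicator A t)\<^sup>2 \<partial>M) < e)"
    using g by blast
qed

text \<open>Dynkin's argument: half-lines form an intersection-stable generator, and the sets with
  approximable indicator are closed under complements and countable disjoint unions.\<close>

lemma poly_l2_approximable_indicator:
  assumes F: "\<And>M. M \<in> F \<Longrightarrow> supported_measure K M" and fin: "finite F"
    and A: "A \<in> sets borel"
  shows "poly_l2_approximable F (indicator A)"
proof -
  let ?G = "range (\<lambda>a::real. {..a})"
  have bs: "sets borel = sigma_sets UNIV ?G"
    unfolding borel_eq_atMost by (subst sets_measure_of) auto
  have "Int_stable ?G" by (auto simp: Int_stable_def)
  moreover have "?G \<subseteq> Pow UNIV" by simp
  moreover have "A \<in> sigma_sets UNIV ?G" using A bs by simp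
  ultimately show ?thesis
  proof (induction rule: sigma_sets_induct_disjoint)
    case (basic A)
    then obtain a where a: "A = {..a}" by auto
    \<comment> \<open>The approximants fall linearly from 1 to 0 between \<open>a\<close> and
      \<open>b n\<close>, so the error lives on {a<..b n}, which shrinks to the empty set.\<close>
    define b where "b n = a + inverse (real (Suc n))" for n
    have ab: "a < b n" for n by (simp add: b_def)
    have c: "continuous_on UNIV (cts_step a (b n))" for n
      using cts_step_uniformly_continuous[OF ab] by (rule uniformly_continuous_imp_continuous)
    show ?case unfolding a
    proof (rule poly_l2_approximable_indicator_seq[OF F fin, where g = "\<lambda>n. cts_step a (b n)"
          and D = "\<lambda>n. {a<..b n}"])
      show "bounded_measurable_on K (cts_step a (b n))" for n
        by (rule bounded_measurable_on_continuous[OF c])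
      show "poly_l2_approximable F (cts_step a (b n))" for n
        by (rule poly_l2_approximable_continuous[OF F fin c])
      show "\<bar>cts_step a (b n) t - indicator {..a} t\<bar> \<le> indicator {a<..b n} t" for n t
      proof -
        have "0 \<le> (b n - t) / (b n - a) \<and> (b n - t) / (b n - a) \<le> 1" if "a < t" "t \<le> b n"
          using that by simp
        then show ?thesis using ab[of n] by (simp add: cts_step_def indicator_def)
      qed
      show "decseq (\<lambda>n. {a<..b n})"
        unfolding decseq_Suc_iff
      proof
        fix n
        have "b (Suc n) \<le> b n" unfolding b_def by (intro add_left_mono le_imp_inverse_le) auto
        then show "{a<..b (Suc n)} \<subseteq> {a<..b n}" by auto
      qed
      show "(\<Inter>n. {a<..b n}) = {}"
      proof (rule equals0I)
        fix t assume t: "t \<in> (\<Inter>n. {a<..b n})"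
        have ta: "a < t" "t \<le> b n" for n using INT_D[OF t UNIV_I, of n] by auto
        then have "0 < t - a" by simp
        then obtain n where "inverse (real (Suc n)) < t - a" using reals_Archimedean by blast
        then have "b n < t" by (simp add: b_def)
        with ta(2)[of n] show False by simp
      qed
    qed auto
  next
    case empty
    show ?case unfolding poly_l2_approximable_def by (intro allI impI exI[of _ 0]) simp
  next
    case (compl A)
    have "(indicator (UNIV - A) t :: real) = poly [:1:] t - indicator A t" for t :: real
      by (simp add: indicator_def)
    show ?case unfolding poly_l2_approximable_def
    proof (intro allI impI)
      fix e :: real assume "0 < e"
      then obtain p where p: "\<forall>M\<in>F. (\<integral>t. (poly p t - indicator A t)\<^sup>2 \<partial>M) < e"
        using compl.IH unfolding poly_l2_approximable_def by blast
      have "(poly ([:1:] - p) t - indicator (UNIV - A) t)\<^sup>2 = (poly p t - indicator A t)\<^sup>2" for t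
        by (auto simp: indicator_def power2_commute)
      with p show "\<exists>p. \<forall>M\<in>F. (\<integral>t. (poly p t - indicator (UNIV - A) t)\<^sup>2 \<partial>M) < e"
        by (intro exI[of _ "[:1:] - p"]) simp
    qed
  next
    case (union A)
    have Am: "A n \<in> sets borel" for n
      unfolding bs by (rule subsetD[OF union(2) rangeI])
    have ps: "bounded_measurable_on K (\<lambda>t. \<Sum>i<n. indicator (A i) t) \<and>
        poly_l2_approximable F (\<lambda>t. \<Sum>i<n. indicator (A i) t)" for n
    proof (induction n)
      case 0
      have "poly_l2_approximable F (\<lambda>_. 0)"
        unfolding poly_l2_approximable_def by (intro allI impI exI[of _ 0]) simp
      then show ?case by (auto intro: bounded_measurable_on_continuous)
    next
      case (Suc n)
      then show ?case
        using poly_l2_approximable_add[OF F _ _ bounded_measurable_on_indicator[OF Am] union(3)]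
          bounded_measurable_on_arith(1)[OF _ bounded_measurable_on_indicator[OF Am]]
        by simp
    qed
    have sum_eq: "(\<Sum>i<n. indicator (A i) t) = (indicator (\<Union>i<n. A i) t :: real)" for n t
      by (subst indicator_UN_disjoint)
        (use union(1) in \<open>auto simp: disjoint_family_on_def\<close>)
    show ?case
    \<comment> \<open>Partial unions differ from the whole union only on the tails, and disjointness
      makes the tails shrink to the empty set.\<close>
    proof (rule poly_l2_approximable_indicator_seq[OF F fin,
          where g = "\<lambda>n t. \<Sum>i<n. indicator (A i) t" and D = "\<lambda>n. (\<Union>i\<in>{n..}. A i)"])
      show "\<bar>(\<Sum>i<n. indicator (A i) t) - indicator (\<Union> (range A)) t\<bar>
          \<le> (indicator (\<Union>i\<in>{n..}. A i) t :: real)" for n t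
        unfolding sum_eq by (auto simp: indicator_def) (metis atLeast_iff lessThan_iff linorder_not_less)
      show "decseq (\<lambda>n. \<Union>i\<in>{n..}. A i)"
        unfolding decseq_def by (meson UN_mono atLeast_subset_iff subset_refl)
      show "(\<Inter>n. \<Union>i\<in>{n..}. A i) = {}"
      proof (rule equals0I)
        fix t assume t: "t \<in> (\<Inter>n. \<Union>i\<in>{n..}. A i)"
        then obtain i where i: "t \<in> A i" by blast
        from t obtain j where "j \<ge> Suc i" "t \<in> A j" by blast
        with i disjoint_family_onD[OF union(1), of i j] show False by auto
      qed
    qed (use ps Am in auto)
  qed
qed

section \<open>Semi-inner product spaces and their completion\<close>

text \<open>Used for the space of operator classes and again for its completion. The axioms speak of
  the form and not of vector space laws, so an identity between vectors is replaced by one between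
  norms, obtained by expanding squares.\<close>

locale semi_inner_space =
  fixes H :: "'a ip_space"
  assumes pts_nonempty: "pts H \<noteq> {}"
    and vadd_closed [simp, intro]: "x \<in> pts H \<Longrightarrow> y \<in> pts H \<Longrightarrow> vadd H x y \<in> pts H"
    and vscale_closed [simp, intro]: "x \<in> pts H \<Longrightarrow> vscale H c x \<in> pts H"
    and ip_commute: "x \<in> pts H \<Longrightarrow> y \<in> pts H \<Longrightarrow> ip H x y = ip H y x"
    and ip_add_left: "x \<in> pts H \<Longrightarrow> y \<in> pts H \<Longrightarrow> z \<in> pts H \<Longrightarrow>
      ip H (vadd H x y) z = ip H x z + ip H y z"
    and ip_scale_left: "x \<in> pts H \<Longrightarrow> z \<in> pts H \<Longrightarrow> ip H (vscale H c x) z = c * ip H x z"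
    and ip_self_nonneg: "x \<in> pts H \<Longrightarrow> 0 \<le> ip H x x"
begin

abbreviation vdiff :: "'a \<Rightarrow> 'a \<Rightarrow> 'a" where "vdiff x y \<equiv> vadd H x (vscale H (-1) y)"

lemma ip_add_right: "x \<in> pts H \<Longrightarrow> y \<in> pts H \<Longrightarrow> z \<in> pts H \<Longrightarrow>
    ip H z (vadd H x y) = ip H z x + ip H z y"
  by (simp add: ip_commute[of z] ip_add_left)

lemma ip_scale_right: "x \<in> pts H \<Longrightarrow> z \<in> pts H \<Longrightarrow> ip H z (vscale H c x) = c * ip H z x"
  by (simp add: ip_commute[of z] ip_scale_left)

lemmas ip_expand = ip_add_left ip_add_right ip_scale_left ip_scale_right

lemma norm_nonneg: "x \<in> pts H \<Longrightarrow> 0 \<le> ip_norm H x"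
  by (simp add: ip_norm_def ip_self_nonneg)

lemma norm_square: "x \<in> pts H \<Longrightarrow> (ip_norm H x)\<^sup>2 = ip H x x"
  by (simp add: ip_norm_def ip_self_nonneg)

lemma dist_nonneg: "x \<in> pts H \<Longrightarrow> y \<in> pts H \<Longrightarrow> 0 \<le> ip_dist H x y"
  by (simp add: ip_dist_def norm_nonneg)

lemma dist_square:
  "x \<in> pts H \<Longrightarrow> y \<in> pts H \<Longrightarrow> (ip_dist H x y)\<^sup>2 = ip H x x - 2 * ip H x y + ip H y y"
  by (simp add: ip_dist_def norm_square ip_expand ip_commute[of y x])

lemma dist_eq_sqrt:
  "x \<in> pts H \<Longrightarrow> y \<in> pts H \<Longrightarrow> ip_dist H x y = sqrt (ip H x x - 2 * ip H x y + ip H y y)"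
  by (simp add: dist_square[symmetric] dist_nonneg)

text \<open>The squared norm of s x + y is a nonnegative polynomial of degree at most two in
  s.\<close>

lemma cauchy_schwarz_square:
  assumes "x \<in> pts H" "y \<in> pts H"
  shows "(ip H x y)\<^sup>2 \<le> ip H x x * ip H y y"
proof -
  have q: "0 \<le> ip H x x * s\<^sup>2 + 2 * s * ip H x y + ip H y y" for s
  proof -
    have "0 \<le> ip H (vadd H (vscale H s x) y) (vadd H (vscale H s x) y)"
      using assms by (intro ip_self_nonneg) auto
    also have "\<dots> = ip H x x * s\<^sup>2 + 2 * s * ip H x y + ip H y y"
      using assms by (simp add: ip_expand ip_commute[of y x] algebra_simps power2_eq_square)
    finally show ?thesis .
  qed
  show ?thesis
  proof (cases "ip H x x = 0")
    case True
    have "ip H x y = 0"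
    proof (rule ccontr)
      assume n: "ip H x y \<noteq> 0"
      \<comment> \<open>For <x, x> = 0 the polynomial is affine in s; at this s its value would be
        -1.\<close>
      have "0 \<le> 2 * (- (ip H y y + 1) / (2 * ip H x y)) * ip H x y + ip H y y"
        using q[of "- (ip H y y + 1) / (2 * ip H x y)"] True by simp
      then show False using n by (simp add: field_simps)
    qed
    then show ?thesis by (simp add: True)
  next
    case False
    with ip_self_nonneg[OF assms(1)] have p: "0 < ip H x x" by simp
    \<comment> \<open>The minimizer of the quadratic polynomial, with the inequality multiplied by
      <x, x>.\<close>
    have "0 \<le> ip H x x * (ip H x x * (- ip H x y / ip H x x)\<^sup>2 +
        2 * (- ip H x y / ip H x x) * ip H x y + ip H y y)"
      by (rule mult_nonneg_nonneg[OF less_imp_le[OF p] q])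
    also have "\<dots> = ip H x x * ip H y y - (ip H x y)\<^sup>2"
      using p by (simp add: field_simps power2_eq_square)
    finally show ?thesis by simp
  qed
qed

lemma cauchy_schwarz:
  assumes "x \<in> pts H" "y \<in> pts H"
  shows "\<bar>ip H x y\<bar> \<le> ip_norm H x * ip_norm H y"
proof (rule power2_le_imp_le)
  show "\<bar>ip H x y\<bar>\<^sup>2 \<le> (ip_norm H x * ip_norm H y)\<^sup>2"
    using cauchy_schwarz_square[OF assms] assms by (simp add: power_mult_distrib norm_square)
qed (use assms norm_nonneg in simp)

lemma norm_triangle:
  assumes "x \<in> pts H" "y \<in> pts H"
  shows "ip_norm H (vadd H x y) \<le> ip_norm H x + ip_norm H y"
proof (rule power2_le_imp_le)
  have "(ip_norm H (vadd H x y))\<^sup>2 = ip H x x + 2 * ip H x y + ip H y y"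
    using assms by (simp add: norm_square ip_expand ip_commute[of y x])
  also have "\<dots> \<le> (ip_norm H x + ip_norm H y)\<^sup>2"
    using cauchy_schwarz[OF assms] assms by (simp add: power2_sum norm_square)
  finally show "(ip_norm H (vadd H x y))\<^sup>2 \<le> (ip_norm H x + ip_norm H y)\<^sup>2" .
qed (use assms norm_nonneg in simp)

lemma dist_self: "x \<in> pts H \<Longrightarrow> ip_dist H x x = 0"
  by (simp add: dist_eq_sqrt)

lemma dist_commute: "x \<in> pts H \<Longrightarrow> y \<in> pts H \<Longrightarrow> ip_dist H x y = ip_dist H y x"
  by (simp add: dist_eq_sqrt ip_commute algebra_simps)

lemma dist_triangle:
  assumes "x \<in> pts H" "y \<in> pts H" "z \<in> pts H"
  shows "ip_dist H x z \<le> ip_dist H x y + ip_dist H y z"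
proof -
  have "(ip_dist H x z)\<^sup>2 = (ip_norm H (vadd H (vdiff x y) (vdiff y z)))\<^sup>2"
    using assms
    by (simp add: dist_square norm_square ip_expand ip_commute[of y x] ip_commute[of z x]
        ip_commute[of z y])
  then have "ip_dist H x z = ip_norm H (vadd H (vdiff x y) (vdiff y z))"
    using assms by (simp add: dist_nonneg norm_nonneg power2_eq_iff_nonneg)
  then show ?thesis using assms by (simp add: ip_dist_def norm_triangle)
qed

lemma norm_le_dist:
  assumes "x \<in> pts H" "y \<in> pts H"
  shows "ip_norm H x \<le> ip_norm H y + ip_dist H x y"
proof -
  have "(ip_norm H x)\<^sup>2 = (ip_norm H (vadd H y (vdiff x y)))\<^sup>2"
    using assms by (simp add: norm_square ip_expand ip_commute[of y x])
  then have "ip_norm H x = ip_norm H (vadd H y (vdiff x y))"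
    using assms by (simp add: norm_nonneg power2_eq_iff_nonneg)
  then show ?thesis
    using norm_triangle[of y "vdiff x y"] assms by (simp add: ip_dist_def)
qed

lemma ip_diff_bound:
  assumes "x \<in> pts H" "y \<in> pts H" "x' \<in> pts H" "y' \<in> pts H"
  shows "\<bar>ip H x y - ip H x' y'\<bar> \<le>
    ip_dist H x x' * ip_norm H y + ip_norm H x' * ip_dist H y y'"
proof -
  have "ip H x y - ip H x' y' = ip H (vdiff x x') y + ip H x' (vdiff y y')"
    using assms by (simp add: ip_expand)
  moreover have "\<bar>ip H (vdiff x x') y\<bar> \<le> ip_dist H x x' * ip_norm H y"
    using assms cauchy_schwarz[of "vdiff x x'" y] by (simp add: ip_dist_def)
  moreover have "\<bar>ip H x' (vdiff y y')\<bar> \<le> ip_norm H x' * ip_dist H y y'"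
    using assms cauchy_schwarz[of x' "vdiff y y'"] by (simp add: ip_dist_def)
  ultimately show ?thesis by linarith
qed

lemma ip_tendsto:
  assumes "\<And>i. u i \<in> pts H" "\<And>i. v i \<in> pts H" "x \<in> pts H" "y \<in> pts H"
    and u: "(\<lambda>i. ip_dist H (u i) x) \<longlonglongrightarrow> 0" and v: "(\<lambda>i. ip_dist H (v i) y) \<longlonglongrightarrow> 0"
  shows "(\<lambda>i. ip H (u i) (v i)) \<longlonglongrightarrow> ip H x y"
proof -
  have b: "norm (ip H (u i) (v i) - ip H x y) \<le>
      ip_dist H (u i) x * (ip_norm H y + ip_dist H (v i) y) + ip_norm H x * ip_dist H (v i) y" for i
    using ip_diff_bound[of "u i" "v i" x y] assms(1-4) norm_le_dist[of "v i" y]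
      mult_left_mono[OF norm_le_dist[of "v i" y] dist_nonneg[of "u i" x]]
    unfolding real_norm_def by (smt (verit, best))
  have "(\<lambda>i. ip_dist H (u i) x * (ip_norm H y + ip_dist H (v i) y) +
      ip_norm H x * ip_dist H (v i) y) \<longlonglongrightarrow> 0 * (ip_norm H y + 0) + ip_norm H x * 0"
    by (intro tendsto_intros u v)
  then have "(\<lambda>i. ip H (u i) (v i) - ip H x y) \<longlonglongrightarrow> 0"
    by (intro Lim_null_comparison[OF always_eventually[OF allI[OF b]]]) simp
  then show ?thesis by (simp add: LIM_zero_iff)
qed

text \<open>The absolute value of the given bound provides a nonnegative constant, so that norm
  estimates can be squared later.\<close>

lemma bounded_operator_dist:
  assumes T: "bounded_operator H T"
  shows "\<exists>K\<ge>0. (\<forall>x\<in>pts H. ip_norm H (T x) \<le> K * ip_norm H x) \<and>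
    (\<forall>x\<in>pts H. \<forall>y\<in>pts H. ip_dist H (T x) (T y) \<le> K * ip_dist H x y)"
proof -
  obtain K where K: "\<And>x. x \<in> pts H \<Longrightarrow> ip_norm H (T x) \<le> K * ip_norm H x"
    using T unfolding bounded_operator_def by blast
  have K': "ip_norm H (T x) \<le> \<bar>K\<bar> * ip_norm H x" if "x \<in> pts H" for x
    using K[OF that] mult_right_mono[OF abs_ge_self norm_nonneg[OF that], of K] by linarith
  moreover have "ip_dist H (T x) (T y) \<le> \<bar>K\<bar> * ip_dist H x y" if "x \<in> pts H" "y \<in> pts H" for x y
  proof -
    have "T (vdiff x y) = vdiff (T x) (T y)"
      using T that by (simp add: bounded_operator_def)
    then show ?thesis using K'[of "vdiff x y"] that by (simp add: ip_dist_def)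
  qed
  ultimately show ?thesis by (intro exI[of _ "\<bar>K\<bar>"]) simp
qed

section \<open>Cauchy sequences and their classes\<close>

lemma cauchy_seqs_pts: "u \<in> cauchy_seqs H \<Longrightarrow> u i \<in> pts H"
  by (simp add: cauchy_seqs_def)

lemma cauchy_seqsD:
  "u \<in> cauchy_seqs H \<Longrightarrow> 0 < \<epsilon> \<Longrightarrow> \<exists>N. \<forall>i\<ge>N. \<forall>j\<ge>N. ip_dist H (u i) (u j) < \<epsilon>"
  by (simp add: cauchy_seqs_def)

lemma cauchy_seqs_bounded:
  assumes u: "u \<in> cauchy_seqs H"
  obtains C where "0 < C" "\<And>i. ip_norm H (u i) \<le> C"
proof -
  obtain N where N: "\<And>i. i \<ge> N \<Longrightarrow> ip_dist H (u i) (u N) < 1"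
    using cauchy_seqsD[OF u, of 1] by auto
  define C where "C = Max ((\<lambda>i. ip_norm H (u i)) ` {..N}) + 1"
  have m: "ip_norm H (u i) \<le> C - 1" if "i \<le> N" for i
    using that by (auto simp: C_def)
  have "ip_norm H (u i) \<le> C" for i
  proof (cases "i \<le> N")
    case True then show ?thesis using m[of i] by simp
  next
    case False
    then show ?thesis
      using m[of N] N[of i] norm_le_dist[OF cauchy_seqs_pts[OF u, of i] cauchy_seqs_pts[OF u, of N]]
      by simp
  qed
  moreover have "0 < C" using m[of 0] norm_nonneg[OF cauchy_seqs_pts[OF u, of 0]] by simp
  ultimately show ?thesis using that by blast
qed

lemma cauchy_seqs_comp:
  assumes u: "u \<in> cauchy_seqs H" and v: "\<And>i. v i \<in> pts H"
    and le: "\<And>i j. ip_dist H (v i) (v j) \<le> K * ip_dist H (u i) (u j)"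
  shows "v \<in> cauchy_seqs H"
  unfolding cauchy_seqs_def
proof (intro CollectI conjI allI impI v)
  fix e :: real assume "0 < e"
  \<comment> \<open>The summand 1 keeps the denominator positive when K = 0.\<close>
  then obtain N where N: "\<And>i j. i \<ge> N \<Longrightarrow> j \<ge> N \<Longrightarrow> ip_dist H (u i) (u j) < e / (\<bar>K\<bar> + 1)"
    using cauchy_seqsD[OF u, of "e / (\<bar>K\<bar> + 1)"] by (auto simp: add_nonneg_pos)
  have "ip_dist H (v i) (v j) < e" if "i \<ge> N" "j \<ge> N" for i j
  proof -
    have p: "0 \<le> ip_dist H (u i) (u j)" by (intro dist_nonneg cauchy_seqs_pts u)
    have "ip_dist H (v i) (v j) \<le> (\<bar>K\<bar> + 1) * ip_dist H (u i) (u j)"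
      using le[of i j] mult_right_mono[of K "\<bar>K\<bar> + 1", OF _ p] by linarith
    also have "\<dots> < e" using N[OF that] by (simp add: field_simps)
    finally show ?thesis .
  qed
  then show "\<exists>N. \<forall>i\<ge>N. \<forall>j\<ge>N. ip_dist H (v i) (v j) < e" by blast
qed

lemma dist_add_le:
  assumes "x \<in> pts H" "y \<in> pts H" "x' \<in> pts H" "y' \<in> pts H"
  shows "ip_dist H (vadd H x y) (vadd H x' y') \<le> ip_dist H x x' + ip_dist H y y'"
proof -
  have "(ip_dist H (vadd H x y) (vadd H x' y'))\<^sup>2 =
      (ip_norm H (vadd H (vdiff x x') (vdiff y y')))\<^sup>2"
    using assms by (simp add: ip_dist_def norm_square ip_expand ip_commute algebra_simps)
  then have "ip_dist H (vadd H x y) (vadd H x' y') = ip_norm H (vadd H (vdiff x x') (vdiff y y'))"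
    using assms by (simp add: dist_nonneg norm_nonneg power2_eq_iff_nonneg)
  then show ?thesis using assms by (simp add: ip_dist_def norm_triangle)
qed

text \<open>At this level sums commute only up to distance 0. Classes of sums are therefore
  symmetric in their arguments, so that congruence has to be checked in one argument.\<close>

lemma dist_vadd_commute:
  assumes "x \<in> pts H" "y \<in> pts H" shows "ip_dist H (vadd H x y) (vadd H y x) = 0"
proof -
  have "(ip_dist H (vadd H x y) (vadd H y x))\<^sup>2 = 0"
    using assms by (simp add: dist_square ip_expand ip_commute[of y x])
  then show ?thesis by simp
qed

lemma dist_scale:
  assumes "x \<in> pts H" "y \<in> pts H"
  shows "ip_dist H (vscale H c x) (vscale H c y) = \<bar>c\<bar> * ip_dist H x y"
proof -
  have "(ip_dist H (vscale H c x) (vscale H c y))\<^sup>2 = (\<bar>c\<bar> * ip_dist H x y)\<^sup>2"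
    using assms by (simp add: power_mult_distrib dist_square ip_expand)
      (simp add: algebra_simps power2_eq_square)
  then show ?thesis using assms by (simp add: dist_nonneg power2_eq_iff_nonneg)
qed

lemma cauchy_seqs_add:
  assumes u: "u \<in> cauchy_seqs H" and v: "v \<in> cauchy_seqs H"
  shows "(\<lambda>i. vadd H (u i) (v i)) \<in> cauchy_seqs H"
  unfolding cauchy_seqs_def
proof (intro CollectI conjI allI impI)
  show "vadd H (u i) (v i) \<in> pts H" for i using u v by (simp add: cauchy_seqs_pts)
  fix e :: real assume "0 < e"
  then have e: "0 < e / 2" by simp
  obtain N where N: "\<And>i j. i \<ge> N \<Longrightarrow> j \<ge> N \<Longrightarrow> ip_dist H (u i) (u j) < e / 2"
    using cauchy_seqsD[OF u e] by blast
  obtain M where M: "\<And>i j. i \<ge> M \<Longrightarrow> j \<ge> M \<Longrightarrow> ip_dist H (v i) (v j) < e / 2"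
    using cauchy_seqsD[OF v e] by blast
  have "ip_dist H (vadd H (u i) (v i)) (vadd H (u j) (v j)) < e"
    if "i \<ge> max N M" "j \<ge> max N M" for i j
    using that dist_add_le[of "u i" "v i" "u j" "v j"] u v N[of i j] M[of i j]
    by (simp add: cauchy_seqs_pts)
  then show "\<exists>N. \<forall>i\<ge>N. \<forall>j\<ge>N. ip_dist H (vadd H (u i) (v i)) (vadd H (u j) (v j)) < e" by blast
qed

lemma cauchy_seqs_scale:
  assumes u: "u \<in> cauchy_seqs H"
  shows "(\<lambda>i. vscale H c (u i)) \<in> cauchy_seqs H"
  using u by (intro cauchy_seqs_comp[OF u, where K = "\<bar>c\<bar>"]) (auto simp: cauchy_seqs_pts dist_scale)

lemma cauchy_seqs_const: "x \<in> pts H \<Longrightarrow> (\<lambda>_. x) \<in> cauchy_seqs H"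
  by (simp add: cauchy_seqs_def dist_self)

lemma cauchy_seqs_bounded_operator:
  assumes T: "bounded_operator H T" and u: "u \<in> cauchy_seqs H"
  shows "(\<lambda>i. T (u i)) \<in> cauchy_seqs H"
proof -
  obtain K where K: "0 \<le> K" "\<forall>x\<in>pts H. ip_norm H (T x) \<le> K * ip_norm H x"
    "\<forall>x\<in>pts H. \<forall>y\<in>pts H. ip_dist H (T x) (T y) \<le> K * ip_dist H x y"
    using bounded_operator_dist[OF T] by (elim exE conjE)
  have "T (u i) \<in> pts H" for i using T cauchy_seqs_pts[OF u] by (simp add: bounded_operator_def)
  then show ?thesis by (rule cauchy_seqs_comp[OF u, where K = K]) (simp add: K(3) cauchy_seqs_pts u)
qed

lemma cauchy_ip_convergent:
  assumes u: "u \<in> cauchy_seqs H" and v: "v \<in> cauchy_seqs H"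
  shows "convergent (\<lambda>i. ip H (u i) (v i))"
proof -
  obtain C where C: "0 < C" "\<And>i. ip_norm H (u i) \<le> C" using cauchy_seqs_bounded[OF u] by blast
  obtain D where D: "0 < D" "\<And>i. ip_norm H (v i) \<le> D" using cauchy_seqs_bounded[OF v] by blast
  have "Cauchy (\<lambda>i. ip H (u i) (v i))"
  proof (rule CauchyI)
    fix e :: real assume e: "0 < e"
    obtain N where N: "\<And>i j. i \<ge> N \<Longrightarrow> j \<ge> N \<Longrightarrow> ip_dist H (u i) (u j) < e / (2 * D)"
      using cauchy_seqsD[OF u, of "e / (2 * D)"] e D by auto
    obtain M where M: "\<And>i j. i \<ge> M \<Longrightarrow> j \<ge> M \<Longrightarrow> ip_dist H (v i) (v j) < e / (2 * C)"
      using cauchy_seqsD[OF v, of "e / (2 * C)"] e C by auto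
    have "norm (ip H (u i) (v i) - ip H (u j) (v j)) < e" if "i \<ge> max N M" "j \<ge> max N M" for i j
    proof -
      have p: "u i \<in> pts H" "u j \<in> pts H" "v i \<in> pts H" "v j \<in> pts H"
        using u v by (auto simp: cauchy_seqs_pts)
      have "ip_dist H (u i) (u j) * ip_norm H (v i) \<le> ip_dist H (u i) (u j) * D"
        using D p by (intro mult_left_mono dist_nonneg) auto
      also have "\<dots> < e / 2" using N[of i j] that D by (simp add: field_simps)
      finally have 1: "ip_dist H (u i) (u j) * ip_norm H (v i) < e / 2" .
      have "ip_norm H (u j) * ip_dist H (v i) (v j) \<le> C * ip_dist H (v i) (v j)"
        using C p by (intro mult_right_mono dist_nonneg) auto
      also have "\<dots> < e / 2" using M[of i j] that C by (simp add: field_simps)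
      finally show ?thesis
        using ip_diff_bound[OF p(1,3,2,4)] 1 by simp
    qed
    then show "\<exists>M. \<forall>m\<ge>M. \<forall>n\<ge>M. norm (ip H (u m) (v m) - ip H (u n) (v n)) < e" by blast
  qed
  then show ?thesis by (rule Cauchy_convergent)
qed

lemma cauchy_ip_lim:
  "u \<in> cauchy_seqs H \<Longrightarrow> v \<in> cauchy_seqs H \<Longrightarrow>
    (\<lambda>i. ip H (u i) (v i)) \<longlonglongrightarrow> lim (\<lambda>i. ip H (u i) (v i))"
  using cauchy_ip_convergent convergent_LIMSEQ_iff by blast

lemma equiv_cauchy_rel: "equiv (cauchy_seqs H) (cauchy_rel H)"
proof (rule equivI)
  show "cauchy_rel H \<subseteq> cauchy_seqs H \<times> cauchy_seqs H" by (auto simp: cauchy_rel_def)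
  show "refl_on (cauchy_seqs H) (cauchy_rel H)"
    by (auto simp: refl_on_def cauchy_rel_def cauchy_seqs_pts dist_self)
  show "sym (cauchy_rel H)"
    by (auto simp: sym_def cauchy_rel_def cauchy_seqs_pts dist_commute)
  show "trans (cauchy_rel H)"
  proof (rule transI)
    fix u v w assume uv: "(u, v) \<in> cauchy_rel H" and vw: "(v, w) \<in> cauchy_rel H"
    have p: "u i \<in> pts H" "v i \<in> pts H" "w i \<in> pts H" for i
      using uv vw by (auto simp: cauchy_rel_def cauchy_seqs_pts)
    have "(\<lambda>i. ip_dist H (u i) (v i)) \<longlonglongrightarrow> 0" "(\<lambda>i. ip_dist H (v i) (w i)) \<longlonglongrightarrow> 0"
      using uv vw by (simp_all add: cauchy_rel_def)
    from tendsto_add[OF this]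
    have s: "(\<lambda>i. ip_dist H (u i) (v i) + ip_dist H (v i) (w i)) \<longlonglongrightarrow> 0" by simp
    have b: "norm (ip_dist H (u i) (w i)) \<le> ip_dist H (u i) (v i) + ip_dist H (v i) (w i)" for i
      using dist_triangle[OF p(1) p(2) p(3), of i i i] dist_nonneg[OF p(1) p(3), of i i] by simp
    have "(\<lambda>i. ip_dist H (u i) (w i)) \<longlonglongrightarrow> 0"
      by (rule Lim_null_comparison[OF always_eventually[OF allI[OF b]] s])
    then show "(u, w) \<in> cauchy_rel H" using uv vw by (auto simp: cauchy_rel_def)
  qed
qed

abbreviation cls :: "(nat \<Rightarrow> 'a) \<Rightarrow> (nat \<Rightarrow> 'a) set" where "cls u \<equiv> cauchy_rel H `` {u}"
abbreviation compl :: "(nat \<Rightarrow> 'a) set ip_space" where "compl \<equiv> ip_completion H"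

lemma pts_completion: "pts compl = cls ` cauchy_seqs H"
  by (auto simp: ip_completion_def quotient_def)

lemma cls_pts [simp, intro]: "u \<in> cauchy_seqs H \<Longrightarrow> cls u \<in> pts compl"
  by (simp add: pts_completion)

lemma cls_eqI:
  assumes "u \<in> cauchy_seqs H" "v \<in> cauchy_seqs H" "(\<lambda>i. ip_dist H (u i) (v i)) \<longlonglongrightarrow> 0"
  shows "cls u = cls v"
  using equiv_class_eq[OF equiv_cauchy_rel, of u v] assms by (simp add: cauchy_rel_def)

text \<open>Transfers equivalence of Cauchy sequences through a Lipschitz estimate; sums, multiples
  and images under operators become well defined on classes in this way.\<close>

lemma rel_null_comparison:
  assumes r: "(u, u') \<in> cauchy_rel H" and w: "w \<in> cauchy_seqs H" "w' \<in> cauchy_seqs H"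
    and le: "\<And>i. ip_dist H (w i) (w' i) \<le> K * ip_dist H (u i) (u' i)"
  shows "(w, w') \<in> cauchy_rel H"
proof -
  have b: "norm (ip_dist H (w i) (w' i)) \<le> K * ip_dist H (u i) (u' i)" for i
    using le[of i] dist_nonneg[of "w i" "w' i"] w by (simp add: cauchy_seqs_pts)
  have "(\<lambda>i. ip_dist H (u i) (u' i)) \<longlonglongrightarrow> 0" using r by (simp add: cauchy_rel_def)
  from tendsto_mult_left[OF this, of K]
  have "(\<lambda>i. K * ip_dist H (u i) (u' i)) \<longlonglongrightarrow> 0" by simp
  from Lim_null_comparison[OF always_eventually[OF allI[OF b]] this]
  show ?thesis using w by (simp add: cauchy_rel_def)
qed

text \<open>The union over all representatives in the definition of the completion collapses to a
  single class.\<close>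

lemma vadd_cls:
  assumes "u \<in> cauchy_seqs H" "v \<in> cauchy_seqs H"
  shows "vadd compl (cls u) (cls v) = cls (\<lambda>i. vadd H (u i) (v i))"
proof -
  have "(\<lambda>u v. cls (\<lambda>i. vadd H (u i) (v i))) respects2 cauchy_rel H"
  proof (rule congruent2_commuteI[OF equiv_cauchy_rel])
    fix u v assume "u \<in> cauchy_seqs H" "v \<in> cauchy_seqs H"
    then show "cls (\<lambda>i. vadd H (u i) (v i)) = cls (\<lambda>i. vadd H (v i) (u i))"
      by (intro cls_eqI cauchy_seqs_add) (simp_all add: dist_vadd_commute cauchy_seqs_pts)
  next
    fix u v w assume "u \<in> cauchy_seqs H" and vw: "(v, w) \<in> cauchy_rel H"
    moreover have "v \<in> cauchy_seqs H" "w \<in> cauchy_seqs H" using vw by (auto simp: cauchy_rel_def)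
    ultimately have p: "u i \<in> pts H" "v i \<in> pts H" "w i \<in> pts H"
      and c: "u \<in> cauchy_seqs H" "v \<in> cauchy_seqs H" "w \<in> cauchy_seqs H" for i
      by (simp_all add: cauchy_seqs_pts)
    have "ip_dist H (vadd H (u i) (v i)) (vadd H (u i) (w i)) \<le> 1 * ip_dist H (v i) (w i)" for i
      using dist_add_le[OF p(1) p(2) p(1) p(3), of i i i i] dist_self[OF p(1), of i] by simp
    then show "cls (\<lambda>i. vadd H (u i) (v i)) = cls (\<lambda>i. vadd H (u i) (w i))"
      by (intro equiv_class_eq[OF equiv_cauchy_rel] rel_null_comparison[OF vw, where K = 1]
          cauchy_seqs_add c)
  qed
  from UN_equiv_class2[OF equiv_cauchy_rel equiv_cauchy_rel this assms] show ?thesis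
    by (simp add: ip_completion_def)
qed

lemma vscale_cls:
  assumes "u \<in> cauchy_seqs H"
  shows "vscale compl c (cls u) = cls (\<lambda>i. vscale H c (u i))"
proof -
  have "(\<lambda>u. cls (\<lambda>i. vscale H c (u i))) respects cauchy_rel H"
  proof (rule congruentI)
    fix u v assume uv: "(u, v) \<in> cauchy_rel H"
    moreover have "u \<in> cauchy_seqs H" "v \<in> cauchy_seqs H" using uv by (auto simp: cauchy_rel_def)
    ultimately show "cls (\<lambda>i. vscale H c (u i)) = cls (\<lambda>i. vscale H c (v i))"
      by (intro equiv_class_eq[OF equiv_cauchy_rel] rel_null_comparison[OF uv, where K = "\<bar>c\<bar>"]
          cauchy_seqs_scale) (auto simp: cauchy_seqs_pts dist_scale)
  qed
  from UN_equiv_class[OF equiv_cauchy_rel this assms] show ?thesis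
    by (simp add: ip_completion_def)
qed

lemma completion_map_cls:
  assumes T: "bounded_operator H T" and u: "u \<in> cauchy_seqs H"
  shows "completion_map H T (cls u) = cls (\<lambda>i. T (u i))"
proof -
  obtain K where K: "0 \<le> K" "\<forall>x\<in>pts H. ip_norm H (T x) \<le> K * ip_norm H x"
    "\<forall>x\<in>pts H. \<forall>y\<in>pts H. ip_dist H (T x) (T y) \<le> K * ip_dist H x y"
    using bounded_operator_dist[OF T] by (elim exE conjE)
  have "(\<lambda>u. cls (\<lambda>i. T (u i))) respects cauchy_rel H"
  proof (rule congruentI)
    fix u v assume uv: "(u, v) \<in> cauchy_rel H"
    moreover have "u \<in> cauchy_seqs H" "v \<in> cauchy_seqs H" using uv by (auto simp: cauchy_rel_def)
    ultimately show "cls (\<lambda>i. T (u i)) = cls (\<lambda>i. T (v i))"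
      by (intro equiv_class_eq[OF equiv_cauchy_rel] rel_null_comparison[OF uv, where K = K]
          cauchy_seqs_bounded_operator[OF T]) (auto simp: cauchy_seqs_pts K(3))
  qed
  from UN_equiv_class[OF equiv_cauchy_rel this u] show ?thesis
    by (simp add: completion_map_def)
qed

text \<open>Justifies \<open>the_elem\<close> in the completion: changing one sequence within its
  class changes the inner products by at most a null sequence times a bound for the other
  sequence.\<close>

lemma ip_cls_tendsto:
  assumes "u \<in> cauchy_seqs H" "v \<in> cauchy_seqs H"
  shows "(\<lambda>i. ip H (u i) (v i)) \<longlonglongrightarrow> ip compl (cls u) (cls v)"
proof -
  have "(\<lambda>u v. {lim (\<lambda>i. ip H (u i) (v i))}) respects2 cauchy_rel H"
  proof (rule congruent2I[OF equiv_cauchy_rel equiv_cauchy_rel])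
    have *: "{lim (\<lambda>i. ip H (u i) (w i))} = {lim (\<lambda>i. ip H (v i) (w i))}"
      if uv: "(u, v) \<in> cauchy_rel H" and w: "w \<in> cauchy_seqs H" for u v w
    proof -
      have u: "u \<in> cauchy_seqs H" and v: "v \<in> cauchy_seqs H" using uv by (auto simp: cauchy_rel_def)
      obtain C where C: "0 < C" "\<And>i. ip_norm H (w i) \<le> C" using cauchy_seqs_bounded[OF w] by blast
      have b: "norm (ip H (u i) (w i) - ip H (v i) (w i)) \<le> ip_dist H (u i) (v i) * C" for i
        using ip_diff_bound[of "u i" "w i" "v i" "w i"] u v w
          mult_left_mono[OF C(2)[of i] dist_nonneg[of "u i" "v i"]]
        by (simp add: cauchy_seqs_pts dist_self)
      have "(\<lambda>i. ip_dist H (u i) (v i)) \<longlonglongrightarrow> 0" using uv by (simp add: cauchy_rel_def)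
      from tendsto_mult_right[OF this, of C]
      have "(\<lambda>i. ip_dist H (u i) (v i) * C) \<longlonglongrightarrow> 0" by simp
      from Lim_null_comparison[OF always_eventually[OF allI[OF b]] this]
      have "(\<lambda>i. ip H (u i) (w i) - ip H (v i) (w i)) \<longlonglongrightarrow> 0" .
      from tendsto_add[OF this cauchy_ip_lim[OF v w]]
      have "(\<lambda>i. ip H (u i) (w i)) \<longlonglongrightarrow> lim (\<lambda>i. ip H (v i) (w i))" by simp
      then show ?thesis by (simp add: limI)
    qed
    show "{lim (\<lambda>i. ip H (u i) (w i))} = {lim (\<lambda>i. ip H (v i) (w i))}"
      if "(u, v) \<in> cauchy_rel H" "w \<in> cauchy_seqs H" for u v w
      using *[OF that] .
    show "{lim (\<lambda>i. ip H (w i) (u i))} = {lim (\<lambda>i. ip H (w i) (v i))}"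
      if "(u, v) \<in> cauchy_rel H" "w \<in> cauchy_seqs H" for u v w
    proof -
      have "u i \<in> pts H" "v i \<in> pts H" "w i \<in> pts H" for i
        using that by (auto simp: cauchy_rel_def cauchy_seqs_pts)
      then show ?thesis using *[OF that] by (simp add: ip_commute[of "w _"])
    qed
  qed
  from UN_equiv_class2[OF equiv_cauchy_rel equiv_cauchy_rel this assms]
  have "ip compl (cls u) (cls v) = lim (\<lambda>i. ip H (u i) (v i))"
    by (simp add: ip_completion_def)
  then show ?thesis using cauchy_ip_lim[OF assms] by simp
qed

lemma ip_cls_eqI:
  "u \<in> cauchy_seqs H \<Longrightarrow> v \<in> cauchy_seqs H \<Longrightarrow> (\<lambda>i. ip H (u i) (v i)) \<longlonglongrightarrow> c \<Longrightarrow>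
    ip compl (cls u) (cls v) = c"
  using ip_cls_tendsto LIMSEQ_unique by blast

lemma semi_inner_space_completion: "semi_inner_space compl"
proof
  show "pts compl \<noteq> {}"
    using pts_nonempty cauchy_seqs_const unfolding pts_completion by blast
  show "vadd compl U V \<in> pts compl" if "U \<in> pts compl" "V \<in> pts compl" for U V
    using that unfolding pts_completion
    by (auto simp: vadd_cls cauchy_seqs_add)
  show "vscale compl c U \<in> pts compl" if "U \<in> pts compl" for U c
    using that unfolding pts_completion by (auto simp: vscale_cls cauchy_seqs_scale)
  show "ip compl U V = ip compl V U" if U: "U \<in> pts compl" "V \<in> pts compl" for U V
  proof -
    obtain u v where u: "U = cls u" "u \<in> cauchy_seqs H" and v: "V = cls v" "v \<in> cauchy_seqs H"
      using U unfolding pts_completion by blast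
    have "(\<lambda>i. ip H (u i) (v i)) = (\<lambda>i. ip H (v i) (u i))"
      using u v by (intro ext ip_commute) (auto simp: cauchy_seqs_pts)
    then show ?thesis unfolding u v using ip_cls_tendsto[OF v(2) u(2)] u v
      by (intro ip_cls_eqI) auto
  qed
  show "ip compl (vadd compl U V) W = ip compl U W + ip compl V W"
    if U: "U \<in> pts compl" "V \<in> pts compl" "W \<in> pts compl" for U V W
  proof -
    obtain u v w where u: "U = cls u" "u \<in> cauchy_seqs H" and v: "V = cls v" "v \<in> cauchy_seqs H"
      and w: "W = cls w" "w \<in> cauchy_seqs H"
      using U unfolding pts_completion by blast
    have "ip H (vadd H (u i) (v i)) (w i) = ip H (u i) (w i) + ip H (v i) (w i)" for i
      using u v w by (intro ip_add_left) (auto simp: cauchy_seqs_pts)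
    then show ?thesis
      unfolding u v w vadd_cls[OF u(2) v(2)]
      using tendsto_add[OF ip_cls_tendsto[OF u(2) w(2)] ip_cls_tendsto[OF v(2) w(2)]]
      by (intro ip_cls_eqI cauchy_seqs_add u v w) simp
  qed
  show "ip compl (vscale compl c U) W = c * ip compl U W"
    if U: "U \<in> pts compl" "W \<in> pts compl" for U W c
  proof -
    obtain u w where u: "U = cls u" "u \<in> cauchy_seqs H" and w: "W = cls w" "w \<in> cauchy_seqs H"
      using U unfolding pts_completion by blast
    have "ip H (vscale H c (u i)) (w i) = c * ip H (u i) (w i)" for i
      using u w by (intro ip_scale_left) (auto simp: cauchy_seqs_pts)
    then show ?thesis
      unfolding u w vscale_cls[OF u(2)]
      using tendsto_mult_left[OF ip_cls_tendsto[OF u(2) w(2)], of c]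
      by (intro ip_cls_eqI cauchy_seqs_scale u w) simp
  qed
  show "0 \<le> ip compl U U" if U: "U \<in> pts compl" for U
  proof -
    obtain u where u: "U = cls u" "u \<in> cauchy_seqs H"
      using U unfolding pts_completion by blast
    show ?thesis unfolding u
      by (rule LIMSEQ_le_const[OF ip_cls_tendsto[OF u(2) u(2)]])
        (use u in \<open>auto intro!: ip_self_nonneg simp: cauchy_seqs_pts\<close>)
  qed
qed

interpretation C: semi_inner_space compl by (rule semi_inner_space_completion)

lemma dist_cls_tendsto:
  assumes "u \<in> cauchy_seqs H" "v \<in> cauchy_seqs H"
  shows "(\<lambda>i. ip_dist H (u i) (v i)) \<longlonglongrightarrow> ip_dist compl (cls u) (cls v)"
proof -
  have "(\<lambda>i. sqrt (ip H (u i) (u i) - 2 * ip H (u i) (v i) + ip H (v i) (v i))) \<longlonglongrightarrow>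
      sqrt (ip compl (cls u) (cls u) - 2 * ip compl (cls u) (cls v) + ip compl (cls v) (cls v))"
    by (intro tendsto_intros ip_cls_tendsto assms)
  then show ?thesis
    using assms by (simp add: C.dist_eq_sqrt dist_eq_sqrt cauchy_seqs_pts)
qed

lemma completion_definite:
  assumes "U \<in> pts compl" "V \<in> pts compl" "ip_dist compl U V = 0"
  shows "U = V"
proof -
  obtain u v where u: "U = cls u" "u \<in> cauchy_seqs H" and v: "V = cls v" "v \<in> cauchy_seqs H"
    using assms unfolding pts_completion by blast
  have "(\<lambda>i. ip_dist H (u i) (v i)) \<longlonglongrightarrow> 0"
    using dist_cls_tendsto[OF u(2) v(2)] assms(3) u v by simp
  then show ?thesis using u v cls_eqI by simp
qed

text \<open>Each class in the sequence is replaced by a single late term of a representative, and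
  these terms form a representative of the limit.\<close>

lemma completion_complete:
  assumes U: "U \<in> cauchy_seqs compl"
  shows "\<exists>W\<in>pts compl. (\<lambda>k. ip_dist compl (U k) W) \<longlonglongrightarrow> 0"
proof -
  have "\<forall>k. \<exists>u. U k = cls u \<and> u \<in> cauchy_seqs H"
    using C.cauchy_seqs_pts[OF U] unfolding pts_completion by blast
  then obtain u where u: "\<And>k. U k = cls (u k)" "\<And>k. u k \<in> cauchy_seqs H" by metis
  have "\<forall>k. \<exists>N. \<forall>i\<ge>N. \<forall>j\<ge>N. ip_dist H (u k i) (u k j) < inverse (real (Suc k))"
    using cauchy_seqsD[OF u(2)] by simp
  then obtain N where N: "\<And>k i j. i \<ge> N k \<Longrightarrow> j \<ge> N k \<Longrightarrow>
      ip_dist H (u k i) (u k j) < inverse (real (Suc k))" by metis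
  \<comment> \<open>Beyond this term \<open>u k\<close> varies by less than 1/(k+1), so the class of
    the constant sequence at \<open>w k\<close> is that close to \<open>U k\<close>.\<close>
  define w where "w k = u k (N k)" for k
  define W where "W k = cls (\<lambda>_. w k)" for k
  have wp: "w k \<in> pts H" for k unfolding w_def by (rule cauchy_seqs_pts[OF u(2)])
  have wc: "(\<lambda>_. w k) \<in> cauchy_seqs H" for k by (rule cauchy_seqs_const[OF wp])
  have Wp: "W k \<in> pts compl" for k unfolding W_def by (rule cls_pts[OF wc])
  have Up: "U k \<in> pts compl" for k by (rule C.cauchy_seqs_pts[OF U])
  have UW: "ip_dist compl (U k) (W k) \<le> inverse (real (Suc k))" for k
    unfolding u(1) W_def
    by (rule LIMSEQ_le_const2[OF dist_cls_tendsto[OF u(2) wc]])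
      (use N[of k _ "N k"] in \<open>auto simp: w_def intro!: exI[of _ "N k"] less_imp_le\<close>)
  have WW: "ip_dist compl (W k) (W l) = ip_dist H (w k) (w l)" for k l
    using LIMSEQ_unique[OF dist_cls_tendsto[OF wc[of k] wc[of l]] tendsto_const]
    by (simp add: W_def)
  have w: "w \<in> cauchy_seqs H"
    unfolding cauchy_seqs_def
  proof (intro CollectI conjI allI impI wp)
    fix e :: real assume e: "0 < e"
    obtain M1 where M1: "\<And>k l. k \<ge> M1 \<Longrightarrow> l \<ge> M1 \<Longrightarrow> ip_dist compl (U k) (U l) < e/3"
      using C.cauchy_seqsD[OF U, of "e/3"] e by auto
    obtain M2 where M2: "inverse (real (Suc M2)) < e/3" using reals_Archimedean[of "e/3"] e by auto
    have "ip_dist H (w k) (w l) < e" if k: "k \<ge> max M1 M2" and l: "l \<ge> max M1 M2" for k l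
    proof -
      have i: "inverse (real (Suc j)) < e/3" if "j \<ge> M2" for j
        by (rule le_less_trans[OF le_imp_inverse_le M2]) (use that in simp_all)
      have "ip_dist compl (W k) (W l) \<le>
          ip_dist compl (W k) (U k) + (ip_dist compl (U k) (U l) + ip_dist compl (U l) (W l))"
        using C.dist_triangle[OF Wp[of k] Up[of k] Wp[of l]] C.dist_triangle[OF Up[of k] Up[of l] Wp[of l]]
        by linarith
      also have "ip_dist compl (W k) (U k) < e/3"
        using UW[of k] i[of k] k C.dist_commute[OF Up[of k] Wp[of k]] by simp
      also have "ip_dist compl (U l) (W l) < e/3" using UW[of l] i[of l] l by simp
      also have "ip_dist compl (U k) (U l) < e/3" using M1 k l by simp
      finally show ?thesis unfolding WW by simp
    qed
    then show "\<exists>N. \<forall>i\<ge>N. \<forall>j\<ge>N. ip_dist H (w i) (w j) < e" by blast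
  qed
  have WL: "(\<lambda>k. ip_dist compl (W k) (cls w)) \<longlonglongrightarrow> 0"
  proof (rule LIMSEQ_I)
    fix e :: real assume e: "0 < e"
    obtain M where M: "\<And>k l. k \<ge> M \<Longrightarrow> l \<ge> M \<Longrightarrow> ip_dist H (w k) (w l) < e/2"
      using cauchy_seqsD[OF w, of "e/2"] e by auto
    have "ip_dist compl (W k) (cls w) \<le> e/2" if "k \<ge> M" for k
      unfolding W_def
      by (rule LIMSEQ_le_const2[OF dist_cls_tendsto[OF wc w]])
        (use M[OF that] in \<open>auto intro!: exI[of _ M] less_imp_le\<close>)
    then show "\<exists>M. \<forall>k\<ge>M. norm (ip_dist compl (W k) (cls w) - 0) < e"
      using e C.dist_nonneg[OF Wp cls_pts[OF w]] by (intro exI[of _ M]) fastforce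
  qed
  have "(\<lambda>k. ip_dist compl (U k) (cls w)) \<longlonglongrightarrow> 0"
  proof (rule Lim_null_comparison[OF always_eventually[OF allI]])
    show "norm (ip_dist compl (U k) (cls w)) \<le>
        inverse (real (Suc k)) + ip_dist compl (W k) (cls w)" for k
      using C.dist_triangle[OF Up[of k] Wp[of k] cls_pts[OF w]] UW[of k]
        C.dist_nonneg[OF Up[of k] cls_pts[OF w]] by simp
    show "(\<lambda>k. inverse (real (Suc k)) + ip_dist compl (W k) (cls w)) \<longlonglongrightarrow> 0"
      using tendsto_add[OF LIMSEQ_inverse_real_of_nat WL] by simp
  qed
  then show ?thesis using cls_pts[OF w] by blast
qed

lemma completion_map_bounded:
  assumes T: "bounded_operator H T"
  shows "bounded_operator compl (completion_map H T)"
proof -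
  obtain K where K: "0 \<le> K" "\<forall>x\<in>pts H. ip_norm H (T x) \<le> K * ip_norm H x"
    "\<forall>x\<in>pts H. \<forall>y\<in>pts H. ip_dist H (T x) (T y) \<le> K * ip_dist H x y"
    using bounded_operator_dist[OF T] by (elim exE conjE)
  note Tc = cauchy_seqs_bounded_operator[OF T]
  show ?thesis
    unfolding bounded_operator_def
  proof (intro conjI ballI allI exI[of _ K])
    fix U assume "U \<in> pts compl"
    then obtain u where u: "U = cls u" "u \<in> cauchy_seqs H" unfolding pts_completion by blast
    show "completion_map H T U \<in> pts compl"
      unfolding u using u Tc by (simp add: completion_map_cls[OF T])
    show "completion_map H T (vscale compl c U) = vscale compl c (completion_map H T U)" for c
    proof -
      have "T (vscale H c (u i)) = vscale H c (T (u i))" for i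
        using T cauchy_seqs_pts[OF u(2)] by (simp add: bounded_operator_def)
      then show ?thesis
        unfolding u using u Tc by (simp add: completion_map_cls[OF T] vscale_cls cauchy_seqs_scale)
    qed
    show "ip_norm compl (completion_map H T U) \<le> K * ip_norm compl U"
    proof (rule power2_le_imp_le)
      have "ip compl (cls (\<lambda>i. T (u i))) (cls (\<lambda>i. T (u i))) \<le> K\<^sup>2 * ip compl (cls u) (cls u)"
      proof (rule LIMSEQ_le)
        show "(\<lambda>i. ip H (T (u i)) (T (u i))) \<longlonglongrightarrow> ip compl (cls (\<lambda>i. T (u i))) (cls (\<lambda>i. T (u i)))"
          by (rule ip_cls_tendsto[OF Tc[OF u(2)] Tc[OF u(2)]])
        show "(\<lambda>i. K\<^sup>2 * ip H (u i) (u i)) \<longlonglongrightarrow> K\<^sup>2 * ip compl (cls u) (cls u)"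
          by (intro tendsto_mult_left ip_cls_tendsto u)
        have "ip H (T (u i)) (T (u i)) \<le> K\<^sup>2 * ip H (u i) (u i)" for i
        proof -
          have p: "u i \<in> pts H" "T (u i) \<in> pts H"
            using cauchy_seqs_pts[OF u(2)] cauchy_seqs_pts[OF Tc[OF u(2)]] by auto
          have "(ip_norm H (T (u i)))\<^sup>2 \<le> (K * ip_norm H (u i))\<^sup>2"
            using K(2)[rule_format, OF p(1)] norm_nonneg[OF p(2)] by (rule power_mono)
          then show ?thesis using p by (simp add: norm_square power_mult_distrib)
        qed
        then show "\<exists>N. \<forall>i\<ge>N. ip H (T (u i)) (T (u i)) \<le> K\<^sup>2 * ip H (u i) (u i)" by blast
      qed
      then show "(ip_norm compl (completion_map H T U))\<^sup>2 \<le> (K * ip_norm compl U)\<^sup>2"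
        unfolding u completion_map_cls[OF T u(2)]
        using u Tc by (simp add: C.norm_square power_mult_distrib)
    qed (use K C.norm_nonneg \<open>U \<in> pts compl\<close> in simp)
    fix V assume "V \<in> pts compl"
    then obtain v where v: "V = cls v" "v \<in> cauchy_seqs H" unfolding pts_completion by blast
    have "T (vadd H (u i) (v i)) = vadd H (T (u i)) (T (v i))" for i
      using T cauchy_seqs_pts[OF u(2)] cauchy_seqs_pts[OF v(2)] by (simp add: bounded_operator_def)
    then show "completion_map H T (vadd compl U V) =
        vadd compl (completion_map H T U) (completion_map H T V)"
      unfolding u v using u v Tc by (simp add: completion_map_cls[OF T] vadd_cls cauchy_seqs_add)
  qed
qed

lemma completion_map_selfadjoint:
  assumes T: "selfadjoint_operator H T"
  shows "selfadjoint_operator compl (completion_map H T)"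
  unfolding selfadjoint_operator_def
proof (intro conjI ballI)
  have b: "bounded_operator H T" using T by (simp add: selfadjoint_operator_def)
  note Tc = cauchy_seqs_bounded_operator[OF b]
  show "bounded_operator compl (completion_map H T)" by (rule completion_map_bounded[OF b])
  fix U V assume "U \<in> pts compl" "V \<in> pts compl"
  then obtain u v where u: "U = cls u" "u \<in> cauchy_seqs H" and v: "V = cls v" "v \<in> cauchy_seqs H"
    unfolding pts_completion by blast
  have "ip H (T (u i)) (v i) = ip H (u i) (T (v i))" for i
    using T cauchy_seqs_pts[OF u(2)] cauchy_seqs_pts[OF v(2)] by (simp add: selfadjoint_operator_def)
  then show "ip compl (completion_map H T U) V = ip compl U (completion_map H T V)"
    unfolding u v completion_map_cls[OF b u(2)] completion_map_cls[OF b v(2)]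
    using ip_cls_tendsto[OF u(2) Tc[OF v(2)]] by (intro ip_cls_eqI Tc u v) simp
qed

end

section \<open>Projection-valued measures on a Hilbert space\<close>

lemma bounded_measurable_on_abs:
  "bounded_measurable_on K f \<Longrightarrow> bounded_measurable_on K (\<lambda>t. \<bar>f t\<bar>)"
  by (auto simp: bounded_measurable_on_def)

text \<open>Pointwise |f| \<le> \<delta> + f^2 / \<delta>; \<delta> is chosen so that the first term
  contributes at most e/2, and the second tends to 0.\<close>

lemma l2_null_imp_l1_null:
  assumes M: "supported_measure K M" and f: "\<And>n. bounded_measurable_on K (f n)"
    and lim: "(\<lambda>n. \<integral>t. (f n t)\<^sup>2 \<partial>M) \<longlonglongrightarrow> 0"
  shows "(\<lambda>n. \<integral>t. \<bar>f n t\<bar> \<partial>M) \<longlonglongrightarrow> 0"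
proof (rule LIMSEQ_I)
  interpret finite_borel_measure M using M by (simp add: supported_measure_def)
  fix e :: real assume e: "0 < e"
  define s where "s = measure M UNIV + 1"
  have s: "0 < s" "measure M UNIV \<le> s" by (auto simp: s_def add_nonneg_pos)
  define \<delta> where "\<delta> = e / (2 * s)"
  have \<delta>: "0 < \<delta>" using e s by (simp add: \<delta>_def)
  have f2: "bounded_measurable_on K (\<lambda>t. (f n t)\<^sup>2)" for n
    unfolding power2_eq_square by (intro bounded_measurable_on_arith f)
  obtain N where N: "\<And>n. n \<ge> N \<Longrightarrow> \<bar>\<integral>t. (f n t)\<^sup>2 \<partial>M\<bar> < \<delta> * (e/2)"
    using LIMSEQ_D[OF lim, of "\<delta> * (e/2)"] \<delta> e by auto
  have "norm ((\<integral>t. \<bar>f n t\<bar> \<partial>M) - 0) < e" if n: "n \<ge> N" for n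
  proof -
    have "(\<integral>t. \<bar>f n t\<bar> \<partial>M) \<le> (\<integral>t. \<delta> + (f n t)\<^sup>2 / \<delta> \<partial>M)"
    proof (rule integral_mono)
      show "integrable M (\<lambda>t. \<bar>f n t\<bar>)"
        by (intro bounded_measurable_on_integrable[OF M] bounded_measurable_on_abs f)
      show "integrable M (\<lambda>t. \<delta> + (f n t)\<^sup>2 / \<delta>)"
        using bounded_measurable_on_integrable[OF M f2] by simp
      fix t
      have "0 \<le> (\<bar>f n t\<bar> - \<delta>)\<^sup>2 + \<bar>f n t\<bar> * \<delta>" using \<delta> by simp
      then show "\<bar>f n t\<bar> \<le> \<delta> + (f n t)\<^sup>2 / \<delta>"
        using \<delta> by (simp add: field_simps power2_eq_square)
    qed
    also have "\<dots> = \<delta> * measure M UNIV + (\<integral>t. (f n t)\<^sup>2 \<partial>M) / \<delta>"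
      using bounded_measurable_on_integrable[OF M f2] by (simp add: borel_UNIV)
    also have "(\<integral>t. (f n t)\<^sup>2 \<partial>M) / \<delta> < e/2" using N[OF n] \<delta> by (simp add: field_simps)
    also have "\<delta> * measure M UNIV \<le> \<delta> * s" using \<delta> s by simp
    also have "\<delta> * s = e/2" using s by (simp add: \<delta>_def)
    finally show ?thesis by simp
  qed
  then show "\<exists>N. \<forall>n\<ge>N. norm ((\<integral>t. \<bar>f n t\<bar> \<partial>M) - 0) < e" by blast
qed

text \<open>With u = p - a and v = q - b one has p q - a b = u v + u b + a v, and |a|, |b| \<le> 1
  reduces this to L^1 and L^2 errors. The weight \<open>g\<close> is constant for inner products and
  linear for the quadratic form of the operator.\<close>

lemma l2_product_tendsto:
  assumes M: "supported_measure K M" and g: "bounded_measurable_on K g"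
    and p: "\<And>n. bounded_measurable_on K (p n)" "(\<lambda>n. \<integral>t. (p n t - a t)\<^sup>2 \<partial>M) \<longlonglongrightarrow> 0"
    and q: "\<And>n. bounded_measurable_on K (q n)" "(\<lambda>n. \<integral>t. (q n t - b t)\<^sup>2 \<partial>M) \<longlonglongrightarrow> 0"
    and a: "bounded_measurable_on K a" "\<And>t. \<bar>a t\<bar> \<le> 1"
    and b: "bounded_measurable_on K b" "\<And>t. \<bar>b t\<bar> \<le> 1"
  shows "(\<lambda>n. \<integral>t. g t * (p n t * q n t) \<partial>M) \<longlonglongrightarrow> (\<integral>t. g t * (a t * b t) \<partial>M)"
proof -
  obtain C where C: "\<And>t. \<bar>t\<bar> \<le> K \<Longrightarrow> \<bar>g t\<bar> \<le> C"
    using g by (auto simp: bounded_measurable_on_def)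
  note int = bounded_measurable_on_integrable[OF M]
  note ar = bounded_measurable_on_arith
  let ?r = "\<lambda>n t. (p n t - a t)\<^sup>2 + (q n t - b t)\<^sup>2 + \<bar>p n t - a t\<bar> + \<bar>q n t - b t\<bar>"
  have i: "integrable M (\<lambda>t. (p n t - a t)\<^sup>2)" "integrable M (\<lambda>t. (q n t - b t)\<^sup>2)"
    "integrable M (\<lambda>t. \<bar>p n t - a t\<bar>)" "integrable M (\<lambda>t. \<bar>q n t - b t\<bar>)"
    "integrable M (\<lambda>t. g t * (p n t * q n t))" "integrable M (\<lambda>t. g t * (a t * b t))" for n
    by (intro int bounded_measurable_on_square_diff bounded_measurable_on_abs ar p q a b g)+
  have bd: "norm ((\<integral>t. g t * (p n t * q n t) \<partial>M) - (\<integral>t. g t * (a t * b t) \<partial>M)) \<le>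
      \<bar>C\<bar> * (\<integral>t. ?r n t \<partial>M)" for n
  proof -
    have "norm ((\<integral>t. g t * (p n t * q n t) \<partial>M) - (\<integral>t. g t * (a t * b t) \<partial>M)) =
        \<bar>\<integral>t. g t * (p n t * q n t) - g t * (a t * b t) \<partial>M\<bar>" using i by simp
    also have "\<dots> \<le> (\<integral>t. \<bar>g t * (p n t * q n t) - g t * (a t * b t)\<bar> \<partial>M)"
      by (rule integral_abs_bound)
    also have "\<dots> \<le> (\<integral>t. \<bar>C\<bar> * ?r n t \<partial>M)"
    proof (rule integral_mono_AE)
      show "AE t in M. \<bar>g t * (p n t * q n t) - g t * (a t * b t)\<bar> \<le> \<bar>C\<bar> * ?r n t"
      proof (rule supported_AE[OF M])
        fix t assume t: "\<bar>t\<bar> \<le> K"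
        define u v where "u = p n t - a t" and "v = q n t - b t"
        have "\<bar>u * v\<bar> \<le> u\<^sup>2 + v\<^sup>2"
        proof -
          have "0 \<le> (\<bar>u\<bar> - \<bar>v\<bar>)\<^sup>2" by simp
          moreover have "0 \<le> \<bar>u\<bar> * \<bar>v\<bar>" by simp
          ultimately show ?thesis unfolding power2_diff abs_mult power2_abs by linarith
        qed
        moreover have "\<bar>u * b t\<bar> \<le> \<bar>u\<bar>" "\<bar>a t * v\<bar> \<le> \<bar>v\<bar>"
          using a(2)[of t] b(2)[of t] by (auto simp: abs_mult mult_left_le mult_left_le_one_le)
        moreover have "p n t * q n t - a t * b t = u * v + u * b t + a t * v"
          by (simp add: u_def v_def algebra_simps)
        ultimately have "\<bar>p n t * q n t - a t * b t\<bar> \<le> ?r n t"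
          unfolding u_def[symmetric] v_def[symmetric] by linarith
        moreover have "\<bar>g t\<bar> \<le> \<bar>C\<bar>" using C[OF t] by simp
        ultimately have "\<bar>g t\<bar> * \<bar>p n t * q n t - a t * b t\<bar> \<le> \<bar>C\<bar> * ?r n t"
          by (intro mult_mono) auto
        then show "\<bar>g t * (p n t * q n t) - g t * (a t * b t)\<bar> \<le> \<bar>C\<bar> * ?r n t"
          by (simp add: right_diff_distrib[symmetric] abs_mult)
      qed
    qed (use i in simp_all)
    finally show ?thesis by simp
  qed
  have "(\<lambda>n. (\<integral>t. (p n t - a t)\<^sup>2 \<partial>M) + (\<integral>t. (q n t - b t)\<^sup>2 \<partial>M) +
      (\<integral>t. \<bar>p n t - a t\<bar> \<partial>M) + (\<integral>t. \<bar>q n t - b t\<bar> \<partial>M)) \<longlonglongrightarrow> 0 + 0 + 0 + 0"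
    by (intro tendsto_add p(2) q(2) l2_null_imp_l1_null[OF M] ar p(1) q(1) a(1) b(1))
  then have "(\<lambda>n. \<integral>t. ?r n t \<partial>M) \<longlonglongrightarrow> 0" using i by simp
  from tendsto_mult_left[OF this, of "\<bar>C\<bar>"]
  have "(\<lambda>n. \<bar>C\<bar> * (\<integral>t. ?r n t \<partial>M)) \<longlonglongrightarrow> 0" by simp
  from Lim_null_comparison[OF always_eventually[OF allI[OF bd]] this]
  show ?thesis by (simp only: LIM_zero_iff)
qed

locale carrier_hilbert_space = semi_inner_space +
  assumes definite: "x \<in> pts H \<Longrightarrow> y \<in> pts H \<Longrightarrow> ip_dist H x y = 0 \<Longrightarrow> x = y"
    and complete: "u \<in> cauchy_seqs H \<Longrightarrow> \<exists>x\<in>pts H. (\<lambda>i. ip_dist H (u i) x) \<longlonglongrightarrow> 0"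
begin

lemma eqI_dist_square:
  "x \<in> pts H \<Longrightarrow> y \<in> pts H \<Longrightarrow> ip H x x - 2 * ip H x y + ip H y y = 0 \<Longrightarrow> x = y"
  using definite[of x y] by (simp add: dist_eq_sqrt)

text \<open>Turns equality of vectors into equality of numbers, which sums and limits can compute;
  operator identities are proved through it.\<close>

lemma eqI_ip:
  assumes "x \<in> pts H" "y \<in> pts H" "\<And>z. z \<in> pts H \<Longrightarrow> ip H x z = ip H y z"
  shows "x = y"
proof (rule eqI_dist_square[OF assms(1,2)])
  show "ip H x x - 2 * ip H x y + ip H y y = 0"
    using assms(3)[OF assms(1)] assms(3)[OF assms(2)] ip_commute[OF assms(1,2)] by simp
qed

end

lemma (in semi_inner_space) carrier_hilbert_space_completion:
  "carrier_hilbert_space (ip_completion H)"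
  using semi_inner_space_completion completion_definite completion_complete
  by (simp add: carrier_hilbert_space_def carrier_hilbert_space_axioms_def)

locale hilbert_pvm = carrier_hilbert_space +
  fixes P :: "real set \<Rightarrow> 'a \<Rightarrow> 'a"
  assumes pvm: "projection_valued_measure H P"
begin

lemma closed [simp, intro]: "A \<in> sets borel \<Longrightarrow> x \<in> pts H \<Longrightarrow> P A x \<in> pts H"
  using pvm by (simp add: projection_valued_measure_def orthogonal_projection_def
      selfadjoint_operator_def bounded_operator_def)

lemma sym: "A \<in> sets borel \<Longrightarrow> x \<in> pts H \<Longrightarrow> y \<in> pts H \<Longrightarrow> ip H (P A x) y = ip H x (P A y)"
  using pvm by (simp add: projection_valued_measure_def orthogonal_projection_def
      selfadjoint_operator_def)

lemma add: "A \<in> sets borel \<Longrightarrow> x \<in> pts H \<Longrightarrow> y \<in> pts H \<Longrightarrow>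
    P A (vadd H x y) = vadd H (P A x) (P A y)"
  using pvm by (simp add: projection_valued_measure_def orthogonal_projection_def
      selfadjoint_operator_def bounded_operator_def)

lemma inter: "A \<in> sets borel \<Longrightarrow> B \<in> sets borel \<Longrightarrow> x \<in> pts H \<Longrightarrow> P A (P B x) = P (A \<inter> B) x"
  using pvm by (simp add: projection_valued_measure_def)

lemma UNIV: "x \<in> pts H \<Longrightarrow> P UNIV x = x"
  using pvm by (simp add: projection_valued_measure_def)

lemma sums: "range A \<subseteq> sets borel \<Longrightarrow> disjoint_family A \<Longrightarrow> x \<in> pts H \<Longrightarrow>
    (\<lambda>k::nat. ip H (P (A k) x) x) sums ip H (P (\<Union>k. A k) x) x"
  using pvm by (simp add: projection_valued_measure_def)

lemma ip_self: "A \<in> sets borel \<Longrightarrow> x \<in> pts H \<Longrightarrow> ip H (P A x) x = ip H (P A x) (P A x)"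
  using sym[of A "P A x" x] by (simp add: inter)

lemma nonneg: "A \<in> sets borel \<Longrightarrow> x \<in> pts H \<Longrightarrow> 0 \<le> ip H (P A x) x"
  by (simp add: ip_self ip_self_nonneg)

text \<open>The empty set is a disjoint union of infinitely many copies of itself, and a constant
  series converges only if the constant is 0.\<close>

lemma empty: "x \<in> pts H \<Longrightarrow> y \<in> pts H \<Longrightarrow> ip H (P {} x) y = 0"
proof -
  assume x: "x \<in> pts H" and y: "y \<in> pts H"
  have "(\<lambda>k::nat. ip H (P {} x) x) sums ip H (P {} x) x"
    using sums[of "\<lambda>_. {}" x] x by (simp add: disjoint_family_on_def)
  then have "ip H (P {} x) x = 0"
    using sums_summable summable_const_iff by blast
  then have "ip H (P {} x) (P {} x) = 0" using ip_self[of "{}" x] x by simp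
  then show "ip H (P {} x) y = 0"
    using cauchy_schwarz_square[of "P {} x" y] x y by simp
qed

lemma complement:
  assumes A: "A \<in> sets borel" and x: "x \<in> pts H"
  shows "vadd H (P A x) (P (- A) x) = x" and "ip H (P A x) x + ip H (P (- A) x) x = ip H x x"
proof -
  have A': "- A \<in> sets borel" using A by auto
  \<comment> \<open>Additivity is available for sequences of sets, so the two sets are padded with
    empty ones.\<close>
  define D where "D k = (if k = 0 then A else if k = Suc 0 then - A else {})" for k
  have D: "D k \<in> sets borel" for k using A A' by (simp add: D_def)
  have "disjoint_family D" by (auto simp: disjoint_family_on_def D_def split: if_splits)
  moreover have "(\<Union>k. D k) = UNIV"
  proof -
    have "D 0 \<union> D (Suc 0) = UNIV" by (simp add: D_def)
    then show ?thesis by blast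
  qed
  ultimately have "(\<lambda>k. ip H (P (D k) x) x) sums ip H x x"
    using sums[of D x] D x by (auto simp: UNIV)
  moreover have "(\<lambda>k. ip H (P (D k) x) x) sums (\<Sum>k<2. ip H (P (D k) x) x)"
    by (rule sums_finite) (auto simp: D_def empty x)
  ultimately have "ip H x x = (\<Sum>k<2. ip H (P (D k) x) x)" by (rule sums_unique2)
  then show 2: "ip H (P A x) x + ip H (P (- A) x) x = ip H x x"
    by (simp add: D_def numeral_2_eq_2)
  \<comment> \<open>By orthogonality the squared distance from x to the sum of its two parts reduces
    to the second claim.\<close>
  have "ip H (P A x) (P (- A) x) = 0"
    using sym[of A x "P (- A) x"] x A A' inter[OF A A'] empty[OF x x] ip_commute[of x "P {} x"]
    by simp
  then show "vadd H (P A x) (P (- A) x) = x"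
    using x A A' 2 ip_commute[of "P (- A) x" "P A x"] ip_self[OF A x] ip_self[OF A' x]
    by (intro eqI_dist_square) (auto simp: ip_add_left ip_add_right)
qed

abbreviation scalar_measure where "scalar_measure \<equiv> pvm_scalar_measure H P"

lemma emeasure_scalar_measure:
  assumes x: "x \<in> pts H" and A: "A \<in> sets borel"
  shows "emeasure (scalar_measure x) A = ennreal (ip H (P A x) x)"
proof (rule emeasure_measure_of[OF pvm_scalar_measure_def])
  show "countably_additive (sets (scalar_measure x)) (\<lambda>A. ennreal (ip H (P A x) x))"
    unfolding countably_additive_def
  proof (intro allI impI)
    fix D :: "nat \<Rightarrow> real set"
    assume D: "range D \<subseteq> sets (scalar_measure x)" and d: "disjoint_family D"
    have D: "range D \<subseteq> sets borel" using D
      by (simp add: pvm_scalar_measure_def sets.sigma_sets_eq[of borel, simplified])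
    from sums[OF D d x]
    show "(\<Sum>i. ennreal (ip H (P (D i) x) x)) = ennreal (ip H (P (\<Union> (range D)) x) x)"
      using D x by (subst suminf_ennreal2) (auto simp: sums_iff intro!: nonneg)
  qed
qed (use A empty[OF x x] in \<open>auto simp: positive_def pvm_scalar_measure_def\<close>)

lemma sets_scalar_measure [simp]: "sets (scalar_measure x) = sets borel"
  by (simp add: pvm_scalar_measure_def sets.sigma_sets_eq[of borel, simplified])

lemma space_scalar_measure [simp]: "space (scalar_measure x) = UNIV"
  by (simp add: pvm_scalar_measure_def)

lemma measure_scalar_measure:
  "x \<in> pts H \<Longrightarrow> A \<in> sets borel \<Longrightarrow> measure (scalar_measure x) A = ip H (P A x) x"
  by (simp add: measure_def emeasure_scalar_measure nonneg)

lemma finite_borel_scalar_measure: "x \<in> pts H \<Longrightarrow> finite_borel_measure (scalar_measure x)"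
  unfolding finite_borel_measure_def finite_borel_measure_axioms_def
  by (auto intro!: finite_measureI simp: emeasure_scalar_measure)

text \<open>Multiplicativity of \<open>P\<close> turns projecting the vector into restricting its
  measure. The quadratic form of an operator on the range of \<open>P A\<close> thereby becomes an
  integral over \<open>A\<close>.\<close>

lemma scalar_measure_restrict:
  assumes x: "x \<in> pts H" and A: "A \<in> sets borel"
  shows "scalar_measure (P A x) = density (scalar_measure x) (\<lambda>t. ennreal (indicator A t))"
proof (rule measure_eqI)
  fix C assume "C \<in> sets (scalar_measure (P A x))"
  then have C: "C \<in> sets borel" by simp
  have "ip H (P C (P A x)) (P A x) = ip H (P (A \<inter> C) x) x"
  proof -
    have "A \<inter> (C \<inter> A) = A \<inter> C" by blast
    then show ?thesis using sym[of A "P C (P A x)" x] A C x by (simp add: inter)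
  qed
  then have "emeasure (scalar_measure (P A x)) C = emeasure (scalar_measure x) (A \<inter> C)"
    using A C x by (simp add: emeasure_scalar_measure)
  also have "\<dots> = (\<integral>\<^sup>+t. indicator (A \<inter> C) t \<partial>scalar_measure x)"
    using A C by (intro nn_integral_indicator[symmetric]) auto
  also have "\<dots> = (\<integral>\<^sup>+t. ennreal (indicator A t) * indicator C t \<partial>scalar_measure x)"
    by (intro nn_integral_cong) (simp add: indicator_def)
  also have "\<dots> = emeasure (density (scalar_measure x) (\<lambda>t. ennreal (indicator A t))) C"
    using A C by (intro emeasure_density[symmetric]) (auto cong: measurable_cong_sets)
  finally show "emeasure (scalar_measure (P A x)) C =
      emeasure (density (scalar_measure x) (\<lambda>t. ennreal (indicator A t))) C" .
qed simp

end

section \<open>Spectral resolution of an operator with moment measures\<close>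

text \<open>Collects what the spectral theorem takes from the finite matrices: the moments of each
  vector are limits of moments of atomic measures on one interval.\<close>

locale moment_operator = carrier_hilbert_space +
  fixes T :: "'a \<Rightarrow> 'a" and K :: real
  assumes T: "selfadjoint_operator H T" and K_nonneg: "0 \<le> K"
    and approximable: "x \<in> pts H \<Longrightarrow> approximable_moments K (\<lambda>j. ip H ((T ^^ j) x) x)"
begin

lemma T_closed [simp, intro]: "x \<in> pts H \<Longrightarrow> T x \<in> pts H"
  using T by (simp add: selfadjoint_operator_def bounded_operator_def)

lemma T_pow_closed [simp, intro]: "x \<in> pts H \<Longrightarrow> (T ^^ j) x \<in> pts H"
  by (induction j) auto

lemma T_sym: "x \<in> pts H \<Longrightarrow> y \<in> pts H \<Longrightarrow> ip H (T x) y = ip H x (T y)"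
  using T by (simp add: selfadjoint_operator_def)

lemma T_add: "x \<in> pts H \<Longrightarrow> y \<in> pts H \<Longrightarrow> T (vadd H x y) = vadd H (T x) (T y)"
  using T by (simp add: selfadjoint_operator_def bounded_operator_def)

lemma T_scale: "x \<in> pts H \<Longrightarrow> T (vscale H c x) = vscale H c (T x)"
  using T by (simp add: selfadjoint_operator_def bounded_operator_def)

lemma T_pow_add: "x \<in> pts H \<Longrightarrow> y \<in> pts H \<Longrightarrow> (T ^^ j) (vadd H x y) = vadd H ((T ^^ j) x) ((T ^^ j) y)"
  by (induction j) (auto simp: T_add)

lemma T_pow_scale: "x \<in> pts H \<Longrightarrow> (T ^^ j) (vscale H c x) = vscale H c ((T ^^ j) x)"
  by (induction j) (auto simp: T_scale)

lemma T_pow_ip: "x \<in> pts H \<Longrightarrow> y \<in> pts H \<Longrightarrow> ip H ((T ^^ i) x) ((T ^^ j) y) = ip H ((T ^^ (i + j)) x) y"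
proof (induction j arbitrary: i)
  case (Suc j)
  have "ip H ((T ^^ i) x) (T ((T ^^ j) y)) = ip H ((T ^^ Suc i) x) ((T ^^ j) y)"
    using Suc.prems by (simp add: T_sym)
  then show ?case using Suc.IH[of "Suc i"] Suc.prems by simp
qed simp

lemma T_pow_sym: "x \<in> pts H \<Longrightarrow> y \<in> pts H \<Longrightarrow> ip H ((T ^^ i) x) y = ip H ((T ^^ i) y) x"
  using T_pow_ip[of x y 0 i] by (simp add: ip_commute)

text \<open>Chosen separately for every vector. Different vectors are compared through common
  polynomials of the operator, so the choices need not be coordinated.\<close>

definition \<mu> :: "'a \<Rightarrow> real measure" where
  "\<mu> x = (SOME M. moment_sequence K M (\<lambda>j. ip H ((T ^^ j) x) x))"

lemma moment_sequence_mu: "x \<in> pts H \<Longrightarrow> moment_sequence K (\<mu> x) (\<lambda>j. ip H ((T ^^ j) x) x)"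
  unfolding \<mu>_def by (rule someI_ex[OF moment_sequence_exists[OF approximable K_nonneg]])

lemma supported_mu: "x \<in> pts H \<Longrightarrow> supported_measure K (\<mu> x)"
  and moments_mu: "x \<in> pts H \<Longrightarrow> (\<integral>t. t ^ j \<partial>\<mu> x) = ip H ((T ^^ j) x) x"
  using moment_sequence_mu by (simp_all add: moment_sequence_def)

lemma finite_borel_mu: "x \<in> pts H \<Longrightarrow> finite_borel_measure (\<mu> x)"
  using supported_mu by (simp add: supported_measure_def)

lemma sets_mu: "x \<in> pts H \<Longrightarrow> sets (\<mu> x) = sets borel"
  using finite_borel_mu by (simp add: finite_borel_measure_def finite_borel_measure_axioms_def)

lemma measure_mu_UNIV: "x \<in> pts H \<Longrightarrow> measure (\<mu> x) UNIV = ip H x x"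
  using moments_mu[of x 0] finite_borel_measure.borel_UNIV[OF finite_borel_mu] by simp

text \<open>The recursion starts at the constant term because the record \<open>ip_space\<close> has
  no zero vector.\<close>

primrec lincomb :: "(nat \<Rightarrow> real) \<Rightarrow> nat \<Rightarrow> 'a \<Rightarrow> 'a" where
  "lincomb c 0 x = vscale H (c 0) x"
| "lincomb c (Suc n) x = vadd H (lincomb c n x) (vscale H (c (Suc n)) ((T ^^ Suc n) x))"

definition apply_poly :: "real poly \<Rightarrow> 'a \<Rightarrow> 'a" where
  "apply_poly p = lincomb (coeff p) (degree p)"

lemma lincomb_closed: "x \<in> pts H \<Longrightarrow> lincomb c n x \<in> pts H"
  by (induction n) (auto simp del: funpow.simps)

lemma apply_poly_closed [simp, intro]: "x \<in> pts H \<Longrightarrow> apply_poly p x \<in> pts H"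
  by (simp add: apply_poly_def lincomb_closed)

lemma ip_lincomb:
  "x \<in> pts H \<Longrightarrow> y \<in> pts H \<Longrightarrow> ip H (lincomb c n x) y = (\<Sum>j\<le>n. c j * ip H ((T ^^ j) x) y)"
  by (induction n) (auto simp: ip_add_left ip_scale_left lincomb_closed simp del: funpow.simps)

lemma ip_apply_poly:
  "x \<in> pts H \<Longrightarrow> y \<in> pts H \<Longrightarrow>
    ip H (apply_poly p x) y = (\<Sum>j\<le>degree p. coeff p j * ip H ((T ^^ j) x) y)"
  by (simp add: apply_poly_def ip_lincomb)

text \<open>Self-adjointness collects both powers on one side. The result depends on the exponents
  through i + j alone and is unchanged when x and y are exchanged, as \<open>proj_ip_commute\<close>
  uses.\<close>

lemma ip_apply_poly_two:
  assumes "x \<in> pts H" "y \<in> pts H"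
  shows "ip H (apply_poly p x) (apply_poly q y) =
    (\<Sum>i\<le>degree p. \<Sum>j\<le>degree q. coeff p i * coeff q j * ip H ((T ^^ (i + j)) x) y)"
proof -
  have "ip H (apply_poly p x) (apply_poly q y) =
      (\<Sum>i\<le>degree p. coeff p i * ip H (apply_poly q y) ((T ^^ i) x))"
    using assms by (simp add: ip_apply_poly ip_commute)
  also have "\<dots> = (\<Sum>i\<le>degree p. coeff p i * (\<Sum>j\<le>degree q. coeff q j * ip H ((T ^^ (i + j)) x) y))"
    using assms by (simp add: ip_apply_poly T_pow_ip T_pow_sym[of y x] add.commute)
  finally show ?thesis by (simp add: sum_distrib_left mult.assoc)
qed

lemma integrable_poly_mult: "x \<in> pts H \<Longrightarrow> integrable (\<mu> x) (\<lambda>t. poly p t * poly q t)"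
  by (intro bounded_measurable_on_integrable[OF supported_mu] bounded_measurable_on_arith
      bounded_measurable_on_poly)

lemma ip_apply_poly_integral:
  assumes x: "x \<in> pts H"
  shows "ip H (apply_poly p x) (apply_poly q x) = (\<integral>t. poly p t * poly q t \<partial>\<mu> x)"
proof -
  have i: "integrable (\<mu> x) (\<lambda>t. t ^ j)" for j
    by (rule supported_integrable_continuous[OF supported_mu[OF x]])
      (rule continuous_on_power[OF continuous_on_id])
  have "(\<integral>t. poly p t * poly q t \<partial>\<mu> x) =
      (\<integral>t. (\<Sum>i\<le>degree p. \<Sum>j\<le>degree q. coeff p i * coeff q j * t ^ (i + j)) \<partial>\<mu> x)"
    by (simp add: poly_altdef sum_product power_add mult_ac)
  also have "\<dots> = (\<Sum>i\<le>degree p. \<Sum>j\<le>degree q. coeff p i * coeff q j * (\<integral>t. t ^ (i + j) \<partial>\<mu> x))"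
    using i by (simp add: Bochner_Integration.integral_sum)
  finally show ?thesis using x by (simp add: ip_apply_poly_two moments_mu)
qed

lemma apply_poly_add: "x \<in> pts H \<Longrightarrow> y \<in> pts H \<Longrightarrow>
    apply_poly p (vadd H x y) = vadd H (apply_poly p x) (apply_poly p y)"
  by (rule eqI_ip) (auto simp: ip_apply_poly T_pow_add ip_add_left sum.distrib distrib_left)

lemma apply_poly_scale: "x \<in> pts H \<Longrightarrow> apply_poly p (vscale H c x) = vscale H c (apply_poly p x)"
  by (rule eqI_ip) (auto simp: ip_apply_poly T_pow_scale ip_scale_left sum_distrib_left mult_ac)

lemma apply_poly_sym: "x \<in> pts H \<Longrightarrow> y \<in> pts H \<Longrightarrow> ip H (apply_poly p x) y = ip H x (apply_poly p y)"
  using T_pow_sym by (simp add: ip_commute[of x "apply_poly p y"] ip_apply_poly)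

lemma apply_poly_one: "x \<in> pts H \<Longrightarrow> apply_poly [:1:] x = x"
  by (rule eqI_ip) (auto simp: ip_apply_poly)

lemma T_apply_poly: 
  assumes x: "x \<in> pts H"
  shows "T (apply_poly p x) = apply_poly (pCons 0 p) x"
proof (rule eqI_ip)
  fix z assume z: "z \<in> pts H"
  have "ip H (T (apply_poly p x)) z = (\<Sum>j\<le>degree p. coeff p j * ip H ((T ^^ Suc j) x) z)"
    using x z by (simp add: T_sym ip_apply_poly)
  also have "\<dots> = (\<Sum>j\<le>Suc (degree p). coeff (pCons 0 p) j * ip H ((T ^^ j) x) z)"
    by (subst sum.atMost_Suc_shift) simp
  also have "\<dots> = (\<Sum>j\<le>degree (pCons 0 p). coeff (pCons 0 p) j * ip H ((T ^^ j) x) z)"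
    by (cases "p = 0") (auto simp: degree_pCons_eq)
  finally show "ip H (T (apply_poly p x)) z = ip H (apply_poly (pCons 0 p) x) z"
    using x z by (simp add: ip_apply_poly)
qed (use x in auto)

lemma dist_apply_poly:
  assumes x: "x \<in> pts H"
  shows "(ip_dist H (apply_poly p x) (apply_poly q x))\<^sup>2 = (\<integral>t. (poly p t - poly q t)\<^sup>2 \<partial>\<mu> x)"
proof -
  have "(\<integral>t. (poly p t - poly q t)\<^sup>2 \<partial>\<mu> x) =
      (\<integral>t. poly p t * poly p t - 2 * (poly p t * poly q t) + poly q t * poly q t \<partial>\<mu> x)"
    by (simp add: power2_eq_square algebra_simps)
  also have "\<dots> = (\<integral>t. poly p t * poly p t \<partial>\<mu> x) - 2 * (\<integral>t. poly p t * poly q t \<partial>\<mu> x) +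
      (\<integral>t. poly q t * poly q t \<partial>\<mu> x)"
    using integrable_poly_mult[OF x] by simp
  finally show ?thesis using x by (simp add: dist_square ip_apply_poly_integral)
qed

section \<open>Spectral projections as limits of polynomials of the operator\<close>

definition approximates :: "(nat \<Rightarrow> real poly) \<Rightarrow> real set \<Rightarrow> 'a \<Rightarrow> bool" where
  "approximates p A x \<longleftrightarrow> (\<lambda>n. \<integral>t. (poly (p n) t - indicator A t)\<^sup>2 \<partial>\<mu> x) \<longlonglongrightarrow> 0"

text \<open>A single sequence for finitely many vectors, whose measures are a priori
  unrelated.\<close>

lemma approximates_exists:
  assumes F: "finite F" "F \<subseteq> pts H" and A: "A \<in> sets borel"
  shows "\<exists>p. \<forall>x\<in>F. approximates p A x"
proof -
  have "poly_l2_approximable (\<mu> ` F) (indicator A)"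
    by (rule poly_l2_approximable_indicator[of _ K]) (use F A supported_mu in auto)
  then have "\<forall>n. \<exists>p. \<forall>M\<in>\<mu> ` F. (\<integral>t. (poly p t - indicator A t)\<^sup>2 \<partial>M) < inverse (real (Suc n))"
    unfolding poly_l2_approximable_def by simp
  from choice[OF this] obtain p where
    p: "\<And>n x. x \<in> F \<Longrightarrow> (\<integral>t. (poly (p n) t - indicator A t)\<^sup>2 \<partial>\<mu> x) < inverse (real (Suc n))"
    by auto
  have "approximates p A x" if x: "x \<in> F" for x
    unfolding approximates_def
  proof (rule Lim_null_comparison[OF always_eventually[OF allI] LIMSEQ_inverse_real_of_nat])
    show "norm (\<integral>t. (poly (p n) t - indicator A t)\<^sup>2 \<partial>\<mu> x) \<le> inverse (real (Suc n))" for n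
      using p[OF x, of n] by (simp add: abs_of_nonneg)
  qed
  then show ?thesis by blast
qed

lemma dist_apply_poly_le:
  assumes x: "x \<in> pts H" and A: "A \<in> sets borel"
  shows "(ip_dist H (apply_poly p x) (apply_poly q x))\<^sup>2 \<le>
    2 * (\<integral>t. (poly p t - indicator A t)\<^sup>2 \<partial>\<mu> x) + 2 * (\<integral>t. (poly q t - indicator A t)\<^sup>2 \<partial>\<mu> x)"
  unfolding dist_apply_poly[OF x]
  by (rule integral_square_add_le[OF supported_mu[OF x]])
    (auto intro!: bounded_measurable_on_arith bounded_measurable_on_poly
      bounded_measurable_on_indicator A)

lemma approximates_cauchy:
  assumes x: "x \<in> pts H" and A: "A \<in> sets borel" and p: "approximates p A x"
  shows "(\<lambda>n. apply_poly (p n) x) \<in> cauchy_seqs H"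
  unfolding cauchy_seqs_def
proof (intro CollectI conjI allI impI)
  fix e :: real assume e: "0 < e"
  obtain N where N: "\<And>n. n \<ge> N \<Longrightarrow> \<bar>\<integral>t. (poly (p n) t - indicator A t)\<^sup>2 \<partial>\<mu> x\<bar> < e\<^sup>2 / 4"
    using LIMSEQ_D[OF p[unfolded approximates_def], of "e\<^sup>2 / 4"] e by auto
  have "ip_dist H (apply_poly (p i) x) (apply_poly (p j) x) < e" if "i \<ge> N" "j \<ge> N" for i j
  proof (rule power2_less_imp_less)
    show "(ip_dist H (apply_poly (p i) x) (apply_poly (p j) x))\<^sup>2 < e\<^sup>2"
      using dist_apply_poly_le[OF x A, of "p i" "p j"] N[OF that(1)] N[OF that(2)] by argo
  qed (use e in simp)
  then show "\<exists>N. \<forall>i\<ge>N. \<forall>j\<ge>N. ip_dist H (apply_poly (p i) x) (apply_poly (p j) x) < e"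
    by blast
qed (use x in auto)

text \<open>Convergence is demanded along every approximating sequence, so that proofs may use one
  common to several vectors.\<close>

definition proj :: "real set \<Rightarrow> 'a \<Rightarrow> 'a" where
  "proj A x = (SOME z. z \<in> pts H \<and>
     (\<forall>p. approximates p A x \<longrightarrow> (\<lambda>n. ip_dist H (apply_poly (p n) x) z) \<longlonglongrightarrow> 0))"

lemma proj_spec:
  assumes x: "x \<in> pts H" and A: "A \<in> sets borel"
  shows "proj A x \<in> pts H" and
    "approximates p A x \<Longrightarrow> (\<lambda>n. ip_dist H (apply_poly (p n) x) (proj A x)) \<longlonglongrightarrow> 0"
proof -
  obtain q where q: "approximates q A x" using approximates_exists[of "{x}" A] x A by auto
  obtain z where z: "z \<in> pts H" "(\<lambda>n. ip_dist H (apply_poly (q n) x) z) \<longlonglongrightarrow> 0"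
    using complete[OF approximates_cauchy[OF x A q]] by blast
  have "(\<lambda>n. ip_dist H (apply_poly (p n) x) z) \<longlonglongrightarrow> 0" if p: "approximates p A x" for p
  proof -
    have "(\<lambda>n. 2 * (\<integral>t. (poly (p n) t - indicator A t)\<^sup>2 \<partial>\<mu> x) +
        2 * (\<integral>t. (poly (q n) t - indicator A t)\<^sup>2 \<partial>\<mu> x)) \<longlonglongrightarrow> 2 * 0 + 2 * 0"
      using p q unfolding approximates_def by (intro tendsto_intros)
    then have s: "(\<lambda>n. 2 * (\<integral>t. (poly (p n) t - indicator A t)\<^sup>2 \<partial>\<mu> x) +
        2 * (\<integral>t. (poly (q n) t - indicator A t)\<^sup>2 \<partial>\<mu> x)) \<longlonglongrightarrow> 0" by simp
    have "(\<lambda>n. (ip_dist H (apply_poly (p n) x) (apply_poly (q n) x))\<^sup>2) \<longlonglongrightarrow> 0"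
      by (rule Lim_null_comparison[OF always_eventually[OF allI] s])
        (use dist_apply_poly_le[OF x A] in simp)
    then have d: "(\<lambda>n. ip_dist H (apply_poly (p n) x) (apply_poly (q n) x)) \<longlonglongrightarrow> 0"
      using tendsto_real_sqrt[of "\<lambda>n. (ip_dist H (apply_poly (p n) x) (apply_poly (q n) x))\<^sup>2" 0]
        x dist_nonneg by simp
    show ?thesis
    proof (rule Lim_null_comparison[OF always_eventually[OF allI]])
      show "norm (ip_dist H (apply_poly (p n) x) z) \<le>
          ip_dist H (apply_poly (p n) x) (apply_poly (q n) x) + ip_dist H (apply_poly (q n) x) z" for n
        using dist_triangle[of "apply_poly (p n) x" "apply_poly (q n) x" z] x z
          dist_nonneg[of "apply_poly (p n) x" z] by simp
      show "(\<lambda>n. ip_dist H (apply_poly (p n) x) (apply_poly (q n) x) +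
          ip_dist H (apply_poly (q n) x) z) \<longlonglongrightarrow> 0"
        using tendsto_add[OF d z(2)] by simp
    qed
  qed
  with z have "\<exists>z. z \<in> pts H \<and>
     (\<forall>p. approximates p A x \<longrightarrow> (\<lambda>n. ip_dist H (apply_poly (p n) x) z) \<longlonglongrightarrow> 0)" by blast
  from someI_ex[OF this, folded proj_def]
  show "proj A x \<in> pts H" and
    "approximates p A x \<Longrightarrow> (\<lambda>n. ip_dist H (apply_poly (p n) x) (proj A x)) \<longlonglongrightarrow> 0"
    by auto
qed

lemma proj_closed [simp, intro]: "x \<in> pts H \<Longrightarrow> A \<in> sets borel \<Longrightarrow> proj A x \<in> pts H"
  by (rule proj_spec)

lemma proj_ip_tendsto:
  assumes x: "x \<in> pts H" and y: "y \<in> pts H" and A: "A \<in> sets borel" and p: "approximates p A x"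
  shows "(\<lambda>n. ip H (apply_poly (p n) x) y) \<longlonglongrightarrow> ip H (proj A x) y"
  by (rule ip_tendsto[OF _ _ _ _ proj_spec(2)[OF x A p]]) (use x y A in \<open>auto simp: dist_self\<close>)

text \<open>In the integral of a product of two polynomials both factors tend to indicators; this
  ties the projections to the measure of x.\<close>

lemma proj_ip_proj:
  assumes x: "x \<in> pts H" and A: "A \<in> sets borel" and B: "B \<in> sets borel"
  shows "ip H (proj A x) (proj B x) = measure (\<mu> x) (A \<inter> B)"
proof -
  obtain p where p: "approximates p A x" using approximates_exists[of "{x}" A] x A by auto
  obtain q where q: "approximates q B x" using approximates_exists[of "{x}" B] x B by auto
  interpret M: finite_borel_measure "\<mu> x" by (rule finite_borel_mu[OF x])
  have "(\<lambda>n. ip H (apply_poly (p n) x) (apply_poly (q n) x)) \<longlonglongrightarrow> ip H (proj A x) (proj B x)"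
    by (rule ip_tendsto) (use x A B p q proj_spec in auto)
  moreover have "(\<lambda>n. \<integral>t. 1 * (poly (p n) t * poly (q n) t) \<partial>\<mu> x) \<longlonglongrightarrow>
      (\<integral>t. 1 * (indicator A t * indicator B t) \<partial>\<mu> x)"
    by (rule l2_product_tendsto[OF supported_mu[OF x]])
      (use p q in \<open>simp_all add: approximates_def bounded_measurable_on_poly A B
        bounded_measurable_on_indicator bounded_measurable_on_continuous abs_indicator\<close>)
  moreover have "(\<integral>t. 1 * (indicator A t * indicator B t) \<partial>\<mu> x) = measure (\<mu> x) (A \<inter> B)"
    by (simp add: indicator_inter_arith[symmetric] M.borel_UNIV)
  ultimately show ?thesis
    using x LIMSEQ_unique by (fastforce simp: ip_apply_poly_integral)
qed


text \<open>Polynomials of the operator are additive, and a sequence common to x, y and x + y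
  carries this to the limit.\<close>

lemma proj_add:
  assumes x: "x \<in> pts H" and y: "y \<in> pts H" and A: "A \<in> sets borel"
  shows "proj A (vadd H x y) = vadd H (proj A x) (proj A y)"
proof (rule eqI_ip)
  fix z assume z: "z \<in> pts H"
  obtain p where p: "\<forall>w\<in>{x, y, vadd H x y}. approximates p A w"
    using approximates_exists[of "{x, y, vadd H x y}" A] x y A by auto
  have "(\<lambda>n. ip H (apply_poly (p n) (vadd H x y)) z) \<longlonglongrightarrow> ip H (proj A x) z + ip H (proj A y) z"
    using tendsto_add[OF proj_ip_tendsto[of x z A p] proj_ip_tendsto[of y z A p]] x y z A p
    by (simp add: apply_poly_add ip_add_left)
  moreover have "(\<lambda>n. ip H (apply_poly (p n) (vadd H x y)) z) \<longlonglongrightarrow> ip H (proj A (vadd H x y)) z"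
    using x y z A p by (intro proj_ip_tendsto) auto
  ultimately show "ip H (proj A (vadd H x y)) z = ip H (vadd H (proj A x) (proj A y)) z"
    using LIMSEQ_unique x y z A by (fastforce simp: ip_add_left)
qed (use x y A in auto)

lemma proj_scale:
  assumes x: "x \<in> pts H" and A: "A \<in> sets borel"
  shows "proj A (vscale H c x) = vscale H c (proj A x)"
proof (rule eqI_ip)
  fix z assume z: "z \<in> pts H"
  obtain p where p: "\<forall>w\<in>{x, vscale H c x}. approximates p A w"
    using approximates_exists[of "{x, vscale H c x}" A] x A by auto
  have "(\<lambda>n. ip H (apply_poly (p n) (vscale H c x)) z) \<longlonglongrightarrow> c * ip H (proj A x) z"
    using tendsto_mult_left[OF proj_ip_tendsto[of x z A p], of c] x z A p
    by (simp add: apply_poly_scale ip_scale_left)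
  moreover have "(\<lambda>n. ip H (apply_poly (p n) (vscale H c x)) z) \<longlonglongrightarrow> ip H (proj A (vscale H c x)) z"
    using x z A p by (intro proj_ip_tendsto) auto
  ultimately show "ip H (proj A (vscale H c x)) z = ip H (vscale H c (proj A x)) z"
    using LIMSEQ_unique x z A by (fastforce simp: ip_scale_left)
qed (use x A in auto)

lemma proj_sym:
  assumes x: "x \<in> pts H" and y: "y \<in> pts H" and A: "A \<in> sets borel"
  shows "ip H (proj A x) y = ip H x (proj A y)"
proof -
  obtain p where p: "\<forall>w\<in>{x, y}. approximates p A w"
    using approximates_exists[of "{x, y}" A] x y A by auto
  have "(\<lambda>n. ip H (apply_poly (p n) x) y) \<longlonglongrightarrow> ip H (proj A x) y"
    using x y A p by (intro proj_ip_tendsto) auto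
  moreover have "(\<lambda>n. ip H (apply_poly (p n) x) y) \<longlonglongrightarrow> ip H (proj A y) x"
    using proj_ip_tendsto[of y x A p] x y A p
    by (simp add: apply_poly_sym[of x y] ip_commute[of x "apply_poly _ y"])
  ultimately have "ip H (proj A x) y = ip H (proj A y) x" by (rule LIMSEQ_unique)
  then show ?thesis using x y A by (simp add: ip_commute)
qed

lemma proj_UNIV:
  assumes x: "x \<in> pts H"
  shows "proj UNIV x = x"
proof -
  have "approximates (\<lambda>_. [:1:]) UNIV x" by (simp add: approximates_def)
  from proj_spec(2)[OF x _ this] have "(\<lambda>n::nat. ip_dist H x (proj UNIV x)) \<longlonglongrightarrow> 0"
    using x by (simp add: apply_poly_one)
  then have "ip_dist H x (proj UNIV x) = 0" by (simp add: LIMSEQ_const_iff)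
  then show ?thesis using definite[of x "proj UNIV x"] x by simp
qed

lemma proj_ip_self:
  "x \<in> pts H \<Longrightarrow> A \<in> sets borel \<Longrightarrow> ip H (proj A x) x = measure (\<mu> x) A"
  using proj_ip_proj[of x A UNIV] by (simp add: proj_UNIV)

text \<open>Polynomials of one self-adjoint operator commute; in the limit the bilinear form becomes
  symmetric, as the polarization in \<open>proj_inter\<close> requires.\<close>

lemma proj_ip_commute:
  assumes x: "x \<in> pts H" and y: "y \<in> pts H" and A: "A \<in> sets borel" and B: "B \<in> sets borel"
  shows "ip H (proj A x) (proj B y) = ip H (proj A y) (proj B x)"
proof -
  obtain p where p: "\<forall>w\<in>{x, y}. approximates p A w"
    using approximates_exists[of "{x, y}" A] x y A by auto
  obtain q where q: "\<forall>w\<in>{x, y}. approximates q B w"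
    using approximates_exists[of "{x, y}" B] x y B by auto
  have "(\<lambda>n. ip H (apply_poly (p n) x) (apply_poly (q n) y)) \<longlonglongrightarrow> ip H (proj A x) (proj B y)"
    by (rule ip_tendsto) (use x y A B p q proj_spec in auto)
  moreover have "(\<lambda>n. ip H (apply_poly (p n) y) (apply_poly (q n) x)) \<longlonglongrightarrow> ip H (proj A y) (proj B x)"
    by (rule ip_tendsto) (use x y A B p q proj_spec in auto)
  moreover have "ip H (apply_poly (p n) x) (apply_poly (q n) y) =
      ip H (apply_poly (p n) y) (apply_poly (q n) x)" for n
    using x y by (simp add: ip_apply_poly_two T_pow_sym[of x y])
  ultimately show ?thesis using LIMSEQ_unique by simp
qed

lemma proj_inter:
  assumes x: "x \<in> pts H" and A: "A \<in> sets borel" and B: "B \<in> sets borel"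
  shows "proj (A \<inter> B) x = proj A (proj B x)"
proof (rule eqI_ip)
  have AB: "A \<inter> B \<in> sets borel" using A B by auto
  show "proj (A \<inter> B) x \<in> pts H" "proj A (proj B x) \<in> pts H" using x A B AB by auto
  fix y assume y: "y \<in> pts H"
  have d: "ip H (proj A w) (proj B w) = ip H (proj (A \<inter> B) w) w" if "w \<in> pts H" for w
    using that A B AB by (simp add: proj_ip_proj proj_ip_self)
  \<comment> \<open>Polarization: the identity \<open>d\<close> of quadratic forms at x, y and x + y
    leaves twice the mixed term.\<close>
  have "2 * ip H (proj A y) (proj B x) = 2 * ip H (proj (A \<inter> B) x) y"
    using d[of "vadd H x y"] d[OF x] d[OF y] x y A B AB proj_ip_commute[OF x y A B]
      proj_sym[OF y x AB] ip_commute[of y "proj (A \<inter> B) x"]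
    by (simp add: proj_add ip_add_left ip_add_right)
  then show "ip H (proj (A \<inter> B) x) y = ip H (proj A (proj B x)) y"
    using proj_sym[of "proj B x" y A] x y A B by (simp add: ip_commute[of "proj B x" "proj A y"])
qed

lemma orthogonal_projection_proj:
  assumes A: "A \<in> sets borel" shows "orthogonal_projection H (proj A)"
  unfolding orthogonal_projection_def selfadjoint_operator_def bounded_operator_def
proof (intro conjI ballI allI exI[of _ 1])
  fix x assume x: "x \<in> pts H"
  interpret M: finite_borel_measure "\<mu> x" by (rule finite_borel_mu[OF x])
  show "proj A x \<in> pts H" using x A by simp
  show "proj A (proj A x) = proj A x" using proj_inter[OF x A A] by simp
  show "proj A (vscale H c x) = vscale H c (proj A x)" for c using proj_scale[OF x A] .
  show "ip_norm H (proj A x) \<le> 1 * ip_norm H x"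
    using proj_ip_proj[OF x A A] M.bounded_measure[of A] x
    by (simp add: ip_norm_def measure_mu_UNIV[OF x, symmetric] M.borel_UNIV)
  fix y assume y: "y \<in> pts H"
  show "proj A (vadd H x y) = vadd H (proj A x) (proj A y)" using proj_add[OF x y A] .
  show "ip H (proj A x) y = ip H x (proj A y)" using proj_sym[OF x y A] .
qed

lemma pvm_proj: "projection_valued_measure H proj"
  unfolding projection_valued_measure_def
proof (intro conjI ballI allI impI)
  fix D :: "nat \<Rightarrow> real set" and x
  assume D: "range D \<subseteq> sets borel" "disjoint_family D" and x: "x \<in> pts H"
  interpret M: finite_borel_measure "\<mu> x" by (rule finite_borel_mu[OF x])
  have "(\<lambda>k. measure (\<mu> x) (D k)) sums measure (\<mu> x) (\<Union>k. D k)"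
    by (rule M.finite_measure_UNION) (use D sets_mu[OF x] in auto)
  then show "(\<lambda>k. ip H (proj (D k) x) x) sums ip H (proj (\<Union>k. D k) x) x"
    using D x by (subst proj_ip_self proj_ip_self[OF x sets.countable_UN]; auto simp: proj_ip_self)
qed (auto simp: orthogonal_projection_proj proj_UNIV proj_inter)

sublocale Q: hilbert_pvm H proj by unfold_locales (rule pvm_proj)

lemma scalar_measure_proj: "x \<in> pts H \<Longrightarrow> pvm_scalar_measure H proj x = \<mu> x"
  by (rule measure_eqI)
    (auto simp: sets_mu Q.emeasure_scalar_measure proj_ip_self
      finite_measure.emeasure_eq_measure[OF finite_borel_measure.axioms(1)[OF finite_borel_mu]])

lemma integrable_id_mu: "x \<in> pts H \<Longrightarrow> integrable (\<mu> x) (\<lambda>t. t)"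
  by (rule supported_integrable_continuous[OF supported_mu continuous_on_id])

theorem spectral_resolution_proj: "spectral_resolution H T proj"
  unfolding spectral_resolution_def
  using T pvm_proj integrable_id_mu moments_mu[of _ 1] by (simp add: scalar_measure_proj)

lemma ip_T_apply_poly:
  assumes x: "x \<in> pts H"
  shows "ip H (T (apply_poly p x)) (apply_poly p x) = (\<integral>t. t * (poly p t * poly p t) \<partial>\<mu> x)"
  using x by (simp add: T_apply_poly ip_apply_poly_integral mult.assoc)

text \<open>The left-hand side is the quadratic form of T - a at p(T) x, so an inequality valid for
  all polynomials p becomes one for the integral over \<open>A\<close>.\<close>

lemma weighted_integral_tendsto:
  assumes x: "x \<in> pts H" and A: "A \<in> sets borel" and p: "approximates p A x"
  shows "(\<lambda>n. ip H (T (apply_poly (p n) x)) (apply_poly (p n) x) -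
      a * ip H (apply_poly (p n) x) (apply_poly (p n) x)) \<longlonglongrightarrow> (\<integral>t. (t - a) * indicator A t \<partial>\<mu> x)"
proof -
  have c: "continuous_on UNIV (\<lambda>t::real. t - a)" "continuous_on UNIV (\<lambda>t::real. t)"
    by (intro continuous_on_diff continuous_on_id continuous_on_const)+
  have "(\<lambda>n. \<integral>t. (t - a) * (poly (p n) t * poly (p n) t) \<partial>\<mu> x) \<longlonglongrightarrow>
      (\<integral>t. (t - a) * (indicator A t * indicator A t) \<partial>\<mu> x)"
    by (rule l2_product_tendsto[OF supported_mu[OF x] bounded_measurable_on_continuous[OF c(1)]])
      (use p in \<open>simp_all add: approximates_def bounded_measurable_on_poly A
        bounded_measurable_on_indicator abs_indicator\<close>)
  moreover have "(\<integral>t. (t - a) * (poly (p n) t * poly (p n) t) \<partial>\<mu> x) =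
      ip H (T (apply_poly (p n) x)) (apply_poly (p n) x) -
      a * ip H (apply_poly (p n) x) (apply_poly (p n) x)" for n
  proof -
    have "integrable (\<mu> x) (\<lambda>t. t * (poly (p n) t * poly (p n) t))"
      by (intro bounded_measurable_on_integrable[OF supported_mu[OF x]] bounded_measurable_on_arith
          bounded_measurable_on_poly bounded_measurable_on_continuous c)
    then show ?thesis
      using integrable_poly_mult[OF x] by (simp add: ip_T_apply_poly x ip_apply_poly_integral left_diff_distrib)
  qed
  moreover have "indicator A t * indicator A t = (indicator A t :: real)" for t
    by (simp add: indicator_def)
  ultimately show ?thesis by simp
qed

text \<open>Used with \<open>s = 1\<close> and \<open>s = -1\<close>: a sign of the quadratic form of \<open>T - a\<close> on all vectors \<open>p(T) x\<close>
  confines \<open>\<mu> x\<close> to one side of \<open>a\<close>.\<close>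

lemma null_from_sign:
  assumes x: "x \<in> pts H" and A: "A \<in> sets borel" and s: "s = 1 \<or> s = -1"
    and le: "\<And>p. s * (ip H (T (apply_poly p x)) (apply_poly p x) -
      a * ip H (apply_poly p x) (apply_poly p x)) \<le> 0"
    and pos: "\<And>t. t \<in> A \<Longrightarrow> 0 < s * (t - a)"
  shows "measure (\<mu> x) A = 0"
proof -
  interpret M: finite_borel_measure "\<mu> x" by (rule finite_borel_mu[OF x])
  obtain p where p: "approximates p A x" using approximates_exists[of "{x}" A] x A by auto
  have c: "continuous_on UNIV (\<lambda>t::real. t - a)"
    by (intro continuous_on_diff continuous_on_id continuous_on_const)
  have i: "integrable (\<mu> x) (\<lambda>t. (t - a) * indicator A t)"
    by (intro bounded_measurable_on_integrable[OF supported_mu[OF x]] bounded_measurable_on_arith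
        bounded_measurable_on_continuous c bounded_measurable_on_indicator A)
  have "s * (\<integral>t. (t - a) * indicator A t \<partial>\<mu> x) \<le> 0"
    by (rule LIMSEQ_le_const2[OF tendsto_mult_left[OF weighted_integral_tendsto[OF x A p]]])
      (use le in auto)
  then have "(\<integral>t. s * ((t - a) * indicator A t) \<partial>\<mu> x) \<le> 0" by simp
  moreover have nn: "0 \<le> s * ((t - a) * indicator A t)" for t
    using pos[of t] by (cases "t \<in> A") auto
  moreover have "0 \<le> (\<integral>t. s * ((t - a) * indicator A t) \<partial>\<mu> x)"
    using nn by (intro Bochner_Integration.integral_nonneg)
  \<comment> \<open>A nonnegative integrand with nonpositive integral vanishes almost everywhere; on
    \<open>A\<close> it is strictly positive.\<close>
  ultimately have "AE t in \<mu> x. s * ((t - a) * indicator A t) = 0"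
    using i by (subst integral_nonneg_eq_0_iff_AE[symmetric]) auto
  then have "AE t in \<mu> x. t \<notin> A"
    by (rule eventually_mono) (use pos in \<open>force simp: indicator_def split: if_splits\<close>)
  then have "A \<in> null_sets (\<mu> x)" using A by (subst AE_iff_null_sets) (simp_all add: sets_mu[OF x])
  then show ?thesis by (rule measure_eq_0_null_sets)
qed

end

section \<open>Uniqueness of the spectral distribution function\<close>

text \<open>Here \<open>P\<close> is an arbitrary resolution, such as the chosen one, to be compared
  with the constructed \<open>proj\<close>.\<close>

locale resolved_operator = moment_operator + R: hilbert_pvm H P for P +
  assumes res: "spectral_resolution H T P"
begin

lemma res_integrable: "x \<in> pts H \<Longrightarrow> integrable (R.scalar_measure x) (\<lambda>t. t)"
  and res_integral: "x \<in> pts H \<Longrightarrow> ip H (T x) x = (\<integral>t. t \<partial>R.scalar_measure x)"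
  using res by (auto simp: spectral_resolution_def)

lemma indicator_measurable: "A \<in> sets borel \<Longrightarrow> indicator A \<in> borel_measurable (R.scalar_measure x)"
  by (auto cong: measurable_cong_sets)

lemma res_restricted:
  assumes x: "x \<in> pts H" and A: "A \<in> sets borel"
  shows "integrable (R.scalar_measure x) (\<lambda>t. indicator A t * t)"
    and "ip H (T (P A x)) (P A x) = (\<integral>t. indicator A t * t \<partial>R.scalar_measure x)"
proof -
  have m: "(\<lambda>t. t) \<in> borel_measurable (R.scalar_measure x)"
    using res_integrable[OF x] by (rule borel_measurable_integrable)
  show "integrable (R.scalar_measure x) (\<lambda>t. indicator A t * t)"
    using integrable_real_mult_indicator[OF _ res_integrable[OF x], of A] A
    by (simp add: mult.commute)
  have "ip H (T (P A x)) (P A x) = (\<integral>t. t \<partial>R.scalar_measure (P A x))"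
    using x A by (intro res_integral) auto
  also have "\<dots> = (\<integral>t. indicator A t * t \<partial>R.scalar_measure x)"
    unfolding R.scalar_measure_restrict[OF x A]
    using m indicator_measurable[OF A] by (subst integral_density) auto
  finally show "ip H (T (P A x)) (P A x) = (\<integral>t. indicator A t * t \<partial>R.scalar_measure x)" .
qed

text \<open>The integral of t splits over \<open>A\<close> and its complement, so the quadratic form
  of T at x has no cross term between the two parts of x.\<close>

lemma T_off_diagonal:
  assumes x: "x \<in> pts H" and A: "A \<in> sets borel"
  shows "ip H (T (P A x)) (P (- A) x) = 0"
proof -
  have A': "- A \<in> sets borel" using A by auto
  let ?u = "P A x" and ?v = "P (- A) x"
  have "(\<integral>t. indicator A t * t \<partial>R.scalar_measure x) + (\<integral>t. indicator (- A) t * t \<partial>R.scalar_measure x) =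
      (\<integral>t. indicator A t * t + indicator (- A) t * t \<partial>R.scalar_measure x)"
    using res_restricted(1)[OF x] A A' by simp
  also have "\<dots> = (\<integral>t. t \<partial>R.scalar_measure x)"
    by (intro Bochner_Integration.integral_cong) (auto simp: indicator_def)
  finally have "ip H (T ?u) ?u + ip H (T ?v) ?v = ip H (T x) x"
    using res_restricted(2)[OF x] A A' x by (simp add: res_integral)
  moreover have "ip H (T x) x = ip H (T (vadd H ?u ?v)) (vadd H ?u ?v)"
    by (simp add: R.complement(1)[OF A x])
  moreover have "\<dots> = ip H (T ?u) ?u + 2 * ip H (T ?u) ?v + ip H (T ?v) ?v"
    using x A A' T_sym[of ?v ?u]
    by (simp add: T_add ip_add_left ip_add_right ip_commute[of ?v "T ?u"])
  ultimately show ?thesis by simp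
qed

text \<open>The case of one vector is applied to a vector whose two parts are \<open>P A x\<close>
  and \<open>P (- A) y\<close>.\<close>

lemma T_off_diagonal2:
  assumes x: "x \<in> pts H" and y: "y \<in> pts H" and A: "A \<in> sets borel"
  shows "ip H (T (P A x)) (P (- A) y) = 0"
proof -
  have A': "- A \<in> sets borel" using A by auto
  define w where "w = vadd H (P A x) (P (- A) y)"
  have w: "w \<in> pts H" using x y A A' by (simp add: w_def)
  have "P A w = P A x" "P (- A) w = P (- A) y"
    using x y A A' w
    by (auto intro!: eqI_ip simp: w_def R.add R.inter ip_add_left R.empty)
  then show ?thesis using T_off_diagonal[OF w A] by simp
qed

text \<open>T is block diagonal for the decomposition by \<open>A\<close>: moving T across the form
  and inserting or dropping the vanishing off-diagonal parts gives commutation.\<close>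

lemma T_commute:
  assumes x: "x \<in> pts H" and A: "A \<in> sets borel"
  shows "P A (T x) = T (P A x)"
proof (rule eqI_ip)
  have A': "- A \<in> sets borel" using A by auto
  fix y assume y: "y \<in> pts H"
  have "ip H (P A (T x)) y = ip H (vadd H (P A x) (P (- A) x)) (T (P A y))"
    unfolding R.complement(1)[OF A x] using x y A by (simp add: R.sym T_sym)
  also have "\<dots> = ip H (P A x) (T (P A y))"
    using x y A A' T_off_diagonal2[OF y x A]
    by (simp add: ip_add_left ip_commute[of "P (- A) x"])
  also have "\<dots> = ip H (T (P A x)) (vadd H (P A y) (P (- A) y))"
    using x y A A' T_off_diagonal2[OF x y A] by (simp add: ip_add_right T_sym)
  also have "\<dots> = ip H (T (P A x)) y" by (simp only: R.complement(1)[OF A y])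
  finally show "ip H (P A (T x)) y = ip H (T (P A x)) y" .
qed (use x A in auto)

lemma T_pow_commute: "x \<in> pts H \<Longrightarrow> A \<in> sets borel \<Longrightarrow> P A ((T ^^ j) x) = (T ^^ j) (P A x)"
  by (induction j) (auto simp: T_commute)

lemma apply_poly_commute:
  assumes x: "x \<in> pts H" and A: "A \<in> sets borel"
  shows "P A (apply_poly p x) = apply_poly p (P A x)"
proof (rule eqI_ip)
  fix z assume z: "z \<in> pts H"
  show "ip H (P A (apply_poly p x)) z = ip H (apply_poly p (P A x)) z"
    using x z A by (simp add: R.sym ip_apply_poly T_pow_commute[symmetric])
qed (use x A in auto)

text \<open>By commutation p(T) P(A) x = P(A) z with z = p(T) x, and there the quadratic form of T -
  a is the integral of t - a over \<open>A\<close>.\<close>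

lemma sign_on_range:
  assumes x: "x \<in> pts H" and A: "A \<in> sets borel" and le: "\<And>t. t \<in> A \<Longrightarrow> s * (t - a) \<le> 0"
  shows "s * (ip H (T (apply_poly p (P A x))) (apply_poly p (P A x)) -
      a * ip H (apply_poly p (P A x)) (apply_poly p (P A x))) \<le> 0"
proof -
  define z where "z = apply_poly p x"
  have z: "z \<in> pts H" using x by (simp add: z_def)
  interpret M: finite_borel_measure "R.scalar_measure z" by (rule R.finite_borel_scalar_measure[OF z])
  have i: "integrable (R.scalar_measure z) (indicator A :: real \<Rightarrow> real)"
    using A by (intro integrable_real_indicator) (auto simp: M.emeasure_eq_measure)
  have "ip H (P A z) (P A z) = (\<integral>t. indicator A t \<partial>R.scalar_measure z)"
    using R.measure_scalar_measure[OF z A] R.ip_self[OF A z] A by simp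
  then have "s * (ip H (T (P A z)) (P A z) - a * ip H (P A z) (P A z)) =
      (\<integral>t. s * (indicator A t * t - a * indicator A t) \<partial>R.scalar_measure z)"
    using res_restricted[OF z A] i by simp
  also have "\<dots> \<le> 0"
  proof -
    have "0 \<le> (\<integral>t. - (s * (indicator A t * t - a * indicator A t)) \<partial>R.scalar_measure z)"
      using le by (intro Bochner_Integration.integral_nonneg) (auto simp: indicator_def)
    then show ?thesis by simp
  qed
  finally show ?thesis using x A by (simp add: z_def apply_poly_commute)
qed

text \<open>On the vectors p(T) y with y = P {..a} x the form of T - a is nonpositive, so y has no
  component above a with respect to \<open>proj\<close>. Hence <y, y> = <y, x> = <y, proj {..a} x>,
  and Cauchy-Schwarz compares the norms.\<close>

lemma resolution_le_proj:
  assumes x: "x \<in> pts H"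
  shows "ip H (P {..a} x) x \<le> measure (\<mu> x) {..a}"
proof -
  define y where "y = P {..a} x"
  have y: "y \<in> pts H" using x by (simp add: y_def)
  have "measure (\<mu> y) {a<..} = 0"
    by (rule null_from_sign[OF y, of _ 1 a]) (use sign_on_range[OF x, of "{..a}" 1 a] in \<open>auto simp: y_def\<close>)
  then have "ip H (proj (- {..a}) y) y = 0"
    using y by (simp add: proj_ip_self Compl_atMost)
  then have n: "ip H (proj (- {..a}) y) (proj (- {..a}) y) = 0"
    using Q.ip_self[of "- {..a}" y] y by simp
  have "ip H y x = ip H (vadd H (proj {..a} y) (proj (- {..a}) y)) x"
    using Q.complement(1)[of "{..a}" y] y by simp
  also have "\<dots> = ip H y (proj {..a} x) + ip H (proj (- {..a}) y) x"
    using x y proj_sym[OF y x, of "{..a}"] by (simp add: ip_add_left)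
  also have "ip H (proj (- {..a}) y) x = 0"
    using cauchy_schwarz_square[of "proj (- {..a}) y" x] n x y by simp
  finally have e: "ip H y x = ip H y (proj {..a} x)" by simp
  have yy: "ip H y y = ip H y x" using R.ip_self[of "{..a}" x] x by (simp add: y_def)
  have "(ip H y y)\<^sup>2 \<le> ip H y y * ip H (proj {..a} x) (proj {..a} x)"
    using cauchy_schwarz_square[of y "proj {..a} x"] x y e yy by simp
  then have "ip H y y \<le> ip H (proj {..a} x) (proj {..a} x)"
    using ip_self_nonneg[OF y] ip_self_nonneg[of "proj {..a} x"] x
    by (cases "ip H y y = 0") (auto simp: power2_eq_square)
  then show ?thesis using yy x by (simp add: y_def proj_ip_proj)
qed

text \<open>The dual argument, with T - a nonnegative on the complementary range. The half-line is
  open because \<open>null_from_sign\<close> asks for a strict sign of t - a.\<close>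

lemma proj_le_resolution:
  assumes x: "x \<in> pts H"
  shows "measure (\<mu> x) {..<a} \<le> ip H (P {..a} x) x"
proof -
  have c: "- {..a} = {a<..}" by auto
  define y where "y = P {a<..} x"
  define w where "w = proj {..<a} x"
  have y: "y \<in> pts H" and w: "w \<in> pts H" using x by (simp_all add: y_def w_def)
  have "measure (\<mu> y) {..<a} = 0"
    by (rule null_from_sign[OF y, of _ "-1" a])
      (use sign_on_range[OF x, of "{a<..}" "-1" a] in \<open>auto simp: y_def\<close>)
  then have n: "ip H (proj {..<a} y) (proj {..<a} y) = 0"
    using y by (simp add: proj_ip_proj)
  have "ip H w w = ip H w x" using Q.ip_self[of "{..<a}" x] x by (simp add: w_def)
  also have "\<dots> = ip H w (vadd H (P {..a} x) y)"
    using R.complement(1)[of "{..a}" x] x by (simp add: c y_def)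
  also have "\<dots> = ip H w (P {..a} x) + ip H (proj {..<a} y) x"
    using x y w proj_sym[OF x y, of "{..<a}"] ip_commute[of "proj {..<a} y" x]
    by (simp add: ip_add_right w_def)
  also have "ip H (proj {..<a} y) x = 0"
    using cauchy_schwarz_square[of "proj {..<a} y" x] n x y by simp
  finally have "(ip H w w)\<^sup>2 \<le> ip H w w * ip H (P {..a} x) (P {..a} x)"
    using cauchy_schwarz_square[of w "P {..a} x"] x w by simp
  then have "ip H w w \<le> ip H (P {..a} x) (P {..a} x)"
    using ip_self_nonneg[OF w] ip_self_nonneg[of "P {..a} x"] x
    by (cases "ip H w w = 0") (auto simp: power2_eq_square)
  then show ?thesis using R.ip_self[of "{..a}" x] x by (simp add: w_def proj_ip_proj)
qed

text \<open>The two comparisons differ by the point a. Comparing at b > a and letting b decrease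
  closes the gap by right continuity.\<close>

theorem resolution_cdf:
  assumes x: "x \<in> pts H"
  shows "ip H (P {..a} x) x = measure (\<mu> x) {..a}"
proof (rule antisym[OF resolution_le_proj[OF x]])
  interpret N: finite_borel_measure "R.scalar_measure x" by (rule R.finite_borel_scalar_measure[OF x])
  interpret M: finite_borel_measure "\<mu> x" by (rule finite_borel_mu[OF x])
  have cdf: "cdf (R.scalar_measure x) b = ip H (P {..b} x) x" for b
    by (simp add: cdf_def R.measure_scalar_measure[OF x])
  have "((cdf (R.scalar_measure x)) \<longlongrightarrow> cdf (R.scalar_measure x) a) (at_right a)"
    using N.cdf_is_right_cont[of a] by (simp add: continuous_within)
  moreover have "\<forall>\<^sub>F b in at_right a. measure (\<mu> x) {..a} \<le> cdf (R.scalar_measure x) b"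
  proof (rule eventually_at_right_less[THEN eventually_mono])
    fix b assume "a < b"
    then have "measure (\<mu> x) {..a} \<le> measure (\<mu> x) {..<b}"
      by (intro M.finite_measure_mono) (auto simp: sets_mu[OF x])
    then show "measure (\<mu> x) {..a} \<le> cdf (R.scalar_measure x) b"
      using proj_le_resolution[OF x, of b] by (simp add: cdf)
  qed
  ultimately have "measure (\<mu> x) {..a} \<le> cdf (R.scalar_measure x) a"
    by (rule tendsto_lowerbound) simp
  then show "measure (\<mu> x) {..a} \<le> ip H (P {..a} x) x" by (simp add: cdf)
qed

end

text \<open>The existence of \<open>proj\<close> makes the choice a resolution, and the comparison
  of arbitrary resolutions evaluates it.\<close>

theorem (in moment_operator) spectral_projection_cdf:
  assumes x: "x \<in> pts H"
  shows "ip H (spectral_projection H T {..a} x) x = measure (\<mu> x) {..a}"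
proof -
  have r: "spectral_resolution H T (spectral_projection H T)"
    unfolding spectral_projection_def by (rule someI[of _ proj]) (rule spectral_resolution_proj)
  then interpret R: resolved_operator H T K "spectral_projection H T"
    by unfold_locales (auto simp: spectral_resolution_def)
  show ?thesis by (rule R.resolution_cdf[OF x])
qed

section \<open>Diagonalization of symmetric kernels\<close>

lemma mult_mat_vec_sum:
  assumes "A \<in> carrier_mat n m" "v \<in> carrier_vec m" "i < n"
  shows "(A *\<^sub>v v) $ i = (\<Sum>j<m. A $$ (i, j) * v $ j)"
  using assms by (auto simp: scalar_prod_def lessThan_atLeast0 intro!: sum.cong)

lemma mult_mat_sum:
  assumes "A \<in> carrier_mat n m" "B \<in> carrier_mat m l" "i < n" "j < l"
  shows "(A * B) $$ (i, j) = (\<Sum>k<m. A $$ (i, k) * B $$ (k, j))"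
  using assms by (auto simp: scalar_prod_def lessThan_atLeast0 intro!: sum.cong)

text \<open>The fundamental theorem of algebra gives a complex eigenvalue; it is real because the
  Hermitian form of a real symmetric matrix takes real values.\<close>

lemma symmetric_mat_eigenvalue:
  fixes A :: "real mat"
  assumes A: "A \<in> carrier_mat n n" and sym: "\<And>i j. i < n \<Longrightarrow> j < n \<Longrightarrow> A $$ (i, j) = A $$ (j, i)"
    and n: "0 < n"
  shows "\<exists>e. eigenvalue A e"
proof -
  define C where "C = map_mat complex_of_real A"
  have C: "C \<in> carrier_mat n n" using A by (simp add: C_def)
  have "degree (char_poly C) = n" using degree_monic_char_poly[OF C] by simp
  then have "\<not> constant (poly (char_poly C))" using n by (simp add: constant_degree)
  then obtain z where "poly (char_poly C) z = 0" using fundamental_theorem_of_algebra by blast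
  then have "eigenvalue C z" using eigenvalue_root_char_poly[OF C] by simp
  then obtain v where v: "v \<in> carrier_vec n" "v \<noteq> 0\<^sub>v n" "C *\<^sub>v v = z \<cdot>\<^sub>v v"
    using C by (auto simp: eigenvalue_def eigenvector_def)
  have ev: "(\<Sum>j<n. complex_of_real (A $$ (i, j)) * v $ j) = z * v $ i" if "i < n" for i
  proof -
    have "(C *\<^sub>v v) $ i = (\<Sum>j<n. complex_of_real (A $$ (i, j)) * v $ j)"
      using mult_mat_vec_sum[OF C v(1) that] that A by (simp add: C_def)
    then show ?thesis using v that by simp
  qed
  define N where "N = (\<Sum>i<n. v $ i * cnj (v $ i))"
  have N_real: "N = complex_of_real (\<Sum>i<n. (cmod (v $ i))\<^sup>2)"
    unfolding N_def of_real_sum by (intro sum.cong refl) (rule complex_norm_square[symmetric])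
  obtain i where i: "i < n" "v $ i \<noteq> 0" using v(1,2) by (auto simp: vec_eq_iff)
  have "0 < (\<Sum>i<n. (cmod (v $ i))\<^sup>2)"
    by (rule sum_pos2[of _ i]) (use i in auto)
  then have N0: "N \<noteq> 0" unfolding N_real by (metis less_irrefl of_real_eq_0_iff)
  \<comment> \<open>The Hermitian form at the eigenvector: it equals z N, and conjugation together
    with symmetry leaves it fixed.\<close>
  define S where "S = (\<Sum>i<n. \<Sum>j<n. complex_of_real (A $$ (i, j)) * v $ j * cnj (v $ i))"
  have "S = (\<Sum>i<n. (\<Sum>j<n. complex_of_real (A $$ (i, j)) * v $ j) * cnj (v $ i))"
    by (simp add: S_def sum_distrib_right)
  then have S: "S = z * N" using ev by (simp add: N_def sum_distrib_left mult.assoc)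
  have "cnj S = (\<Sum>i<n. \<Sum>j<n. complex_of_real (A $$ (i, j)) * cnj (v $ j) * v $ i)"
    by (simp add: S_def)
  also have "\<dots> = (\<Sum>i<n. \<Sum>j<n. complex_of_real (A $$ (j, i)) * cnj (v $ i) * v $ j)"
    by (rule sum.swap)
  also have "\<dots> = S" unfolding S_def using sym by (intro sum.cong refl) (simp add: mult_ac)
  finally have "cnj z * N = z * N" using S by (simp add: N_real)
  then have "cnj z = z" using N0 by simp
  then have z: "z = complex_of_real (Re z)" by (simp add: complex_eq_iff)
  have "poly (map_poly complex_of_real (char_poly A)) z = 0"
    using \<open>poly (char_poly C) z = 0\<close> by (simp add: C_def of_real_hom.char_poly_hom[OF A])
  then have "complex_of_real (poly (char_poly A) (Re z)) = 0"
    by (subst (asm) z) (simp only: of_real_hom.poly_map_poly)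
  then show ?thesis using eigenvalue_root_char_poly[OF A] by auto
qed

text \<open>The Householder reflection along u = e_0 - v, where |u|^2 = 2 c; it exchanges e_0 and
  v.\<close>

lemma householder:
  fixes v :: "real vec"
  assumes v: "v \<in> carrier_vec (Suc m)" and v1: "(\<Sum>i<Suc m. (v $ i)\<^sup>2) = 1"
  obtains H where "H \<in> carrier_mat (Suc m) (Suc m)" "transpose_mat H = H" "H * H = 1\<^sub>m (Suc m)"
    "col H 0 = v"
proof
  define c where "c = 1 - v $ 0"
  define u where "u i = (if i = 0 then 1 else 0) - v $ i" for i
  \<comment> \<open>If \<open>v\<close> is the first unit vector, then \<open>c = 0\<close> and division by zero makes \<open>H\<close> the identity.\<close>
  define H where "H = mat (Suc m) (Suc m) (\<lambda>(i, j). (if i = j then 1 else 0) - u i * u j / c)"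
  show H: "H \<in> carrier_mat (Suc m) (Suc m)" by (simp add: H_def)
  show "transpose_mat H = H" by (rule eq_matI) (auto simp: H_def)
  have uu: "(\<Sum>k<Suc m. (u k)\<^sup>2) = 2 * c"
  proof -
    have "(u k)\<^sup>2 = (if k = 0 then 1 - 2 * v $ 0 else 0) + (v $ k)\<^sup>2" for k
      by (simp add: u_def power2_diff)
    then have "(\<Sum>k<Suc m. (u k)\<^sup>2) = (\<Sum>k<Suc m. if k = 0 then 1 - 2 * v $ 0 else 0) + 1"
      using v1 by (simp only: sum.distrib)
    also have "(\<Sum>k<Suc m. if k = 0 then 1 - 2 * v $ 0 else 0) = 1 - 2 * v $ 0"
      by (subst sum.delta) auto
    finally show ?thesis by (simp add: c_def)
  qed
  show "H * H = 1\<^sub>m (Suc m)"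
  proof (rule eq_matI)
    fix i j assume ij: "i < dim_row (1\<^sub>m (Suc m))" "j < dim_col (1\<^sub>m (Suc m))"
    then have i: "i < Suc m" and j: "j < Suc m" by auto
    have "(H * H) $$ (i, j) = (\<Sum>k<Suc m. H $$ (i, k) * H $$ (k, j))"
      by (rule mult_mat_sum[OF H H i j])
    \<comment> \<open>The square of 1 - u u^T / c, sorted so that each sum either has a single
      nonzero term or is the squared norm of u.\<close>
    also have "\<dots> = (\<Sum>k<Suc m. (if k = j then (if i = j then 1 else 0) - u i * u j / c else 0) -
        (if k = i then u i * u j / c else 0) + u i * u j / c\<^sup>2 * (u k)\<^sup>2)"
      using i j by (intro sum.cong) (auto simp: H_def power2_eq_square algebra_simps)
    also have "\<dots> = ((if i = j then 1 else 0) - u i * u j / c) - u i * u j / c +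
        u i * u j / c\<^sup>2 * (2 * c)"
      using i j by (simp only: sum.distrib sum_subtractf sum_distrib_left[symmetric] uu sum.delta
          finite_lessThan) simp
    also have "\<dots> = 1\<^sub>m (Suc m) $$ (i, j)"
      using i j by (cases "c = 0") (simp_all add: power2_eq_square)
    finally show "(H * H) $$ (i, j) = 1\<^sub>m (Suc m) $$ (i, j)" .
  qed (simp_all add: H_def)
  show "col H 0 = v"
  proof (rule eq_vecI)
    fix i assume "i < dim_vec v"
    then have i: "i < Suc m" using v by simp
    show "col H 0 $ i = v $ i"
    proof (cases "c = 0")
      case True
      \<comment> \<open>Here v_0 = 1, and the unit norm forces all other coordinates to
        vanish.\<close>
      have "(v $ 0)\<^sup>2 + (\<Sum>i<m. (v $ Suc i)\<^sup>2) = 1"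
        using v1 by (simp only: sum.lessThan_Suc_shift)
      then have "(\<Sum>i<m. (v $ Suc i)\<^sup>2) = 0" using True by (simp add: c_def)
      then have "v $ Suc k = 0" if "k < m" for k
        using that by (subst (asm) sum_nonneg_eq_0_iff) auto
      then show ?thesis using i v True by (cases i) (simp_all add: H_def c_def)
    next
      case False
      then show ?thesis using i v by (simp add: H_def u_def c_def)
    qed
  qed (use v in \<open>simp add: H_def\<close>)
qed

text \<open>Deflation: conjugating by a reflection that sends e_0 to a unit eigenvector makes the
  first column a multiple of e_0, symmetry clears the first row as well, and the induction
  hypothesis applies to the remaining block.\<close>

lemma symmetric_mat_diagonalization:
  fixes A :: "real mat"
  assumes "A \<in> carrier_mat n n" "transpose_mat A = A"
  shows "\<exists>P D. P \<in> carrier_mat n n \<and> D \<in> carrier_mat n n \<and> diagonal_mat D \<and>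
    P * transpose_mat P = 1\<^sub>m n \<and> A = P * D * transpose_mat P"
  using assms
proof (induction n arbitrary: A)
  case 0
  then show ?case by (intro exI[of _ "1\<^sub>m 0"]) (auto simp: diagonal_mat_def)
next
  case (Suc m)
  let ?n = "Suc m"
  note A = Suc.prems(1)
  have sym: "A $$ (i, j) = A $$ (j, i)" if "i < ?n" "j < ?n" for i j
  proof -
    have "A $$ (i, j) = transpose_mat A $$ (i, j)" by (simp only: Suc.prems(2))
    then show ?thesis using that A by simp
  qed
  obtain e where "eigenvalue A e" using symmetric_mat_eigenvalue[OF A sym] by auto
  then obtain w where w: "w \<in> carrier_vec ?n" "w \<noteq> 0\<^sub>v ?n" "A *\<^sub>v w = e \<cdot>\<^sub>v w"
    using A by (auto simp: eigenvalue_def eigenvector_def)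
  define r where "r = sqrt (\<Sum>i<?n. (w $ i)\<^sup>2)"
  obtain i where i: "i < ?n" "w $ i \<noteq> 0" using w(1,2) by (auto simp: vec_eq_iff)
  have "0 < (\<Sum>i<?n. (w $ i)\<^sup>2)" by (rule sum_pos2[of _ i]) (use i in auto)
  then have r: "0 < r" "r\<^sup>2 = (\<Sum>i<?n. (w $ i)\<^sup>2)" by (simp_all add: r_def)
  define v where "v = (1 / r) \<cdot>\<^sub>v w"
  have v: "v \<in> carrier_vec ?n" using w by (simp add: v_def)
  have "(\<Sum>i<?n. (v $ i)\<^sup>2) = (\<Sum>i<?n. (w $ i)\<^sup>2 / r\<^sup>2)"
    using w by (intro sum.cong) (auto simp: v_def power_divide)
  also have "\<dots> = 1" using r by (simp only: sum_divide_distrib[symmetric] r(2)[symmetric]) simp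
  finally have v1: "(\<Sum>i<?n. (v $ i)\<^sup>2) = 1" .
  have Av: "A *\<^sub>v v = e \<cdot>\<^sub>v v"
    using w A by (simp add: v_def mult_mat_vec smult_smult_assoc mult.commute)
  obtain H where H: "H \<in> carrier_mat ?n ?n" "transpose_mat H = H" "H * H = 1\<^sub>m ?n" "col H 0 = v"
    using householder[OF v v1] .
  define A' where "A' = H * (A * H)"
  have AH: "A * H \<in> carrier_mat ?n ?n" and A': "A' \<in> carrier_mat ?n ?n"
    using A H by (simp_all add: A'_def)
  have "transpose_mat A' = A'"
  proof -
    have "transpose_mat A' = transpose_mat (A * H) * transpose_mat H"
      unfolding A'_def by (rule transpose_mult[OF H(1) AH])
    also have "\<dots> = (H * A) * H" by (simp add: transpose_mult[OF A H(1)] H Suc.prems)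
    also have "\<dots> = A'" unfolding A'_def by (rule assoc_mult_mat[OF H(1) A H(1)])
    finally show ?thesis .
  qed
  then have sym': "A' $$ (i, j) = A' $$ (j, i)" if "i < ?n" "j < ?n" for i j
    using A' that index_transpose_mat(1)[of i A' j] by simp
  have "col A' 0 = H *\<^sub>v (A *\<^sub>v col H 0)"
    unfolding A'_def by (subst col_mult2[OF H(1) AH], simp, subst col_mult2[OF A H(1)], simp_all)
  also have "\<dots> = e \<cdot>\<^sub>v (H *\<^sub>v col H 0)"
    using H v by (simp add: Av mult_mat_vec)
  also have "H *\<^sub>v col H 0 = col (H * H) 0"
    by (rule col_mult2[OF H(1) H(1), symmetric]) simp
  finally have col0: "col A' 0 = e \<cdot>\<^sub>v unit_vec ?n 0" by (simp add: H(3))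
  have A'0: "A' $$ (i, 0) = (if i = 0 then e else 0)" if "i < ?n" for i
  proof -
    have "A' $$ (i, 0) = col A' 0 $ i" using that A' by simp
    then show ?thesis using that by (simp add: col0)
  qed
  define B where "B = mat m m (\<lambda>(i, j). A' $$ (Suc i, Suc j))"
  define E where "E = mat 1 1 (\<lambda>_. e)"
  have B: "B \<in> carrier_mat m m" and E: "E \<in> carrier_mat 1 1" by (simp_all add: B_def E_def)
  have "transpose_mat B = B"
    by (rule eq_matI) (auto simp: B_def sym')
  then obtain P D where P: "P \<in> carrier_mat m m" and D: "D \<in> carrier_mat m m" "diagonal_mat D"
    and PP: "P * transpose_mat P = 1\<^sub>m m" and BP: "B = P * D * transpose_mat P"
    using Suc.IH[OF B] by blast
  have A'_block: "A' = four_block_mat E (0\<^sub>m 1 m) (0\<^sub>m m 1) B"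
  proof (rule eq_matI)
    fix i j assume "i < dim_row (four_block_mat E (0\<^sub>m 1 m) (0\<^sub>m m 1) B)"
      "j < dim_col (four_block_mat E (0\<^sub>m 1 m) (0\<^sub>m m 1) B)"
    then have i: "i < ?n" and j: "j < ?n" using B E by auto
    show "A' $$ (i, j) = four_block_mat E (0\<^sub>m 1 m) (0\<^sub>m m 1) B $$ (i, j)"
    proof (cases "j = 0")
      case True
      then show ?thesis using i A'0[OF i] by (auto simp: E_def B_def)
    next
      case j0: False
      show ?thesis
      proof (cases "i = 0")
        case True
        then show ?thesis using j j0 A'0[OF j] sym'[OF i j] by (auto simp: E_def B_def)
      next
        case False
        then show ?thesis using i j j0 by (auto simp: E_def B_def)
      qed
    qed
  qed (use A' B E in auto)
  define P' where "P' = four_block_mat (1\<^sub>m 1) (0\<^sub>m 1 m) (0\<^sub>m m 1) P"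
  define D' where "D' = four_block_mat E (0\<^sub>m 1 m) (0\<^sub>m m 1) D"
  have Pt: "transpose_mat P \<in> carrier_mat m m" using P by simp
  have o: "1\<^sub>m 1 \<in> carrier_mat 1 (1::nat)" and z1: "0\<^sub>m 1 m \<in> carrier_mat 1 m"
    and z2: "0\<^sub>m m 1 \<in> carrier_mat m 1" by auto
  have PD: "P * D \<in> carrier_mat m m" using P D by simp
  have P't: "transpose_mat P' = four_block_mat (1\<^sub>m 1) (0\<^sub>m 1 m) (0\<^sub>m m 1) (transpose_mat P)"
    unfolding P'_def by (subst transpose_four_block_mat[OF _ _ _ P]) auto
  have c: "P' \<in> carrier_mat ?n ?n" "transpose_mat P' \<in> carrier_mat ?n ?n" "D' \<in> carrier_mat ?n ?n"
    unfolding P't unfolding P'_def D'_def using P D E by auto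
  have "P' * transpose_mat P' = four_block_mat (1\<^sub>m 1) (0\<^sub>m 1 m) (0\<^sub>m m 1) (1\<^sub>m m)"
    unfolding P't unfolding P'_def
    by (subst mult_four_block_mat[OF o z1 z2 P o z1 z2 Pt]) (use P Pt PP in simp)
  also have "\<dots> = 1\<^sub>m ?n" by (rule eq_matI) auto
  finally have P'P': "P' * transpose_mat P' = 1\<^sub>m ?n" .
  have "P' * D' = four_block_mat E (0\<^sub>m 1 m) (0\<^sub>m m 1) (P * D)"
    unfolding P'_def D'_def
    by (subst mult_four_block_mat[OF o z1 z2 P E z1 z2 D(1)]) (use P D E in simp)
  then have "P' * D' * transpose_mat P' =
      four_block_mat E (0\<^sub>m 1 m) (0\<^sub>m m 1) (P * D) *
      four_block_mat (1\<^sub>m 1) (0\<^sub>m 1 m) (0\<^sub>m m 1) (transpose_mat P)" by (simp add: P't)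
  also have "\<dots> = four_block_mat E (0\<^sub>m 1 m) (0\<^sub>m m 1) B"
    by (subst mult_four_block_mat[OF E z1 z2 PD o z1 z2 Pt]) (use right_mult_zero_mat[OF PD] Pt E B in \<open>simp add: BP[symmetric]\<close>)
  finally have A'P: "A' = P' * D' * transpose_mat P'" by (simp add: A'_block)
  \<comment> \<open>H is symmetric and its own inverse, so Q is again orthogonal and the conjugation
    by H is undone.\<close>
  define Q where "Q = H * P'"
  have Q: "Q \<in> carrier_mat ?n ?n" using H c by (simp add: Q_def)
  have Qt: "transpose_mat Q = transpose_mat P' * H"
    unfolding Q_def using transpose_mult[OF H(1) c(1)] H by simp
  have PtH: "transpose_mat P' * H \<in> carrier_mat ?n ?n" and PD': "P' * D' \<in> carrier_mat ?n ?n"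
    using H c by auto
  have "Q * transpose_mat Q = H * (P' * (transpose_mat P' * H))"
    unfolding Qt unfolding Q_def by (rule assoc_mult_mat[OF H(1) c(1) PtH])
  moreover have "P' * (transpose_mat P' * H) = (P' * transpose_mat P') * H"
    by (rule assoc_mult_mat[OF c(1) c(2) H(1), symmetric])
  ultimately have QQ: "Q * transpose_mat Q = 1\<^sub>m ?n" using H by (simp add: P'P')
  have e1: "(P' * D') * (transpose_mat P' * H) = A' * H"
    unfolding A'P by (rule assoc_mult_mat[OF PD' c(2) H(1), symmetric])
  have "Q * D' = H * (P' * D')" unfolding Q_def by (rule assoc_mult_mat[OF H(1) c(1) c(3)])
  then have "Q * D' * transpose_mat Q = H * ((P' * D') * (transpose_mat P' * H))"
    unfolding Qt by (simp only: assoc_mult_mat[OF H(1) PD' PtH])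
  then have "Q * D' * transpose_mat Q = H * (A' * H)" by (simp only: e1)
  moreover have "A' * H = H * ((A * H) * H)"
    unfolding A'_def by (rule assoc_mult_mat[OF H(1) AH H(1)])
  moreover have "(A * H) * H = A" using assoc_mult_mat[OF A H(1) H(1)] A by (simp add: H)
  moreover have "H * (H * A) = A" using assoc_mult_mat[OF H(1) H(1) A] A by (simp add: H)
  ultimately have "A = Q * D' * transpose_mat Q" by simp
  moreover have "diagonal_mat D'"
    unfolding diagonal_mat_def
  proof (intro allI impI)
    fix i j assume "i < dim_row D'" "j < dim_col D'" "i \<noteq> j"
    then show "D' $$ (i, j) = 0"
      using D E unfolding diagonal_mat_def D'_def by (cases i; cases j) simp_all
  qed
  ultimately show ?case using Q QQ c by blast
qed


text \<open>For a diagonal matrix the characteristic polynomial is a product of linear factors, and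
  orders add up over factors.\<close>

lemma char_poly_symmetric_order:
  fixes D :: "real mat"
  assumes sim: "similar_mat A D" and D: "D \<in> carrier_mat n n" "diagonal_mat D"
  shows "Polynomial.order \<theta> (char_poly A) = card {i. i < n \<and> D $$ (i, i) = \<theta>}"
proof -
  have "upper_triangular D" using D unfolding diagonal_mat_def upper_triangular_def by auto
  then have "char_poly A = (\<Prod>a\<leftarrow>diag_mat D. [:- a, 1:])"
    using char_poly_similar[OF sim] char_poly_upper_triangular[OF D(1)] by simp
  then have "Polynomial.order \<theta> (char_poly A) =
      sum_list (map (Polynomial.order \<theta>) (map (\<lambda>a. [:- a, 1:]) (diag_mat D)))"
    by (simp only:) (rule order_prod_list, auto)
  also have "\<dots> = (\<Sum>i\<leftarrow>[0..<n]. if D $$ (i, i) = \<theta> then 1 else 0)"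
    using D(1) by (simp add: diag_mat_def order_linear' comp_def)
  also have "\<dots> = (\<Sum>i<n. if D $$ (i, i) = \<theta> then 1 else 0)"
    by (simp add: interv_sum_list_conv_sum_set_nat lessThan_atLeast0)
  also have "\<dots> = card {i. i < n \<and> D $$ (i, i) = \<theta>}"
    by (simp add: sum.If_cases lessThan_def Collect_conj_eq)
  finally show ?thesis .
qed

text \<open>The columns of the orthogonal matrix are read as functions on \<open>V\<close>. Both
  orthogonality relations are recorded: completeness gives Parseval's identity, orthonormality
  identifies the eigenvectors.\<close>

theorem symmetric_kernel_diagonalization:
  fixes B :: "'v \<Rightarrow> 'v \<Rightarrow> real"
  assumes V: "finite V" and sym: "\<And>x y. x \<in> V \<Longrightarrow> y \<in> V \<Longrightarrow> B x y = B y x"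
  shows "\<exists>l w.
    (\<forall>x\<in>V. \<forall>y\<in>V. B x y = (\<Sum>i<card V. l i * w i x * w i y)) \<and>
    (\<forall>x\<in>V. \<forall>y\<in>V. (\<Sum>i<card V. w i x * w i y) = (if x = y then 1 else 0)) \<and>
    (\<forall>i<card V. \<forall>j<card V. (\<Sum>x\<in>V. w i x * w j x) = (if i = j then 1 else 0)) \<and>
    (\<forall>t. eigenvalue_distribution V B t = real (card {i. i < card V \<and> l i \<le> t}) / real (card V))"
proof -
  define n where "n = card V"
  define f where "f = from_nat_into V"
  have f: "bij_betw f {..<n} V" unfolding f_def n_def by (rule bij_betw_from_nat_into_finite[OF V])
  define g where "g = inv_into {..<n} f"
  have fg: "f (g x) = x" "g x < n" if "x \<in> V" for x
    using f that by (auto simp: g_def bij_betw_def f_inv_into_f inv_into_into[of x f "{..<n}", simplified])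
  have gf: "g (f i) = i" "f i \<in> V" if "i < n" for i
    using f that by (auto simp: g_def bij_betw_def inv_into_f_f)
  have reindex: "(\<Sum>x\<in>V. h (g x)) = (\<Sum>i<n. h i)" for h :: "nat \<Rightarrow> real"
    using sum.reindex_bij_betw[OF f, of "\<lambda>x. h (g x)"] gf by simp
  define M where "M = kernel_mat V B"
  have M: "M \<in> carrier_mat n n" "\<And>i j. i < n \<Longrightarrow> j < n \<Longrightarrow> M $$ (i, j) = B (f i) (f j)"
    by (simp_all add: M_def kernel_mat_def n_def f_def)
  have "transpose_mat M = M"
    using M sym gf by (intro eq_matI) auto
  then obtain P D where P: "P \<in> carrier_mat n n" and D: "D \<in> carrier_mat n n" "diagonal_mat D"
    and PP: "P * transpose_mat P = 1\<^sub>m n" and MP: "M = P * D * transpose_mat P"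
    using symmetric_mat_diagonalization[OF M(1)] by blast
  have Pt: "transpose_mat P \<in> carrier_mat n n" using P by simp
  have PtP: "transpose_mat P * P = 1\<^sub>m n" by (rule mat_mult_left_right_inverse[OF P Pt PP])
  define l where "l i = D $$ (i, i)" for i
  define w where "w i x = P $$ (g x, i)" for i x
  have D_eq: "D $$ (i, j) = (if i = j then l j else 0)" if "i < n" "j < n" for i j
    using that D by (auto simp: diagonal_mat_def l_def)
  have rows: "(\<Sum>k<n. P $$ (i, k) * P $$ (j, k)) = (if i = j then 1 else 0)" if "i < n" "j < n" for i j
    using mult_mat_sum[OF P Pt that] that P by (simp add: PP)
  have cols: "(\<Sum>k<n. P $$ (k, i) * P $$ (k, j)) = (if i = j then 1 else 0)" if "i < n" "j < n" for i j
    using mult_mat_sum[OF Pt P that] that P by (simp add: PtP)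
  have entries: "M $$ (i, j) = (\<Sum>k<n. l k * P $$ (i, k) * P $$ (j, k))" if "i < n" "j < n" for i j
  proof -
    have PD: "P * D \<in> carrier_mat n n" using P D by simp
    have "(P * D) $$ (i, k) = l k * P $$ (i, k)" if k: "k < n" for k
    proof -
      have "(P * D) $$ (i, k) = (\<Sum>a<n. if a = k then l k * P $$ (i, k) else 0)"
        unfolding mult_mat_sum[OF P D(1) \<open>i < n\<close> k] using k by (intro sum.cong) (auto simp: D_eq)
      then show ?thesis using k by simp
    qed
    then show ?thesis
      unfolding MP mult_mat_sum[OF PD Pt that] using that P by (intro sum.cong) auto
  qed
  show ?thesis
  proof (intro exI[of _ l] exI[of _ w] conjI ballI allI impI)
    fix x y assume x: "x \<in> V" and y: "y \<in> V"
    show "B x y = (\<Sum>i<card V. l i * w i x * w i y)"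
      using entries[OF fg(2)[OF x] fg(2)[OF y]] M(2)[OF fg(2)[OF x] fg(2)[OF y]] fg(1) x y
      by (simp add: w_def n_def)
  next
    fix x y assume x: "x \<in> V" and y: "y \<in> V"
    have "g x = g y \<longleftrightarrow> x = y" using fg(1) x y by metis
    then show "(\<Sum>i<card V. w i x * w i y) = (if x = y then 1 else 0)"
      using rows[OF fg(2)[OF x] fg(2)[OF y]] by (simp add: w_def n_def)
  next
    fix i j assume "i < card V" "j < card V"
    then show "(\<Sum>x\<in>V. w i x * w j x) = (if i = j then 1 else 0)"
      unfolding w_def using reindex[of "\<lambda>k. P $$ (k, i) * P $$ (k, j)"] cols[of i j]
      by (simp add: n_def)
  next
    fix t
    have "similar_mat M D"
      by (rule similar_matI[of M D P "transpose_mat P" n]) (use M P D Pt PP PtP MP in auto)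
    then have ord: "Polynomial.order \<theta> (char_poly M) = card {i. i < n \<and> l i = \<theta>}" for \<theta>
      unfolding l_def by (rule char_poly_symmetric_order[OF _ D])
    have nz: "char_poly M \<noteq> 0" using degree_monic_char_poly[OF M(1)] by auto
    have ev: "eigenvalue M \<theta> \<longleftrightarrow> (\<exists>i<n. l i = \<theta>)" for \<theta>
    proof -
      have "eigenvalue M \<theta> \<longleftrightarrow> card {i. i < n \<and> l i = \<theta>} \<noteq> 0"
        using eigenvalue_root_char_poly[OF M(1)] nz order_root[of "char_poly M" \<theta>] ord by simp
      then show ?thesis by (auto simp: card_eq_0_iff)
    qed
    \<comment> \<open>\<open>eigenvalue_distribution\<close> groups by distinct eigenvalues; their
      index sets are disjoint.\<close>
    have "(\<Sum>\<theta>\<in>{\<theta>. eigenvalue M \<theta> \<and> \<theta> \<le> t}. card {i. i < n \<and> l i = \<theta>}) =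
        card (\<Union>\<theta>\<in>{\<theta>. eigenvalue M \<theta> \<and> \<theta> \<le> t}. {i. i < n \<and> l i = \<theta>})"
    proof (rule card_UN_disjoint[symmetric])
      have "{\<theta>. eigenvalue M \<theta> \<and> \<theta> \<le> t} \<subseteq> l ` {..<n}" by (auto simp: ev)
      then show "finite {\<theta>. eigenvalue M \<theta> \<and> \<theta> \<le> t}" by (rule finite_subset) simp
    qed auto
    also have "(\<Union>\<theta>\<in>{\<theta>. eigenvalue M \<theta> \<and> \<theta> \<le> t}. {i. i < n \<and> l i = \<theta>}) = {i. i < n \<and> l i \<le> t}"
      by (auto simp: ev)
    finally show "eigenvalue_distribution V B t = real (card {i. i < card V \<and> l i \<le> t}) / real (card V)"
      unfolding eigenvalue_distribution_def M_def[symmetric] ord by (simp add: n_def)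
  qed
qed

definition kernel_apply :: "'v set \<Rightarrow> ('v \<Rightarrow> 'v \<Rightarrow> real) \<Rightarrow> ('v \<Rightarrow> real) \<Rightarrow> 'v \<Rightarrow> real" where
  "kernel_apply V B a x = (\<Sum>y\<in>V. B x y * a y)"

text \<open>Expansion in eigenvectors makes the quadratic form of every power a weighted moment. Row
  sums serve as the bound because they control the eigenvalues independently of the number of
  vertices.\<close>

theorem symmetric_kernel_spectral:
  fixes B :: "'v \<Rightarrow> 'v \<Rightarrow> real"
  assumes V: "finite V" and sym: "\<And>x y. x \<in> V \<Longrightarrow> y \<in> V \<Longrightarrow> B x y = B y x"
    and row: "\<And>x. x \<in> V \<Longrightarrow> (\<Sum>y\<in>V. \<bar>B x y\<bar>) \<le> K"
  shows "\<exists>l w. (\<forall>i<card V. \<bar>l i\<bar> \<le> K) \<and>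
    (\<forall>t. eigenvalue_distribution V B t = real (card {i. i < card V \<and> l i \<le> t}) / real (card V)) \<and>
    (\<forall>a j. (\<Sum>x\<in>V. (kernel_apply V B ^^ j) a x * a x) =
       (\<Sum>i<card V. (\<Sum>x\<in>V. a x * w i x)\<^sup>2 * l i ^ j)) \<and>
    (\<forall>i<card V. (\<Sum>x\<in>V. (w i x)\<^sup>2) = 1)"
proof -
  obtain l w where
    *: "\<forall>x\<in>V. \<forall>y\<in>V. B x y = (\<Sum>i<card V. l i * w i x * w i y)"
    "\<forall>x\<in>V. \<forall>y\<in>V. (\<Sum>i<card V. w i x * w i y) = (if x = y then 1 else 0)"
    "\<forall>i<card V. \<forall>j<card V. (\<Sum>x\<in>V. w i x * w j x) = (if i = j then 1 else 0)" and
    dist: "\<forall>t. eigenvalue_distribution V B t = real (card {i. i < card V \<and> l i \<le> t}) / real (card V)"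
    using symmetric_kernel_diagonalization[of V B] V sym by blast
  note B = *(1)[rule_format] and comp = *(2)[rule_format] and orth = *(3)[rule_format]
  have eig: "(\<Sum>y\<in>V. B x y * w i y) = l i * w i x" if i: "i < card V" and x: "x \<in> V" for i x
  proof -
    have "(\<Sum>y\<in>V. B x y * w i y) = (\<Sum>y\<in>V. \<Sum>k<card V. l k * w k x * (w k y * w i y))"
      using x by (intro sum.cong refl) (simp add: B sum_distrib_right mult.assoc)
    also have "\<dots> = (\<Sum>k<card V. \<Sum>y\<in>V. l k * w k x * (w k y * w i y))" by (rule sum.swap)
    also have "\<dots> = (\<Sum>k<card V. if k = i then l i * w i x else 0)"
      using i by (intro sum.cong refl) (auto simp: sum_distrib_left[symmetric] orth)
    also have "\<dots> = l i * w i x" using i by simp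
    finally show ?thesis .
  qed
  define co where "co a i = (\<Sum>x\<in>V. a x * w i x)" for a i
  have parseval: "(\<Sum>x\<in>V. a x * b x) = (\<Sum>i<card V. co a i * co b i)" for a b
  proof -
    have "(\<Sum>i<card V. co a i * co b i) =
        (\<Sum>i<card V. \<Sum>x\<in>V. \<Sum>y\<in>V. a x * b y * (w i x * w i y))"
      by (simp add: co_def sum_product mult_ac)
    also have "\<dots> = (\<Sum>x\<in>V. \<Sum>y\<in>V. \<Sum>i<card V. a x * b y * (w i x * w i y))"
      by (subst sum.swap) (intro sum.cong refl sum.swap)
    also have "\<dots> = (\<Sum>x\<in>V. \<Sum>y\<in>V. if y = x then a x * b x else 0)"
      by (intro sum.cong refl) (auto simp: sum_distrib_left[symmetric] comp)
    also have "\<dots> = (\<Sum>x\<in>V. a x * b x)" using V by simp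
    finally show ?thesis by simp
  qed
  have co1: "co (kernel_apply V B a) i = l i * co a i" if i: "i < card V" for a i
  proof -
    have "co (kernel_apply V B a) i = (\<Sum>x\<in>V. \<Sum>y\<in>V. B x y * a y * w i x)"
      by (simp add: co_def kernel_apply_def sum_distrib_right)
    also have "\<dots> = (\<Sum>y\<in>V. \<Sum>x\<in>V. B x y * a y * w i x)" by (rule sum.swap)
    also have "\<dots> = (\<Sum>y\<in>V. a y * (\<Sum>x\<in>V. B y x * w i x))"
      unfolding sum_distrib_left using sym by (intro sum.cong refl) (simp add: mult_ac)
    also have "\<dots> = l i * co a i"
      using i by (simp add: eig co_def sum_distrib_left mult_ac)
    finally show ?thesis .
  qed
  have coj: "co ((kernel_apply V B ^^ j) a) i = l i ^ j * co a i" if "i < card V" for a i j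
    using that by (induction j) (simp_all add: co1)
  have sq: "(\<Sum>x\<in>V. (w i x)\<^sup>2) = 1" if "i < card V" for i
    using orth[OF that that] by (simp add: power2_eq_square)
  show ?thesis
  proof (intro exI[of _ l] exI[of _ w] conjI allI impI)
    fix i assume i: "i < card V"
    note sq = sq[OF i]
    have ne: "V \<noteq> {}" using sq by auto
    \<comment> \<open>At a coordinate of maximal modulus the eigenvalue equation bounds the
      eigenvalue by a row sum.\<close>
    obtain x where x: "x \<in> V" "\<And>y. y \<in> V \<Longrightarrow> \<bar>w i y\<bar> \<le> \<bar>w i x\<bar>"
    proof -
      have "Max ((\<lambda>y. \<bar>w i y\<bar>) ` V) \<in> (\<lambda>y. \<bar>w i y\<bar>) ` V" using V ne by (intro Max_in) auto
      then obtain x where "x \<in> V" "Max ((\<lambda>y. \<bar>w i y\<bar>) ` V) = \<bar>w i x\<bar>" by auto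
      moreover from this have "\<bar>w i y\<bar> \<le> \<bar>w i x\<bar>" if "y \<in> V" for y
        using that V Max_ge[of "(\<lambda>y. \<bar>w i y\<bar>) ` V" "\<bar>w i y\<bar>"] by simp
      ultimately show thesis using that by blast
    qed
    have "0 < \<bar>w i x\<bar>"
    proof (rule ccontr)
      assume "\<not> 0 < \<bar>w i x\<bar>"
      then have "w i y = 0" if "y \<in> V" for y using x(2)[OF that] by simp
      then show False using sq by simp
    qed
    moreover have "\<bar>l i\<bar> * \<bar>w i x\<bar> \<le> K * \<bar>w i x\<bar>"
    proof -
      have "\<bar>l i\<bar> * \<bar>w i x\<bar> = \<bar>\<Sum>y\<in>V. B x y * w i y\<bar>"
        using eig[OF i x(1)] by (simp add: abs_mult)
      also have "\<dots> \<le> (\<Sum>y\<in>V. \<bar>B x y\<bar> * \<bar>w i x\<bar>)"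
        using x(2) by (intro sum_abs[THEN order_trans] sum_mono) (simp add: abs_mult mult_left_mono)
      also have "\<dots> \<le> K * \<bar>w i x\<bar>"
        unfolding sum_distrib_right[symmetric] by (intro mult_right_mono row x) simp
      finally show ?thesis .
    qed
    ultimately show "\<bar>l i\<bar> \<le> K" by simp
  next
    fix a j
    have "(\<Sum>x\<in>V. (kernel_apply V B ^^ j) a x * a x) = (\<Sum>i<card V. (co a i)\<^sup>2 * l i ^ j)"
      unfolding parseval by (intro sum.cong refl) (simp add: coj power2_eq_square)
    then show "(\<Sum>x\<in>V. (kernel_apply V B ^^ j) a x * a x) =
       (\<Sum>i<card V. (\<Sum>x\<in>V. a x * w i x)\<^sup>2 * l i ^ j)" by (simp only: co_def)
  qed (use dist sq in auto)
qed

section \<open>Balls in graphs and their isomorphism types\<close>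

text \<open>An infimum of a nonempty set of extended naturals is attained. Balls can thus be
  described by walks.\<close>

lemma gdist_le_iff: "gdist G x y \<le> enat k \<longleftrightarrow> (\<exists>j\<le>k. (x, y) \<in> edges G ^^ j)"
proof
  assume le: "gdist G x y \<le> enat k"
  define S where "S = enat ` {j. (x, y) \<in> edges G ^^ j}"
  have gd: "gdist G x y = (if S = {} then \<infinity> else (LEAST z. z \<in> S))"
    by (simp only: gdist_def Inf_enat_def S_def)
  have "S \<noteq> {}"
  proof
    assume "S = {}"
    then have "gdist G x y = \<infinity>" by (simp only: gd simp_thms if_True)
    with le show False by simp
  qed
  then obtain z where "z \<in> S" by blast
  then have "(LEAST z. z \<in> S) \<in> S" by (rule LeastI)
  then have "gdist G x y \<in> S" using \<open>S \<noteq> {}\<close> by (simp only: gd if_False)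
  then show "\<exists>j\<le>k. (x, y) \<in> edges G ^^ j" using le by (auto simp: S_def)
next
  assume "\<exists>j\<le>k. (x, y) \<in> edges G ^^ j"
  then obtain j where j: "j \<le> k" "(x, y) \<in> edges G ^^ j" by blast
  then have "gdist G x y \<le> enat j" unfolding gdist_def by (intro INF_lower) simp
  also have "\<dots> \<le> enat k" using j by simp
  finally show "gdist G x y \<le> enat k" .
qed

lemma gdist_finite_iff: "gdist G x y < \<infinity> \<longleftrightarrow> (\<exists>j. (x, y) \<in> edges G ^^ j)"
proof
  assume "gdist G x y < \<infinity>"
  then obtain k where "gdist G x y = enat k" by auto
  then have "gdist G x y \<le> enat k" by simp
  then show "\<exists>j. (x, y) \<in> edges G ^^ j" unfolding gdist_le_iff by blast
next
  assume "\<exists>j. (x, y) \<in> edges G ^^ j"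
  then obtain j where "(x, y) \<in> edges G ^^ j" ..
  then have "gdist G x y \<le> enat j" unfolding gdist_le_iff by blast
  then show "gdist G x y < \<infinity>" using le_less_trans[of "gdist G x y" "enat j" \<infinity>] by simp
qed

abbreviation ball_verts :: "('v, 'x, 's) xs_graph \<Rightarrow> nat \<Rightarrow> 'v \<Rightarrow> 'v set" where
  "ball_verts G r x \<equiv> verts (gball G r x)"

lemma ball_verts: "ball_verts G r x = {y \<in> verts G. \<exists>j\<le>r. (x, y) \<in> edges G ^^ j}"
  by (simp add: gball_def Let_def gdist_le_iff)

lemma edges_gball: "edges (gball G r x) = edges G \<inter> (ball_verts G r x \<times> ball_verts G r x)"
  by (simp add: gball_def Let_def)

lemma gball_eqI:
  assumes "ball_verts G r x = ball_verts G' r' x'" "edges (gball G r x) = edges (gball G' r' x')"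
    "vcol G = vcol G'" "ecol G = ecol G'"
  shows "gball G r x = gball (G' :: ('v, 'x, 's) xs_graph) r' x'"
  using assms by (intro xs_graph.equality) (simp_all add: gball_def Let_def)

lemma vcol_gball [simp]: "vcol (gball G r x) = vcol G" "ecol (gball G r x) = ecol G"
  by (simp_all add: gball_def Let_def)

lemma root_in_ball: "x \<in> verts G \<Longrightarrow> x \<in> ball_verts G r x"
  by (auto simp: ball_verts intro: exI[of _ 0])

lemma ball_verts_mono: "r \<le> s \<Longrightarrow> ball_verts G r x \<subseteq> ball_verts G s x"
  by (auto simp: ball_verts) (meson le_trans)

lemma ball_verts_trans:
  assumes "y \<in> ball_verts G r x" "z \<in> ball_verts G s y" shows "z \<in> ball_verts G (r + s) x"
proof -
  obtain i j where ij: "i \<le> r" "(x, y) \<in> edges G ^^ i" "j \<le> s" "(y, z) \<in> edges G ^^ j" "z \<in> verts G"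
    using assms by (auto simp: ball_verts)
  then have "(x, z) \<in> edges G ^^ (i + j)" by (auto simp: relpow_add)
  then show ?thesis using ij by (auto simp: ball_verts intro!: exI[of _ "i + j"])
qed

lemma relpow_sym: "sym E \<Longrightarrow> (x, y) \<in> E ^^ j \<Longrightarrow> (y, x) \<in> E ^^ j"
proof (induction j arbitrary: y)
  case (Suc j)
  then obtain z where z: "(x, z) \<in> E ^^ j" "(z, y) \<in> E" by auto
  then have "(y, z) \<in> E" "(z, x) \<in> E ^^ j" using Suc by (auto dest: symD)
  then show ?case by (rule relpow_Suc_I2)
qed auto

lemma ball_verts_sym:
  assumes "wf_graph G" "x \<in> verts G" "y \<in> ball_verts G r x" shows "x \<in> ball_verts G r y"
  using assms relpow_sym[of "edges G" x y] by (auto simp: ball_verts wf_graph_def)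

lemma finite_ball_verts: "wf_graph G \<Longrightarrow> finite (ball_verts G r x)"
  by (simp add: ball_verts wf_graph_def)

lemma wf_gball: "wf_graph G \<Longrightarrow> wf_graph (gball G r x)"
  using finite_ball_verts[of G r x]
  unfolding wf_graph_def edges_gball by (auto simp: sym_def irrefl_def)

text \<open>Raising the radius by one multiplies the size by at most d + 1, as each vertex
  contributes itself and at most d neighbours. The bound is the same for all graphs of the
  sequence.\<close>

lemma card_ball_verts:
  assumes G: "wf_graph G" "degree_bound d G"
  shows "x \<in> verts G \<Longrightarrow> card (ball_verts G r x) \<le> Suc d ^ r"
proof (induction r)
  case 0
  then have "ball_verts G 0 x = {x}" by (auto simp: ball_verts)
  then show ?case by simp
next
  case (Suc r)
  have fin: "finite (edges G `` {y})" for y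
    using G by (auto simp: wf_graph_def intro: finite_subset[of _ "verts G"])
  have "ball_verts G (Suc r) x \<subseteq> (\<Union>y\<in>ball_verts G r x. insert y (edges G `` {y}))"
  proof
    fix z assume "z \<in> ball_verts G (Suc r) x"
    then obtain j where j: "z \<in> verts G" "j \<le> Suc r" "(x, z) \<in> edges G ^^ j" by (auto simp: ball_verts)
    show "z \<in> (\<Union>y\<in>ball_verts G r x. insert y (edges G `` {y}))"
    proof (cases j)
      case 0
      then have "z = x" using j by simp
      then show ?thesis using root_in_ball[OF j(1), of r] by auto
    next
      case (Suc i)
      then obtain y where y: "(x, y) \<in> edges G ^^ i" "(y, z) \<in> edges G" using j by auto
      then have "y \<in> ball_verts G r x" using G Suc j by (auto simp: ball_verts wf_graph_def)
      then show ?thesis using y by auto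
    qed
  qed
  then have "card (ball_verts G (Suc r) x) \<le>
      card (\<Union>y\<in>ball_verts G r x. insert y (edges G `` {y}))"
    by (rule card_mono[rotated]) (auto intro: fin finite_ball_verts G)
  also have "\<dots> \<le> (\<Sum>y\<in>ball_verts G r x. card (insert y (edges G `` {y})))"
    by (rule card_UN_le[OF finite_ball_verts[OF G(1)]])
  also have "\<dots> \<le> (\<Sum>y\<in>ball_verts G r x. Suc d)"
  proof (rule sum_mono)
    fix y assume "y \<in> ball_verts G r x"
    then have "card (edges G `` {y}) \<le> d" using G by (simp add: degree_bound_def ball_verts)
    then show "card (insert y (edges G `` {y})) \<le> Suc d"
      using card_insert_le_m1[of "Suc d" "edges G `` {y}" y] by simp
  qed
  also have "\<dots> = card (ball_verts G r x) * Suc d" by (simp only: sum_constant of_nat_id)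
  also have "\<dots> \<le> Suc d ^ r * Suc d" using Suc by (intro mult_le_mono) auto
  also have "\<dots> = Suc d ^ Suc r" by (simp only: power_Suc2)
  finally show ?case .
qed

text \<open>Every vertex on a short walk is itself the end of a shorter one, so a set containing all
  such ends also contains the walk.\<close>

lemma relpow_within:
  assumes wf: "edges G \<subseteq> verts G \<times> verts G" and y: "y \<in> verts G"
    and U: "\<And>i z. i \<le> t \<Longrightarrow> z \<in> verts G \<Longrightarrow> (y, z) \<in> edges G ^^ i \<Longrightarrow> z \<in> U"
  shows "j \<le> t \<Longrightarrow> (y, z) \<in> edges G ^^ j \<Longrightarrow> (y, z) \<in> (edges G \<inter> U \<times> U) ^^ j"
proof (induction j arbitrary: z)
  case (Suc j)
  then obtain w where w: "(y, w) \<in> edges G ^^ j" "(w, z) \<in> edges G" by auto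
  have "w \<in> U" using U[of j w] w wf Suc.prems by auto
  moreover have "z \<in> U" using U[of "Suc j" z] w wf Suc.prems by auto
  ultimately show ?case using Suc w by auto
qed simp

lemma relpow_mono_rel: "R \<subseteq> S \<Longrightarrow> (R :: 'a rel) ^^ j \<subseteq> S ^^ j"
  by (induction j) auto

text \<open>Walks of length at most t from y stay within distance s + t of x, so cutting out the
  larger ball first loses none of them.\<close>

lemma gball_gball:
  assumes wf: "wf_graph G" and x: "x \<in> verts G" and y: "y \<in> ball_verts G s x"
  shows "gball (gball G (s + t) x) t y = gball G t y"
proof -
  let ?U = "ball_verts G (s + t) x"
  have sub: "ball_verts G t y \<subseteq> ?U" using ball_verts_trans[OF y] by blast
  have yv: "y \<in> verts G" using y by (simp add: ball_verts)
  have v: "ball_verts (gball G (s + t) x) t y = ball_verts G t y"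
  proof (intro equalityI subsetI)
    fix z assume "z \<in> ball_verts (gball G (s + t) x) t y"
    then obtain j where j: "z \<in> ?U" "j \<le> t" "(y, z) \<in> edges (gball G (s + t) x) ^^ j"
      unfolding ball_verts[of "gball G (s + t) x"] by auto
    have "(y, z) \<in> edges G ^^ j"
      using j(3) relpow_mono_rel[of "edges (gball G (s + t) x)" "edges G"] by (auto simp: edges_gball)
    then show "z \<in> ball_verts G t y" using j by (auto simp: ball_verts)
  next
    fix z assume z: "z \<in> ball_verts G t y"
    then obtain j where j: "j \<le> t" "(y, z) \<in> edges G ^^ j" by (auto simp: ball_verts)
    have "(y, z) \<in> (edges G \<inter> ?U \<times> ?U) ^^ j"
    proof (rule relpow_within[OF _ yv _ j])
      show "edges G \<subseteq> verts G \<times> verts G" using wf by (simp add: wf_graph_def)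
      show "w \<in> ?U" if "i \<le> t" "w \<in> verts G" "(y, w) \<in> edges G ^^ i" for i w
        using that sub by (auto simp: ball_verts)
    qed
    then show "z \<in> ball_verts (gball G (s + t) x) t y"
      unfolding ball_verts[of "gball G (s + t) x"] using z sub j by (auto simp: edges_gball)
  qed
  show ?thesis
    by (rule gball_eqI[OF v]) (use sub in \<open>auto simp: edges_gball v\<close>)
qed

section \<open>Isomorphisms of rooted coloured graphs\<close>

lemma rooted_iso_iff:
  "rooted_iso \<phi> (G, a) (H, b) \<longleftrightarrow> bij_betw \<phi> (verts G) (verts H) \<and> \<phi> a = b \<and>
    (\<forall>u\<in>verts G. \<forall>v\<in>verts G. (u, v) \<in> edges G \<longleftrightarrow> (\<phi> u, \<phi> v) \<in> edges H) \<and>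
    (\<forall>u\<in>verts G. vcol H (\<phi> u) = vcol G u) \<and>
    (\<forall>(u, v)\<in>edges G. ecol H (\<phi> u, \<phi> v) = ecol G (u, v))"
  by (simp add: rooted_iso_def)

lemma rooted_iso_refl: "rooted_iso id p p"
  by (cases p) (auto simp: rooted_iso_iff)

lemma rooted_iso_trans:
  assumes "edges (fst p) \<subseteq> verts (fst p) \<times> verts (fst p)"
    and "rooted_iso \<phi> p q" "rooted_iso \<psi> q r"
  shows "rooted_iso (\<psi> \<circ> \<phi>) p r"
proof -
  obtain G a H b L c where p: "p = (G, a)" "q = (H, b)" "r = (L, c)" by (metis surj_pair)
  have in_H: "\<phi> u \<in> verts H" if "u \<in> verts G" for u
    using assms(2) that by (auto simp: p rooted_iso_iff bij_betw_def)
  have E: "u \<in> verts G \<and> v \<in> verts G" if "(u, v) \<in> edges G" for u v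
    using assms(1) that by (auto simp: p)
  have \<phi>: "bij_betw \<phi> (verts G) (verts H)" "\<phi> a = b"
    "\<And>u v. u \<in> verts G \<Longrightarrow> v \<in> verts G \<Longrightarrow> (u, v) \<in> edges G \<longleftrightarrow> (\<phi> u, \<phi> v) \<in> edges H"
    "\<And>u. u \<in> verts G \<Longrightarrow> vcol H (\<phi> u) = vcol G u"
    "\<And>u v. (u, v) \<in> edges G \<Longrightarrow> ecol H (\<phi> u, \<phi> v) = ecol G (u, v)"
    using assms(2) by (auto simp: p rooted_iso_iff)
  have \<psi>: "bij_betw \<psi> (verts H) (verts L)" "\<psi> b = c"
    "\<And>u v. u \<in> verts H \<Longrightarrow> v \<in> verts H \<Longrightarrow> (u, v) \<in> edges H \<longleftrightarrow> (\<psi> u, \<psi> v) \<in> edges L"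
    "\<And>u. u \<in> verts H \<Longrightarrow> vcol L (\<psi> u) = vcol H u"
    "\<And>u v. (u, v) \<in> edges H \<Longrightarrow> ecol L (\<psi> u, \<psi> v) = ecol H (u, v)"
    using assms(3) by (auto simp: p rooted_iso_iff)
  have "ecol L (\<psi> (\<phi> u), \<psi> (\<phi> v)) = ecol G (u, v)" if uv: "(u, v) \<in> edges G" for u v
  proof -
    have "(\<phi> u, \<phi> v) \<in> edges H" using \<phi>(3) E[OF uv] uv by blast
    then show ?thesis by (simp only: \<psi>(5) \<phi>(5)[OF uv])
  qed
  then show ?thesis
    unfolding p rooted_iso_iff
    using bij_betw_trans[OF \<phi>(1) \<psi>(1)] in_H
    by (simp add: \<phi>(2) \<psi>(2) \<phi>(3) \<psi>(3) \<phi>(4) \<psi>(4)) blast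
qed

lemma rooted_iso_inv:
  assumes a: "snd p \<in> verts (fst p)" and q: "edges (fst q) \<subseteq> verts (fst q) \<times> verts (fst q)"
    and iso: "rooted_iso \<phi> p q"
  shows "rooted_iso (inv_into (verts (fst p)) \<phi>) q p"
proof -
  obtain G a H b where p: "p = (G, a)" "q = (H, b)" by (metis surj_pair)
  define \<psi> where "\<psi> = inv_into (verts G) \<phi>"
  have bij: "bij_betw \<phi> (verts G) (verts H)" using iso by (simp add: p rooted_iso_iff)
  have inv: "\<phi> (\<psi> v) = v" "\<psi> v \<in> verts G" if "v \<in> verts H" for v
    using bij that by (auto simp: \<psi>_def bij_betw_def f_inv_into_f inv_into_into)
  have "\<psi> b = a"
    using iso bij assms(1) by (auto simp: p rooted_iso_iff \<psi>_def bij_betw_def)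
  moreover have "bij_betw \<psi> (verts H) (verts G)" unfolding \<psi>_def by (rule bij_betw_inv_into[OF bij])
  moreover have ed: "(u, v) \<in> edges H \<longleftrightarrow> (\<psi> u, \<psi> v) \<in> edges G" if "u \<in> verts H" "v \<in> verts H" for u v
    using iso inv[OF that(1)] inv[OF that(2)] by (simp add: p rooted_iso_iff)
  moreover have "vcol G (\<psi> u) = vcol H u" if "u \<in> verts H" for u
    using iso inv[OF that] by (simp add: p rooted_iso_iff) metis
  moreover have "ecol G (\<psi> u, \<psi> v) = ecol H (u, v)" if uv: "(u, v) \<in> edges H" for u v
  proof -
    have u: "u \<in> verts H" and v: "v \<in> verts H" using uv q by (auto simp: p)
    have "(\<psi> u, \<psi> v) \<in> edges G" using ed[OF u v] uv by simp
    then have "ecol H (\<phi> (\<psi> u), \<phi> (\<psi> v)) = ecol G (\<psi> u, \<psi> v)"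
      using iso by (auto simp: p rooted_iso_iff)
    then show ?thesis using inv u v by simp
  qed
  ultimately show ?thesis unfolding p fst_conv \<psi>_def[symmetric] rooted_iso_iff by auto
qed

lemma rooted_iso_relpow:
  assumes iso: "rooted_iso \<phi> (G, a) (H, b)"
    and G: "edges G \<subseteq> verts G \<times> verts G" and H: "edges H \<subseteq> verts H \<times> verts H"
    and u: "u \<in> verts G"
  shows "v \<in> verts G \<Longrightarrow> (u, v) \<in> edges G ^^ j \<longleftrightarrow> (\<phi> u, \<phi> v) \<in> edges H ^^ j"
proof (induction j arbitrary: v)
  case 0
  then show ?case using iso u by (auto simp: rooted_iso_iff bij_betw_def inj_on_def)
next
  case (Suc j)
  have im: "\<phi> ` verts G = verts H" using iso by (simp add: rooted_iso_iff bij_betw_def)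
  have ed: "(w, v) \<in> edges G \<longleftrightarrow> (\<phi> w, \<phi> v) \<in> edges H" if "w \<in> verts G" for w
    using iso that Suc.prems by (simp add: rooted_iso_iff)
  have "(u, v) \<in> edges G ^^ Suc j \<longleftrightarrow> (\<exists>w\<in>verts G. (u, w) \<in> edges G ^^ j \<and> (w, v) \<in> edges G)"
    using G by auto
  also have "\<dots> \<longleftrightarrow> (\<exists>w\<in>verts G. (\<phi> u, \<phi> w) \<in> edges H ^^ j \<and> (\<phi> w, \<phi> v) \<in> edges H)"
    using Suc.IH ed by blast
  also have "\<dots> \<longleftrightarrow> (\<exists>w\<in>verts H. (\<phi> u, w) \<in> edges H ^^ j \<and> (w, \<phi> v) \<in> edges H)"
    unfolding im[symmetric] by blast
  also have "\<dots> \<longleftrightarrow> (\<phi> u, \<phi> v) \<in> edges H ^^ Suc j" using H by auto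
  finally show ?case .
qed

lemma rooted_iso_gdist:
  assumes "rooted_iso \<phi> (G, a) (H, b)" "edges G \<subseteq> verts G \<times> verts G" "edges H \<subseteq> verts H \<times> verts H"
    "u \<in> verts G" "v \<in> verts G"
  shows "gdist H (\<phi> u) (\<phi> v) = gdist G u v"
  unfolding gdist_def using rooted_iso_relpow[OF assms] by simp

lemma rooted_iso_gball:
  assumes iso: "rooted_iso \<phi> (G, a) (H, b)"
    and G: "edges G \<subseteq> verts G \<times> verts G" and H: "edges H \<subseteq> verts H \<times> verts H"
    and y: "y \<in> verts G"
  shows "rooted_iso \<phi> (gball G t y, y) (gball H t (\<phi> y), \<phi> y)"
proof -
  have bij: "bij_betw \<phi> (verts G) (verts H)" using iso by (simp add: rooted_iso_iff)
  have sub: "ball_verts G t y \<subseteq> verts G" by (auto simp: ball_verts)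
  have im: "\<phi> ` ball_verts G t y = ball_verts H t (\<phi> y)"
  proof -
    have "\<phi> ` ball_verts G t y = {w \<in> \<phi> ` verts G. \<exists>j\<le>t. (\<phi> y, w) \<in> edges H ^^ j}"
      using rooted_iso_relpow[OF iso G H y] by (auto simp: ball_verts)
    then show ?thesis using bij by (simp add: bij_betw_def ball_verts)
  qed
  have b: "bij_betw \<phi> (ball_verts G t y) (ball_verts H t (\<phi> y))"
    using bij_betw_subset[OF bij sub im] .
  have mem: "\<phi> u \<in> ball_verts H t (\<phi> y)" if "u \<in> ball_verts G t y" for u using im that by blast
  show ?thesis
    unfolding rooted_iso_iff
  proof (intro conjI ballI b refl)
    fix u v assume uv: "u \<in> ball_verts G t y" "v \<in> ball_verts G t y"
    then have "(u, v) \<in> edges G \<longleftrightarrow> (\<phi> u, \<phi> v) \<in> edges H"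
      using iso sub by (simp add: rooted_iso_iff subset_iff)
    then show "(u, v) \<in> edges (gball G t y) \<longleftrightarrow> (\<phi> u, \<phi> v) \<in> edges (gball H t (\<phi> y))"
      using uv mem by (simp add: edges_gball)
  next
    fix u assume "u \<in> ball_verts G t y"
    then show "vcol (gball H t (\<phi> y)) (\<phi> u) = vcol (gball G t y) u"
      using iso sub by (auto simp: rooted_iso_iff)
  next
    fix e assume "e \<in> edges (gball G t y)"
    then show "case e of (u, v) \<Rightarrow> ecol (gball H t (\<phi> y)) (\<phi> u, \<phi> v) = ecol (gball G t y) (u, v)"
      using iso by (auto simp: rooted_iso_iff edges_gball)
  qed
qed

text \<open>Joins transport of balls along isomorphisms with \<open>gball_gball\<close> on both
  sides. The locality of products and adjoints of kernels rests on this passage from (s + t)-balls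
  to t-balls.\<close>

lemma rooted_iso_restrict:
  assumes wf: "wf_graph G" "wf_graph G'" and x: "x \<in> verts G" and x': "x' \<in> verts G'"
    and iso: "rooted_iso \<phi> (gball G (s + t) x, x) (gball G' (s + t) x', x')"
    and y: "y \<in> ball_verts G s x"
  shows "\<phi> y \<in> ball_verts G' s x'" "rooted_iso \<phi> (gball G t y, y) (gball G' t (\<phi> y), \<phi> y)"
    "bij_betw \<phi> (ball_verts G s x) (ball_verts G' s x')"
proof -
  have ed: "edges (gball L r z) \<subseteq> ball_verts L r z \<times> ball_verts L r z"
    for L :: "('a, 'b, 'c) xs_graph" and r z by (auto simp: edges_gball)
  have ed': "edges (gball L r z) \<subseteq> ball_verts L r z \<times> ball_verts L r z"
    for L :: "('d, 'b, 'c) xs_graph" and r z by (auto simp: edges_gball)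
  have root: "\<phi> x = x'" using iso by (simp add: rooted_iso_iff)
  have 1: "gball (gball G (s + t) x) s x = gball G s x"
    using gball_gball[OF wf(1) x root_in_ball[OF x, of t], of s] by (simp add: add.commute)
  have 2: "gball (gball G' (s + t) x') s x' = gball G' s x'"
    using gball_gball[OF wf(2) x' root_in_ball[OF x', of t], of s] by (simp add: add.commute)
  have "rooted_iso \<phi> (gball G s x, x) (gball G' s x', x')"
    using rooted_iso_gball[OF iso ed ed' root_in_ball[OF x], of s] by (simp add: root 1 2)
  then show b: "bij_betw \<phi> (ball_verts G s x) (ball_verts G' s x')" by (simp add: rooted_iso_iff)
  show y': "\<phi> y \<in> ball_verts G' s x'" using b y by (auto simp: bij_betw_def)
  have "y \<in> ball_verts G (s + t) x" using y ball_verts_mono[of s "s + t" G x] by auto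
  from rooted_iso_gball[OF iso ed ed' this, of t]
  show "rooted_iso \<phi> (gball G t y, y) (gball G' t (\<phi> y), \<phi> y)"
    by (simp add: gball_gball[OF wf(1) x y] gball_gball[OF wf(2) x' y'])
qed

text \<open>Distances are measured inside the ball here, as membership in
  \<open>rooted_graphs\<close> demands.\<close>

lemma connected_gball:
  assumes wf: "wf_graph G" and x: "x \<in> verts G"
  shows "connected_graph (gball G r x)" "\<forall>u\<in>ball_verts G r x. gdist (gball G r x) x u \<le> enat r"
proof -
  have g: "gball (gball G r x) r x = gball G r x"
    using gball_gball[OF wf x root_in_ball[OF x, of 0], of r] by simp
  have p: "\<exists>j\<le>r. (x, u) \<in> edges (gball G r x) ^^ j" if "u \<in> ball_verts G r x" for u
  proof -
    have "u \<in> ball_verts (gball G r x) r x" using that by (simp add: g)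
    then show ?thesis unfolding ball_verts[of "gball G r x"] by blast
  qed
  then show "\<forall>u\<in>ball_verts G r x. gdist (gball G r x) x u \<le> enat r" by (simp add: gdist_le_iff)
  have s: "sym (edges (gball G r x))" using wf_gball[OF wf] by (simp add: wf_graph_def)
  have "\<exists>j. (u, v) \<in> edges (gball G r x) ^^ j"
    if u: "u \<in> ball_verts G r x" and v: "v \<in> ball_verts G r x" for u v
  proof -
    obtain i where "(u, x) \<in> edges (gball G r x) ^^ i" using p[OF u] relpow_sym[OF s] by blast
    moreover obtain j where "(x, v) \<in> edges (gball G r x) ^^ j" using p[OF v] by blast
    ultimately have "(u, v) \<in> edges (gball G r x) ^^ (i + j)" by (auto simp: relpow_add)
    then show ?thesis ..
  qed
  then show "connected_graph (gball G r x)"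
    using root_in_ball[OF x, of r] unfolding connected_graph_def gdist_finite_iff by blast
qed

lemma degree_bound_gball:
  assumes "wf_graph G" "degree_bound d G" shows "degree_bound d (gball G r x)"
  unfolding degree_bound_def
proof
  fix u assume "u \<in> ball_verts G r x"
  then have u: "u \<in> verts G" by (simp add: ball_verts)
  have "finite (edges G `` {u})"
    using assms by (auto simp: wf_graph_def intro: finite_subset[of _ "verts G"])
  then have "card (edges (gball G r x) `` {u}) \<le> card (edges G `` {u})"
    by (rule card_mono) (auto simp: edges_gball)
  then show "card (edges (gball G r x) `` {u}) \<le> d" using assms u by (force simp: degree_bound_def)
qed

section \<open>Representatives on the naturals and finiteness of the set of types\<close>

lemma nat_copy:
  fixes G :: "('v, 'x::finite, 's::finite) xs_graph"
  assumes wf: "wf_graph G"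
  shows "\<exists>\<phi> H. rooted_iso \<phi> (G, a) (H, \<phi> a) \<and> wf_graph H \<and> verts H = {..<card (verts G)}"
proof -
  have fin: "finite (verts G)" using wf by (simp add: wf_graph_def)
  obtain \<phi> where bij: "bij_betw \<phi> (verts G) {..<card (verts G)}"
    using ex_bij_betw_finite_nat[OF fin] by (auto simp: lessThan_atLeast0)
  define \<psi> where "\<psi> = inv_into (verts G) \<phi>"
  have inv: "\<psi> (\<phi> u) = u" if "u \<in> verts G" for u
    using bij that by (simp add: \<psi>_def bij_betw_def)
  \<comment> \<open>Colours are pulled back along the inverse labelling; beyond the copied vertices
    and edges their values are arbitrary.\<close>
  define H where "H = \<lparr>verts = {..<card (verts G)}, edges = map_prod \<phi> \<phi> ` edges G,
    vcol = vcol G \<circ> \<psi>, ecol = ecol G \<circ> map_prod \<psi> \<psi>\<rparr>"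
  have E: "edges G \<subseteq> verts G \<times> verts G" using wf by (simp add: wf_graph_def)
  have ed: "(\<phi> u, \<phi> v) \<in> edges H \<longleftrightarrow> (u, v) \<in> edges G" if "u \<in> verts G" "v \<in> verts G" for u v
  proof
    assume "(\<phi> u, \<phi> v) \<in> edges H"
    then obtain u' v' where e: "(u', v') \<in> edges G" "\<phi> u = \<phi> u'" "\<phi> v = \<phi> v'"
      by (auto simp: H_def)
    then have "u' \<in> verts G" "v' \<in> verts G" using E by auto
    then have "u = u'" "v = v'" using e that inv by metis+
    then show "(u, v) \<in> edges G" using e by simp
  next
    assume "(u, v) \<in> edges G"
    then show "(\<phi> u, \<phi> v) \<in> edges H" by (force simp: H_def)
  qed
  have "rooted_iso \<phi> (G, a) (H, \<phi> a)"
    unfolding rooted_iso_iff using bij ed E inv by (auto simp: H_def)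
  moreover have "wf_graph H"
  proof -
    have im: "\<phi> ` verts G = {..<card (verts G)}" using bij by (simp add: bij_betw_def)
    have "edges H \<subseteq> verts H \<times> verts H" using E im by (auto simp: H_def)
    moreover have "sym (edges H)"
      using wf by (auto simp: wf_graph_def sym_def H_def)
    moreover have "irrefl (edges H)"
    proof (rule irreflI)
      fix w
      show "(w, w) \<notin> edges H"
      proof
        assume "(w, w) \<in> edges H"
        then obtain u v where uv: "(u, v) \<in> edges G" "\<phi> u = w" "\<phi> v = w" by (auto simp: H_def)
        then have "u = v" using E bij by (auto simp: bij_betw_def dest: inj_onD)
        then show False using uv wf by (auto simp: wf_graph_def irrefl_def)
      qed
    qed
    ultimately show ?thesis by (simp add: wf_graph_def H_def)
  qed
  moreover have "verts H = {..<card (verts G)}" by (simp add: H_def)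
  ultimately show ?thesis by blast
qed

lemma rooted_graphs_iso:
  fixes G :: "('v, 'x::finite, 's::finite) xs_graph"
  assumes iso: "rooted_iso \<phi> (G, a) (H, b)" and G: "wf_graph G" and H: "wf_graph H"
    and c: "connected_graph G" and dg: "degree_bound d G" and a: "a \<in> verts G"
    and r: "\<forall>u\<in>verts G. gdist G a u \<le> enat r"
  shows "(H, b) \<in> rooted_graphs d r"
proof -
  have E: "edges G \<subseteq> verts G \<times> verts G" "edges H \<subseteq> verts H \<times> verts H"
    using G H by (auto simp: wf_graph_def)
  note dist = rooted_iso_gdist[OF iso E]
  have bij: "bij_betw \<phi> (verts G) (verts H)" and root: "\<phi> a = b"
    using iso by (auto simp: rooted_iso_iff)
  then have im: "verts H = \<phi> ` verts G" by (simp add: bij_betw_def)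
  have "connected_graph H" using c dist by (auto simp: connected_graph_def im)
  moreover have "degree_bound d H"
    unfolding degree_bound_def im
  proof (rule ballI, elim imageE)
    fix w u assume w: "w = \<phi> u" and u: "u \<in> verts G"
    have "edges H `` {w} = \<phi> ` (edges G `` {u})"
    proof (intro equalityI subsetI)
      fix z assume z: "z \<in> edges H `` {w}"
      then obtain v where v: "v \<in> verts G" "z = \<phi> v" using E im by blast
      then have "(u, v) \<in> edges G" using z w u iso by (auto simp: rooted_iso_iff)
      then show "z \<in> \<phi> ` (edges G `` {u})" using v by blast
    next
      fix z assume "z \<in> \<phi> ` (edges G `` {u})"
      then show "z \<in> edges H `` {w}" using w u E iso by (auto simp: rooted_iso_iff)
    qed
    moreover have "finite (edges G `` {u})"
      using G by (auto simp: wf_graph_def intro: finite_subset[of _ "verts G"])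
    ultimately have "card (edges H `` {w}) \<le> card (edges G `` {u})" using card_image_le by metis
    then show "card (edges H `` {w}) \<le> d" using dg u by (force simp: degree_bound_def)
  qed
  moreover have "b \<in> verts H" "\<forall>u\<in>verts H. gdist H b u \<le> enat r"
    using a r root dist[OF a] by (auto simp: im)
  ultimately show ?thesis using H by (simp add: rooted_graphs_def)
qed

lemma rooted_graphs_edges: "p \<in> rooted_graphs d r \<Longrightarrow> edges (fst p) \<subseteq> verts (fst p) \<times> verts (fst p)"
  and rooted_graphs_root: "p \<in> rooted_graphs d r \<Longrightarrow> snd p \<in> verts (fst p)"
  by (auto simp: rooted_graphs_def wf_graph_def)

lemma equiv_rooted_iso_rel: "equiv (rooted_graphs d r) (rooted_iso_rel d r)"
proof (rule equivI)
  show "rooted_iso_rel d r \<subseteq> rooted_graphs d r \<times> rooted_graphs d r" by (auto simp: rooted_iso_rel_def)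
  show "refl_on (rooted_graphs d r) (rooted_iso_rel d r)"
    by (auto simp: refl_on_def rooted_iso_rel_def intro: rooted_iso_refl)
  show "sym (rooted_iso_rel d r)"
  proof (rule symI)
    fix p q assume "(p, q) \<in> rooted_iso_rel d r"
    then obtain \<phi> where pq: "p \<in> rooted_graphs d r" "q \<in> rooted_graphs d r" "rooted_iso \<phi> p q"
      by (auto simp: rooted_iso_rel_def)
    from rooted_iso_inv[OF rooted_graphs_root[OF pq(1)] rooted_graphs_edges[OF pq(2)] pq(3)]
    show "(q, p) \<in> rooted_iso_rel d r" using pq by (auto simp: rooted_iso_rel_def)
  qed
  show "trans (rooted_iso_rel d r)"
  proof (rule transI)
    fix p q w assume "(p, q) \<in> rooted_iso_rel d r" "(q, w) \<in> rooted_iso_rel d r"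
    then obtain \<phi> \<psi> where pq: "p \<in> rooted_graphs d r" "w \<in> rooted_graphs d r"
      "rooted_iso \<phi> p q" "rooted_iso \<psi> q w"
      by (auto simp: rooted_iso_rel_def)
    from rooted_iso_trans[OF rooted_graphs_edges[OF pq(1)] pq(3,4)]
    show "(p, w) \<in> rooted_iso_rel d r" using pq by (auto simp: rooted_iso_rel_def)
  qed
qed

text \<open>Every type has a representative on an initial segment of bounded length, and such
  representatives have finitely many codes.\<close>

lemma finite_ball_types: "finite (ball_types d r :: (nat, 'x::finite, 's::finite) rooted set set)"
proof -
  let ?N = "Suc d ^ r"
  \<comment> \<open>Colours are recorded on vertices and edges only: their values elsewhere are
    arbitrary and must not distinguish codes.\<close>
  define code where "code p = (verts (fst p), edges (fst p),
    (\<lambda>u. (u, vcol (fst p) u)) ` verts (fst p), (\<lambda>e. (e, ecol (fst p) e)) ` edges (fst p), snd p)" for p :: "(nat, 'x, 's) rooted"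
  define C where "C = Pow {..<?N} \<times> Pow ({..<?N} \<times> {..<?N}) \<times> Pow ({..<?N} \<times> (UNIV :: 'x set)) \<times>
    Pow (({..<?N} \<times> {..<?N}) \<times> (UNIV :: 's set)) \<times> {..<?N}"
  have "\<forall>\<alpha>\<in>ball_types d r. \<exists>p\<in>\<alpha>. p \<in> rooted_graphs d r \<and> code p \<in> C"
  proof
    fix \<alpha> :: "(nat, 'x, 's) rooted set" assume \<alpha>: "\<alpha> \<in> ball_types d r"
    then obtain q where q: "q \<in> rooted_graphs d r" "\<alpha> = rooted_iso_rel d r `` {q}"
      unfolding ball_types_def by (rule quotientE)
    obtain G a where G: "q = (G, a)" by (cases q)
    have g: "wf_graph G" "connected_graph G" "degree_bound d G" "a \<in> verts G"
      "\<forall>u\<in>verts G. gdist G a u \<le> enat r"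
      using q by (auto simp: G rooted_graphs_def)
    obtain \<phi> H where H: "rooted_iso \<phi> (G, a) (H, \<phi> a)" "wf_graph H" "verts H = {..<card (verts G)}"
      using nat_copy[OF g(1)] by blast
    have p: "(H, \<phi> a) \<in> rooted_graphs d r" by (rule rooted_graphs_iso[OF H(1) g(1) H(2) g(2-5)])
    have "(H, \<phi> a) \<in> \<alpha>" using q p H(1) by (auto simp: G rooted_iso_rel_def)
    moreover have "verts G = ball_verts G r a"
      using g(5) by (auto simp: ball_verts gdist_le_iff)
    then have "card (verts G) \<le> ?N" using card_ball_verts[OF g(1,3,4), of r] by simp
    then have v: "verts H \<subseteq> {..<?N}" using H(3) by auto
    moreover have E: "edges H \<subseteq> {..<?N} \<times> {..<?N}" and root: "\<phi> a \<in> {..<?N}"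
      using rooted_graphs_edges[OF p] rooted_graphs_root[OF p] v by auto
    moreover have "(\<lambda>u. (u, vcol H u)) ` verts H \<subseteq> {..<?N} \<times> UNIV" using v by blast
    moreover have "(\<lambda>e. (e, ecol H e)) ` edges H \<subseteq> ({..<?N} \<times> {..<?N}) \<times> UNIV" using E by blast
    ultimately have "code (H, \<phi> a) \<in> C" by (simp only: code_def C_def mem_Times_iff fst_conv snd_conv Pow_iff simp_thms)
    then show "\<exists>p\<in>\<alpha>. p \<in> rooted_graphs d r \<and> code p \<in> C"
      using p \<open>(H, \<phi> a) \<in> \<alpha>\<close> by (intro bexI[of _ "(H, \<phi> a)"] conjI)
  qed
  from bchoice[OF this[unfolded Bex_def]] obtain rep where
    r: "\<forall>\<alpha>\<in>ball_types d r. rep \<alpha> \<in> \<alpha> \<and> rep \<alpha> \<in> rooted_graphs d r \<and> code (rep \<alpha>) \<in> C" ..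
  have rep: "rep \<alpha> \<in> \<alpha>" "rep \<alpha> \<in> rooted_graphs d r" "code (rep \<alpha>) \<in> C"
    if "\<alpha> \<in> ball_types d r" for \<alpha>
    using bspec[OF r that] by (rule conjunct1, rule conjunct2[THEN conjunct1], rule conjunct2[THEN conjunct2])
  have inj: "inj_on (\<lambda>\<alpha>. code (rep \<alpha>)) (ball_types d r)"
  proof (rule inj_onI)
    fix \<alpha> \<beta> :: "(nat, 'x, 's) rooted set"
    assume \<alpha>: "\<alpha> \<in> ball_types d r" and \<beta>: "\<beta> \<in> ball_types d r" and eq: "code (rep \<alpha>) = code (rep \<beta>)"
    obtain G a H b where GH: "rep \<alpha> = (G, a)" "rep \<beta> = (H, b)" by (metis surj_pair)
    have ee: "verts G = verts H \<and> edges G = edges H \<and>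
      (\<lambda>u. (u, vcol G u)) ` verts G = (\<lambda>u. (u, vcol H u)) ` verts H \<and>
      (\<lambda>e. (e, ecol G e)) ` edges G = (\<lambda>e. (e, ecol H e)) ` edges H \<and> a = b"
      using eq unfolding code_def GH fst_conv snd_conv prod.inject .
    note e = conjunct1[OF ee] conjunct1[OF conjunct2[OF ee]] conjunct1[OF conjunct2[OF conjunct2[OF ee]]]
      conjunct1[OF conjunct2[OF conjunct2[OF conjunct2[OF ee]]]]
      conjunct2[OF conjunct2[OF conjunct2[OF conjunct2[OF ee]]]]
    have vc: "vcol G u = vcol H u" if "u \<in> verts G" for u
    proof -
      have "(u, vcol G u) \<in> (\<lambda>u. (u, vcol H u)) ` verts H" 
        unfolding e(3)[symmetric] using that by (rule imageI)
      then show ?thesis by blast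
    qed
    have ec: "ecol G f = ecol H f" if "f \<in> edges G" for f
    proof -
      have "(f, ecol G f) \<in> (\<lambda>e. (e, ecol H e)) ` edges H" 
        unfolding e(4)[symmetric] using that by (rule imageI)
      then show ?thesis by blast
    qed
    have "rooted_iso id (rep \<alpha>) (rep \<beta>)"
      unfolding GH rooted_iso_iff using vc ec
      by (simp add: e(1,2,5)[symmetric] split: prod.split)
    then have "(rep \<alpha>, rep \<beta>) \<in> rooted_iso_rel d r"
      using rep(2)[OF \<alpha>] rep(2)[OF \<beta>] by (auto simp: rooted_iso_rel_def)
    then show "\<alpha> = \<beta>"
      by (rule quotient_eqI[OF equiv_rooted_iso_rel \<alpha>[unfolded ball_types_def]
            \<beta>[unfolded ball_types_def] rep(1)[OF \<alpha>] rep(1)[OF \<beta>]])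
  qed
  have "finite ((\<lambda>\<alpha>. code (rep \<alpha>)) ` ball_types d r)"
  proof (rule finite_subset)
    show "(\<lambda>\<alpha>. code (rep \<alpha>)) ` ball_types d r \<subseteq> C" by (rule image_subsetI) (rule rep(3))
    show "finite C" unfolding C_def by (intro finite_cartesian_product iffD2[OF finite_Pow_iff] finite finite_lessThan)
  qed
  then show ?thesis by (rule finite_imageD[OF _ inj])
qed

section \<open>The ball type of a vertex\<close>

definition ball_type :: "nat \<Rightarrow> ('v, 'x::finite, 's::finite) xs_graph \<Rightarrow> nat \<Rightarrow> 'v \<Rightarrow> (nat, 'x, 's) rooted set" where
  "ball_type d G r x = {q \<in> rooted_graphs d r. \<exists>\<phi>. rooted_iso \<phi> (gball G r x, x) q}"

lemma edges_gball_subset: "edges (gball G r x) \<subseteq> ball_verts G r x \<times> ball_verts G r x"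
  by (auto simp: edges_gball)

context
  fixes d :: nat and G :: "('v, 'x::finite, 's::finite) xs_graph" and x :: 'v and r :: nat
  assumes G: "wf_graph G" "degree_bound d G" and x: "x \<in> verts G"
begin

lemma ball_type_copy:
  obtains \<phi> p where "p \<in> rooted_graphs d r" "rooted_iso \<phi> (gball G r x, x) p"
proof -
  obtain \<phi> and H :: "(nat, 'x, 's) xs_graph"
    where H: "rooted_iso \<phi> (gball G r x, x) (H, \<phi> x)" "wf_graph H"
    using nat_copy[OF wf_gball[OF G(1), of r x], of x] by blast
  have "(H, \<phi> x) \<in> rooted_graphs d r"
    by (rule rooted_graphs_iso[OF H(1) wf_gball[OF G(1)] H(2) connected_gball(1)[OF G(1) x]
          degree_bound_gball[OF G] root_in_ball[OF x] connected_gball(2)[OF G(1) x]])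
  from that[OF this H(1)] show thesis .
qed

lemma ball_type_class:
  assumes p: "p \<in> rooted_graphs d r" "rooted_iso \<phi> (gball G r x, x) p"
  shows "ball_type d G r x = rooted_iso_rel d r `` {p}"
proof (intro equalityI subsetI)
  fix q assume "q \<in> ball_type d G r x"
  then obtain \<psi> where q: "q \<in> rooted_graphs d r" "rooted_iso \<psi> (gball G r x, x) q"
    by (auto simp: ball_type_def)
  have i: "rooted_iso (inv_into (verts (fst (gball G r x, x))) \<phi>) p (gball G r x, x)"
    by (rule rooted_iso_inv[OF _ rooted_graphs_edges[OF p(1)] p(2)]) (simp add: root_in_ball x)
  from rooted_iso_trans[OF rooted_graphs_edges[OF p(1)] i q(2)]
  show "q \<in> rooted_iso_rel d r `` {p}" using p q by (auto simp: rooted_iso_rel_def)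
next
  fix q assume "q \<in> rooted_iso_rel d r `` {p}"
  then obtain \<psi> where q: "q \<in> rooted_graphs d r" "rooted_iso \<psi> p q" by (auto simp: rooted_iso_rel_def)
  have "rooted_iso (\<psi> \<circ> \<phi>) (gball G r x, x) q"
    by (rule rooted_iso_trans[OF _ p(2) q(2)]) (simp add: edges_gball_subset)
  then show "q \<in> ball_type d G r x" using q by (auto simp: ball_type_def)
qed

lemma ball_type_in: "ball_type d G r x \<in> ball_types d r"
proof -
  obtain \<phi> p where p: "p \<in> rooted_graphs d r" "rooted_iso \<phi> (gball G r x, x) p"
    by (rule ball_type_copy)
  show ?thesis unfolding ball_type_class[OF p] ball_types_def using p(1) by (rule quotientI)
qed

lemma represents_iff:
  assumes \<alpha>: "\<alpha> \<in> ball_types d r"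
  shows "represents (gball G r x, x) \<alpha> \<longleftrightarrow> ball_type d G r x = \<alpha>"
proof
  obtain q where q: "q \<in> rooted_graphs d r" "\<alpha> = rooted_iso_rel d r `` {q}"
    using \<alpha> unfolding ball_types_def by (rule quotientE)
  assume "represents (gball G r x, x) \<alpha>"
  then obtain p \<phi> where p: "p \<in> \<alpha>" "rooted_iso \<phi> (gball G r x, x) p" by (auto simp: represents_def)
  then have pr: "p \<in> rooted_graphs d r" "(q, p) \<in> rooted_iso_rel d r" using q by (auto simp: rooted_iso_rel_def)
  show "ball_type d G r x = \<alpha>"
    unfolding ball_type_class[OF pr(1) p(2)] q(2)
    by (rule equiv_class_eq[OF equiv_rooted_iso_rel pr(2), symmetric])
next
  assume \<alpha>: "ball_type d G r x = \<alpha>"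
  obtain \<phi> p where p: "p \<in> rooted_graphs d r" "rooted_iso \<phi> (gball G r x, x) p"
    by (rule ball_type_copy)
  then have "p \<in> \<alpha>" unfolding \<alpha>[symmetric] by (auto simp: ball_type_def)
  with p show "represents (gball G r x, x) \<alpha>" by (auto simp: represents_def)
qed

end

text \<open>Balls in two graphs with a common representative on \<open>nat\<close> are matched by
  one labelling followed by the inverse of the other. Later comparisons then avoid
  representatives.\<close>

lemma ball_type_eq_iff:
  fixes G :: "('v, 'x::finite, 's::finite) xs_graph" and G' :: "('w, 'x, 's) xs_graph"
  assumes G: "wf_graph G" "degree_bound d G" "x \<in> verts G"
    and G': "wf_graph G'" "degree_bound d G'" "x' \<in> verts G'"
  shows "ball_type d G r x = ball_type d G' r x' \<longleftrightarrow>
    (\<exists>\<phi>. rooted_iso \<phi> (gball G r x, x) (gball G' r x', x'))"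
proof
  assume eq: "ball_type d G r x = ball_type d G' r x'"
  obtain \<phi> p where p: "p \<in> rooted_graphs d r" "rooted_iso \<phi> (gball G r x, x) p"
    using ball_type_copy[OF G] .
  then have "p \<in> ball_type d G' r x'" unfolding eq[symmetric] by (auto simp: ball_type_def)
  then obtain \<psi> where \<psi>: "rooted_iso \<psi> (gball G' r x', x') p" by (auto simp: ball_type_def)
  have i: "rooted_iso (inv_into (verts (fst (gball G' r x', x'))) \<psi>) p (gball G' r x', x')"
    by (rule rooted_iso_inv[OF _ rooted_graphs_edges[OF p(1)] \<psi>]) (simp add: root_in_ball G')
  have "rooted_iso (inv_into (verts (fst (gball G' r x', x'))) \<psi> \<circ> \<phi>) (gball G r x, x) (gball G' r x', x')"
    by (rule rooted_iso_trans[OF _ p(2) i]) (simp add: edges_gball_subset)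
  then show "\<exists>\<phi>. rooted_iso \<phi> (gball G r x, x) (gball G' r x', x')" by blast
next
  assume "\<exists>\<phi>. rooted_iso \<phi> (gball G r x, x) (gball G' r x', x')"
  then obtain \<phi> where \<phi>: "rooted_iso \<phi> (gball G r x, x) (gball G' r x', x')" ..
  obtain \<psi> p where p: "p \<in> rooted_graphs d r" "rooted_iso \<psi> (gball G' r x', x') p"
    using ball_type_copy[OF G'] .
  have c: "rooted_iso (\<psi> \<circ> \<phi>) (gball G r x, x) p"
    by (rule rooted_iso_trans[OF _ \<phi> p(2)]) (simp add: edges_gball_subset)
  show "ball_type d G r x = ball_type d G' r x'"
    unfolding ball_type_class[OF G p(1) c] ball_type_class[OF G' p] ..
qed

section \<open>Kernels determined by local isomorphism types\<close>

locale graph_sequence =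
  fixes d :: nat and G :: "nat \<Rightarrow> ('v, 'x::finite, 's::finite) xs_graph"
  assumes weakly_convergent: "weakly_convergent d G"
begin

abbreviation V :: "nat \<Rightarrow> 'v set" where "V n \<equiv> verts (G n)"
abbreviation vtyp :: "nat \<Rightarrow> nat \<Rightarrow> 'v \<Rightarrow> (nat, 'x, 's) rooted set" where
  "vtyp s n x \<equiv> ball_type d (G n) s x"
abbreviation bl :: "nat \<Rightarrow> nat \<Rightarrow> 'v \<Rightarrow> 'v set" where "bl s n x \<equiv> ball_verts (G n) s x"
abbreviation typs :: "nat \<Rightarrow> (nat, 'x, 's) rooted set set" where "typs s \<equiv> ball_types d s"
abbreviation ball_iso where
  "ball_iso \<phi> s n x n' x' \<equiv> rooted_iso \<phi> (gball (G n) s x, x) (gball (G n') s x', x')"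

lemma wf: "wf_graph (G n)" and deg: "degree_bound d (G n)" and conn: "connected_graph (G n)"
  using weakly_convergent by (simp_all add: weakly_convergent_def)

lemma finite_V [simp, intro]: "finite (V n)" using wf by (simp add: wf_graph_def)

lemma card_V: "0 < card (V n)"
  using conn[of n] by (simp add: connected_graph_def card_gt_0_iff)

lemma bl_V: "bl s n x \<subseteq> V n" by (auto simp: ball_verts)

lemma bl_sym: "x \<in> V n \<Longrightarrow> y \<in> bl s n x \<Longrightarrow> x \<in> bl s n y"
  by (rule ball_verts_sym[OF wf])

lemma card_bl: "x \<in> V n \<Longrightarrow> card (bl s n x) \<le> Suc d ^ s"
  by (rule card_ball_verts[OF wf deg])

lemma freq_eq:
  "\<alpha> \<in> typs s \<Longrightarrow> ball_freq (G n) s \<alpha> = real (card {z \<in> V n. vtyp s n z = \<alpha>}) / real (card (V n))"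
  unfolding ball_freq_def
  by (intro arg_cong2[where f = "(/)"] arg_cong[where f = "\<lambda>S. real (card S)"] Collect_cong refl)
    (auto simp: represents_iff[OF wf deg])

lemma freq_tendsto: "1 \<le> s \<Longrightarrow> \<alpha> \<in> typs s \<Longrightarrow> (\<lambda>n. ball_freq (G n) s \<alpha>) \<longlonglongrightarrow> lim_freq G s \<alpha>"
  using weakly_convergent unfolding weakly_convergent_def lim_freq_def
  by (simp add: convergent_LIMSEQ_iff)

text \<open>Condition (iii) on operator sequences says nothing about the vertices whose ball type has limit
  frequency \<open>0\<close>; they form a vanishing proportion.\<close>

definition good :: "nat \<Rightarrow> nat \<Rightarrow> 'v \<Rightarrow> bool" where
  "good s n x \<longleftrightarrow> x \<in> V n \<and> lim_freq G s (vtyp s n x) \<noteq> 0"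

lemma good_V: "good s n x \<Longrightarrow> x \<in> V n" by (simp add: good_def)

lemma typ_eq_iff: "x \<in> V n \<Longrightarrow> x' \<in> V n' \<Longrightarrow> vtyp s n x = vtyp s n' x' \<longleftrightarrow> (\<exists>\<phi>. ball_iso \<phi> s n x n' x')"
  by (rule ball_type_eq_iff[OF wf deg _ wf deg])

lemma good_iso: "good s n x \<Longrightarrow> x' \<in> V n' \<Longrightarrow> ball_iso \<phi> s n x n' x' \<Longrightarrow> good s n' x'"
  using typ_eq_iff[of x n x' n' s] by (auto simp: good_def)

lemma type_sum:
  fixes h :: "'v \<Rightarrow> real"
  shows "(\<Sum>x\<in>V n. h x) = (\<Sum>\<alpha>\<in>typs s. \<Sum>x\<in>{z \<in> V n. vtyp s n z = \<alpha>}. h x)"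
  by (rule sum.group[symmetric]) (auto simp: finite_ball_types ball_type_in[OF wf deg])

text \<open>There are finitely many types, so the frequencies of the rare ones form a finite sum of
  null sequences.\<close>

lemma bad_fraction_null:
  assumes s: "1 \<le> s"
  shows "(\<lambda>n. real (card {z \<in> V n. \<not> good s n z}) / real (card (V n))) \<longlonglongrightarrow> 0"
proof -
  let ?B = "{\<alpha> \<in> typs s. lim_freq G s \<alpha> = 0}"
  have "real (card {z \<in> V n. \<not> good s n z}) / real (card (V n)) = (\<Sum>\<alpha>\<in>?B. ball_freq (G n) s \<alpha>)" for n
  proof -
    have "card {z \<in> V n. \<not> good s n z} = card (\<Union>\<alpha>\<in>?B. {z \<in> V n. vtyp s n z = \<alpha>})"
      by (rule arg_cong[where f = card]) (auto simp: good_def ball_type_in[OF wf deg])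
    also have "\<dots> = (\<Sum>\<alpha>\<in>?B. card {z \<in> V n. vtyp s n z = \<alpha>})"
      by (rule card_UN_disjoint) (auto simp: finite_ball_types)
    finally show ?thesis by (simp add: freq_eq sum_divide_distrib)
  qed
  moreover have "(\<lambda>n. \<Sum>\<alpha>\<in>?B. ball_freq (G n) s \<alpha>) \<longlonglongrightarrow> (\<Sum>\<alpha>\<in>?B. 0)"
  proof (rule tendsto_sum)
    fix \<alpha> :: "(nat, 'x, 's) rooted set" assume "\<alpha> \<in> ?B"
    then show "(\<lambda>n. ball_freq (G n) s \<alpha>) \<longlonglongrightarrow> 0" using freq_tendsto[OF s, of \<alpha>] by simp
  qed
  ultimately show ?thesis by simp
qed

text \<open>A frequent type of \<open>(s + t)\<close>-balls makes every type of \<open>t\<close>-ball occurring within distance \<open>s\<close> of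
  its root frequent, because a vertex has at most \<open>(d + 1)\<^sup>s\<close> others within distance \<open>s\<close>.\<close>

lemma good_neighbour:
  assumes g: "good (s + t) n x" and y: "y \<in> bl s n x" and t: "1 \<le> t"
  shows "good t n y"
proof -
  have x: "x \<in> V n" and yV: "y \<in> V n" using g y bl_V by (auto simp: good_def)
  let ?\<alpha> = "vtyp (s + t) n x" and ?\<beta> = "vtyp t n y"
  have \<alpha>: "?\<alpha> \<in> typs (s + t)" and \<beta>: "?\<beta> \<in> typs t"
    using ball_type_in[OF wf deg] x yV by auto
  have le: "ball_freq (G m) (s + t) ?\<alpha> \<le> real (Suc d ^ s) * ball_freq (G m) t ?\<beta>" for m
  proof -
    let ?Z = "{z \<in> V m. vtyp (s + t) m z = ?\<alpha>}" and ?W = "{w \<in> V m. vtyp t m w = ?\<beta>}"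
    \<comment> \<open>The isomorphism with the ball of x yields a vertex of type
      \<open>?\<beta>\<close> within distance s of each z; every such vertex serves at most (d+1)^s
      different z.\<close>
    have "?Z \<subseteq> (\<Union>w\<in>?W. bl s m w)"
    proof
      fix z assume "z \<in> ?Z"
      then have z: "z \<in> V m" and tz: "vtyp (s + t) n x = vtyp (s + t) m z" by auto
      obtain \<phi> where \<phi>: "ball_iso \<phi> (s + t) n x m z" using typ_eq_iff[OF x z] tz by blast
      note r = rooted_iso_restrict[OF wf wf x z \<phi> y]
      have w: "\<phi> y \<in> V m" using r(1) bl_V by blast
      then have "vtyp t m (\<phi> y) = ?\<beta>" using typ_eq_iff[OF yV w] r(2) by metis
      moreover have "z \<in> bl s m (\<phi> y)" using bl_sym[OF z r(1)] .
      ultimately show "z \<in> (\<Union>w\<in>?W. bl s m w)" using w by blast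
    qed
    then have "card ?Z \<le> card (\<Union>w\<in>?W. bl s m w)"
      by (rule card_mono[rotated]) (auto intro: finite_ball_verts[OF wf])
    also have "\<dots> \<le> (\<Sum>w\<in>?W. card (bl s m w))" by (rule card_UN_le) simp
    also have "\<dots> \<le> (\<Sum>w\<in>?W. Suc d ^ s)" by (rule sum_mono) (simp add: card_bl del: power_Suc)
    also have "\<dots> = Suc d ^ s * card ?W" by simp
    finally have "real (card ?Z) \<le> real (Suc d ^ s * card ?W)" by (rule of_nat_mono)
    then have "real (card ?Z) / real (card (V m)) \<le> real (Suc d ^ s * card ?W) / real (card (V m))"
      by (rule divide_right_mono) simp
    then show ?thesis unfolding freq_eq[OF \<alpha>] freq_eq[OF \<beta>] of_nat_mult times_divide_eq_right .
  qed
  have "lim_freq G (s + t) ?\<alpha> \<le> real (Suc d ^ s) * lim_freq G t ?\<beta>"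
    by (rule LIMSEQ_le[OF freq_tendsto tendsto_mult_left[OF freq_tendsto]])
      (use t \<alpha> \<beta> le in auto)
  moreover have "0 \<le> lim_freq G (s + t) ?\<alpha>"
    by (rule LIMSEQ_le_const[OF freq_tendsto]) (use t \<alpha> in \<open>auto simp: ball_freq_def\<close>)
  moreover have "lim_freq G (s + t) ?\<alpha> \<noteq> 0" using g by (simp add: good_def)
  ultimately have "lim_freq G t ?\<beta> \<noteq> 0" by auto
  then show ?thesis using yV by (simp add: good_def)
qed

lemma good_mono: "good s' n x \<Longrightarrow> 1 \<le> s \<Longrightarrow> s \<le> s' \<Longrightarrow> good s n x"
  using good_neighbour[of "s' - s" s n x x] root_in_ball[OF good_V] by simp

text \<open>Since ball types can be compared between the graphs of the sequence directly, no representative on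
  \<open>nat\<close> and no invariant function occur in this reformulation: invariance is the case \<open>n = n'\<close>,
  \<open>x = x'\<close>.\<close>

definition local_kernel :: "nat \<Rightarrow> 'v kernel_seq \<Rightarrow> bool" where
  "local_kernel s A \<longleftrightarrow> 1 \<le> s \<and> A \<in> kernels_on G \<and> (\<exists>m. \<forall>n x y. \<bar>A n x y\<bar> \<le> m) \<and>
    (\<forall>n x y. x \<in> V n \<longrightarrow> y \<notin> bl s n x \<longrightarrow> A n x y = 0) \<and>
    (\<forall>n x n' x' \<phi> y. good s n x \<longrightarrow> x' \<in> V n' \<longrightarrow> ball_iso \<phi> s n x n' x' \<longrightarrow>
       y \<in> bl s n x \<longrightarrow> A n x y = A n' x' (\<phi> y))"

lemma local_kernelD:
  assumes "local_kernel s A"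
  shows "1 \<le> s" "A \<in> kernels_on G" "\<exists>m. \<forall>n x y. \<bar>A n x y\<bar> \<le> m"
    "x \<in> V n \<Longrightarrow> y \<notin> bl s n x \<Longrightarrow> A n x y = 0"
    "good s n x \<Longrightarrow> x' \<in> V n' \<Longrightarrow> ball_iso \<phi> s n x n' x' \<Longrightarrow> y \<in> bl s n x \<Longrightarrow> A n x y = A n' x' (\<phi> y)"
    "x \<notin> V n \<or> y \<notin> V n \<Longrightarrow> A n x y = 0"
  using assms unfolding local_kernel_def kernels_on_def by blast+

lemma far_iff: "y \<in> V n \<Longrightarrow> gdist (G n) x y > enat s \<longleftrightarrow> y \<notin> bl s n x"
  by (simp add: ball_verts gdist_le_iff[symmetric] not_le)

text \<open>A nonzero limit excludes that all frequencies are 0. The vertex found is used to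
  transport kernel values to a representative.\<close>

lemma type_inhabited:
  assumes s: "1 \<le> s" and \<alpha>: "\<alpha> \<in> typs s" "lim_freq G s \<alpha> \<noteq> 0"
  obtains n x where "good s n x" "vtyp s n x = \<alpha>"
proof -
  have "\<exists>n. \<exists>x\<in>V n. vtyp s n x = \<alpha>"
  proof (rule ccontr)
    assume "\<not> ?thesis"
    then have "ball_freq (G n) s \<alpha> = 0" for n using \<alpha> by (simp add: freq_eq)
    then have "(\<lambda>n. ball_freq (G n) s \<alpha>) \<longlonglongrightarrow> 0" by simp
    then show False using freq_tendsto[OF s \<alpha>(1)] \<alpha>(2) LIMSEQ_unique by blast
  qed
  then obtain n x where "x \<in> V n" "vtyp s n x = \<alpha>" by blast
  then show thesis using \<alpha> by (intro that[of n x]) (simp_all add: good_def)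
qed

lemma typ_memberE:
  assumes p: "p \<in> vtyp s n x" and x: "x \<in> V n"
  obtains \<phi> where "p \<in> rooted_graphs d s" "rooted_iso \<phi> (gball (G n) s x, x) p"
    "rooted_iso (inv_into (bl s n x) \<phi>) p (gball (G n) s x, x)" "bij_betw \<phi> (bl s n x) (verts (fst p))"
proof -
  obtain \<phi> where \<phi>: "p \<in> rooted_graphs d s" "rooted_iso \<phi> (gball (G n) s x, x) p"
    using p by (auto simp: ball_type_def)
  have "rooted_iso (inv_into (verts (fst (gball (G n) s x, x))) \<phi>) p (gball (G n) s x, x)"
    by (rule rooted_iso_inv[OF _ rooted_graphs_edges[OF \<phi>(1)] \<phi>(2)]) (simp add: root_in_ball x)
  moreover have "bij_betw \<phi> (bl s n x) (verts (fst p))"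
    using \<phi>(2) by (cases p) (simp add: rooted_iso_iff)
  ultimately show thesis using \<phi> that by simp
qed

lemma iso_to_representative:
  assumes "p \<in> \<alpha>" "\<alpha> \<in> typs s" "rooted_iso \<phi> (gball (G n) s x, x) p" "x \<in> V n"
  shows "vtyp s n x = \<alpha>"
proof -
  have "represents (gball (G n) s x, x) \<alpha>" using assms by (auto simp: represents_def)
  then show ?thesis using represents_iff[OF wf deg assms(4) assms(2)] by simp
qed

text \<open>From left to right, two vertices of equal type are labelled by the same representative.
  From right to left, the row at one vertex of the type defines the function on a representative,
  and agreement among all vertices makes it correspond everywhere.\<close>

lemma operator_seq_range_iff:
  "0 < s \<Longrightarrow> operator_seq_range d G s A \<longleftrightarrow> local_kernel s A"
proof
  assume s: "0 < s" and A: "operator_seq_range d G s A"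
  then have k: "A \<in> kernels_on G" by (simp add: operator_seq_range_def)
  have z: "A n x y = 0" if "x \<notin> V n \<or> y \<notin> V n" for n x y
    using k that by (simp add: kernels_on_def)
  obtain m where m: "0 < m" "\<And>n x y. x \<in> V n \<Longrightarrow> y \<in> V n \<Longrightarrow> \<bar>A n x y\<bar> \<le> m"
    using A by (auto simp: operator_seq_range_def)
  have "\<bar>A n x y\<bar> \<le> m" for n x y
    using m z[of x n y] by (cases "x \<in> V n \<and> y \<in> V n") auto
  moreover have "A n x y = 0" if "x \<in> V n" "y \<notin> bl s n x" for n x y
  proof (cases "y \<in> V n")
    case True
    then show ?thesis using A that by (simp add: operator_seq_range_def far_iff)
  qed (simp add: z)
  moreover have "A n x y = A n' x' (\<phi> y)"
    if g: "good s n x" and x': "x' \<in> V n'" and \<phi>: "ball_iso \<phi> s n x n' x'" and y: "y \<in> bl s n x"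
    for n x n' x' \<phi> y
  proof -
    have x: "x \<in> V n" using g by (rule good_V)
    have "vtyp s n x \<in> typs s" using ball_type_in[OF wf deg x] .
    then obtain p f where p: "p \<in> vtyp s n x" and c: "corresponds G s A p f"
      using A g by (auto simp: operator_seq_range_def good_def)
    have "p \<in> vtyp s n' x'" using typ_eq_iff[OF x x'] \<phi> p by blast
    then obtain \<psi> where \<psi>: "rooted_iso \<psi> (gball (G n') s x', x') p" using x' by (rule typ_memberE)
    have "rooted_iso (\<psi> \<circ> \<phi>) (gball (G n) s x, x) p"
      by (rule rooted_iso_trans[OF _ \<phi> \<psi>]) (simp add: edges_gball_subset)
    then have "A n x y = f (\<psi> (\<phi> y))" using c x y by (simp add: corresponds_def)
    moreover have "\<phi> y \<in> bl s n' x'" using \<phi> y by (auto simp: rooted_iso_iff bij_betw_def)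
    then have "A n' x' (\<phi> y) = f (\<psi> (\<phi> y))" using c x' \<psi> by (simp add: corresponds_def)
    ultimately show ?thesis by simp
  qed
  ultimately show "local_kernel s A" using s k unfolding local_kernel_def
    by (intro conjI allI impI exI[of _ m]) (simp_all add: Suc_le_eq)
next
  assume s: "0 < s" and A: "local_kernel s A"
  note L = local_kernelD[OF A]
  obtain m where m: "\<And>n x y. \<bar>A n x y\<bar> \<le> m" using L(3) by blast
  have "\<exists>p\<in>\<alpha>. \<exists>f. invariant_function p f \<and> corresponds G s A p f"
    if \<alpha>: "\<alpha> \<in> typs s" "lim_freq G s \<alpha> \<noteq> 0" for \<alpha>
  proof -
    obtain n x where x: "good s n x" "vtyp s n x = \<alpha>" using type_inhabited[OF L(1) \<alpha>] .
    have xV: "x \<in> V n" using x by (simp add: good_V)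
    obtain \<phi>0 p where p0: "p \<in> rooted_graphs d s" "rooted_iso \<phi>0 (gball (G n) s x, x) p"
      using ball_type_copy[OF wf deg xV] .
    then have p: "p \<in> rooted_graphs d s" "p \<in> \<alpha>" using x by (auto simp: ball_type_def)
    obtain \<phi> where \<phi>: "rooted_iso \<phi> (gball (G n) s x, x) p"
      "rooted_iso (inv_into (bl s n x) \<phi>) p (gball (G n) s x, x)" "bij_betw \<phi> (bl s n x) (verts (fst p))"
      using p(2)[folded x(2)] xV by (rule typ_memberE)
    define \<kappa> where "\<kappa> = inv_into (bl s n x) \<phi>"
    define f where "f u = A n x (\<kappa> u)" for u
    have c: "corresponds G s A p f"
      unfolding corresponds_def
    proof (intro allI ballI impI)
      fix n' x' \<psi> y assume x': "x' \<in> V n'" and \<psi>: "rooted_iso \<psi> (gball (G n') s x', x') p"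
        and y: "y \<in> bl s n' x'"
      have "vtyp s n' x' = \<alpha>" by (rule iso_to_representative[OF p(2) \<alpha>(1) \<psi> x'])
      then have g: "good s n' x'" using \<alpha> x' by (simp add: good_def)
      have "ball_iso (\<kappa> \<circ> \<psi>) s n' x' n x"
        unfolding \<kappa>_def by (rule rooted_iso_trans[OF _ \<psi> \<phi>(2)]) (simp add: edges_gball_subset)
      from L(5)[OF g xV this y] show "A n' x' y = f (\<psi> y)" by (simp add: f_def)
    qed
    have "invariant_function p f"
      unfolding invariant_function_def
    proof (intro allI impI ballI)
      \<comment> \<open>A labelling followed by an automorphism is another labelling of the same
        ball, so both values of \<open>f\<close> equal the same kernel entry.\<close>
      fix \<theta> u assume \<theta>: "rooted_iso \<theta> p p" and u: "u \<in> verts (fst p)"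
      obtain y where y: "y \<in> bl s n x" "u = \<phi> y" using \<phi>(3) u by (auto simp: bij_betw_def)
      have "rooted_iso (\<theta> \<circ> \<phi>) (gball (G n) s x, x) p"
        by (rule rooted_iso_trans[OF _ \<phi>(1) \<theta>]) (simp add: edges_gball_subset)
      then have "A n x y = f ((\<theta> \<circ> \<phi>) y)" using c xV y by (simp add: corresponds_def)
      moreover have "A n x y = f (\<phi> y)" using c xV y \<phi>(1) by (simp add: corresponds_def)
      ultimately show "f (\<theta> u) = f u" using y by simp
    qed
    with c p show ?thesis by blast
  qed
  moreover have "\<exists>m>0. \<forall>n. \<forall>x\<in>V n. \<forall>y\<in>V n. \<bar>A n x y\<bar> \<le> m"
    using m by (intro exI[of _ "max m 1"] conjI allI ballI) (simp_all add: le_max_iff_disj)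
  ultimately show "operator_seq_range d G s A"
    using L(2) L(4) unfolding operator_seq_range_def by (simp add: far_iff)
qed

definition null_kernel :: "nat \<Rightarrow> 'v kernel_seq \<Rightarrow> bool" where
  "null_kernel s A \<longleftrightarrow> local_kernel s A \<and> (\<forall>n x y. good s n x \<longrightarrow> A n x y = 0)"

lemma operator_seqs_iff: "A \<in> operator_seqs d G \<longleftrightarrow> (\<exists>s. local_kernel s A)"
proof
  assume "A \<in> operator_seqs d G"
  then show "\<exists>s. local_kernel s A" using operator_seq_range_iff by (auto simp: operator_seqs_def)
next
  assume "\<exists>s. local_kernel s A"
  then obtain s where A: "local_kernel s A" ..
  then have s: "0 < s" using local_kernelD(1)[OF A] by simp
  show "A \<in> operator_seqs d G"
    unfolding operator_seqs_def using s operator_seq_range_iff[OF s, of A] A by blast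
qed

lemma null_seqs_iff: "A \<in> null_seqs d G \<longleftrightarrow> (\<exists>s. null_kernel s A)"
proof
  assume "A \<in> null_seqs d G"
  then obtain s where s: "0 < s" "operator_seq_range d G s A"
    and n: "\<And>\<alpha>. \<alpha> \<in> typs s \<Longrightarrow> lim_freq G s \<alpha> \<noteq> 0 \<Longrightarrow> \<exists>p\<in>\<alpha>. corresponds G s A p (\<lambda>_. 0)"
    by (auto simp: null_seqs_def)
  have A: "local_kernel s A" using s operator_seq_range_iff by blast
  have "A n x y = 0" if g: "good s n x" for n x y
  proof (cases "y \<in> bl s n x")
    case True
    have x: "x \<in> V n" using g by (rule good_V)
    have "vtyp s n x \<in> typs s" using ball_type_in[OF wf deg x] .
    then obtain p where p: "p \<in> vtyp s n x" "corresponds G s A p (\<lambda>_. 0)"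
      using n[of "vtyp s n x"] g by (auto simp: good_def)
    obtain \<psi> where "rooted_iso \<psi> (gball (G n) s x, x) p" using p(1) x by (rule typ_memberE)
    then show ?thesis using p(2) x True unfolding corresponds_def by blast
  qed (use local_kernelD(4)[OF A good_V[OF g]] in simp)
  with A show "\<exists>s. null_kernel s A" unfolding null_kernel_def by blast
next
  assume "\<exists>s. null_kernel s A"
  then obtain s where A: "local_kernel s A" and n: "\<And>n x y. good s n x \<Longrightarrow> A n x y = 0"
    by (auto simp: null_kernel_def)
  have "\<exists>p\<in>\<alpha>. corresponds G s A p (\<lambda>_. 0)" if \<alpha>: "\<alpha> \<in> typs s" "lim_freq G s \<alpha> \<noteq> 0" for \<alpha>
  proof -
    obtain p where p: "p \<in> \<alpha>"
      using \<alpha>(1) equiv_class_self[OF equiv_rooted_iso_rel] unfolding ball_types_def quotient_def by blast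
    have "corresponds G s A p (\<lambda>_. 0)"
      unfolding corresponds_def
    proof (intro allI ballI impI)
      fix n' x' \<psi> y assume x': "x' \<in> V n'" and \<psi>: "rooted_iso \<psi> (gball (G n') s x', x') p"
      have "vtyp s n' x' = \<alpha>" by (rule iso_to_representative[OF p \<alpha>(1) \<psi> x'])
      then show "A n' x' y = 0" using \<alpha> x' by (intro n) (simp add: good_def)
    qed
    with p show ?thesis by blast
  qed
  then show "A \<in> null_seqs d G"
    using A operator_seq_range_iff[of s A] local_kernelD(1)[OF A] unfolding null_seqs_def
    by (intro CollectI exI[of _ s]) simp
qed


section \<open>The algebra of local kernels\<close>

lemma ball_iso_root: "ball_iso \<phi> s n x n' x' \<Longrightarrow> \<phi> x = x'"
  by (simp add: rooted_iso_iff)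

lemma ball_iso_bij: "ball_iso \<phi> s n x n' x' \<Longrightarrow> bij_betw \<phi> (bl s n x) (bl s n' x')"
  by (simp add: rooted_iso_iff)

text \<open>The last claim says that distance more than t from y is preserved too; it covers the
  entries where the kernels vanish on both sides.\<close>

lemma ball_iso_neighbour:
  assumes \<phi>: "ball_iso \<phi> (s + t) n x n' x'" and x: "x \<in> V n" and x': "x' \<in> V n'"
    and y: "y \<in> bl s n x"
  shows "ball_iso \<phi> t n y n' (\<phi> y)" "\<phi> y \<in> bl s n' x'"
    "z \<in> bl (s + t) n x \<Longrightarrow> \<phi> z \<in> bl t n' (\<phi> y) \<longleftrightarrow> z \<in> bl t n y"
proof -
  note r = rooted_iso_restrict[OF wf wf x x' \<phi> y]
  show i: "ball_iso \<phi> t n y n' (\<phi> y)" and "\<phi> y \<in> bl s n' x'" by (rule r)+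
  have im: "bl t n' (\<phi> y) = \<phi> ` bl t n y" using ball_iso_bij[OF i] by (simp add: bij_betw_def)
  have sub: "bl t n y \<subseteq> bl (s + t) n x" using ball_verts_trans[OF y] by blast
  have inj: "inj_on \<phi> (bl (s + t) n x)" using ball_iso_bij[OF \<phi>] by (simp add: bij_betw_def)
  assume "z \<in> bl (s + t) n x"
  then show "\<phi> z \<in> bl t n' (\<phi> y) \<longleftrightarrow> z \<in> bl t n y"
    unfolding im using inj_on_image_mem_iff[OF inj _ sub] by simp
qed

lemma local_kernelI:
  assumes "1 \<le> s" "\<And>n x y. x \<notin> V n \<or> y \<notin> V n \<Longrightarrow> A n x y = 0"
    "\<And>n x y. x \<in> V n \<Longrightarrow> \<bar>A n x y\<bar> \<le> m"
    "\<And>n x y. x \<in> V n \<Longrightarrow> y \<notin> bl s n x \<Longrightarrow> A n x y = 0"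
    "\<And>n x n' x' \<phi> y. good s n x \<Longrightarrow> good s n' x' \<Longrightarrow> x \<in> V n \<Longrightarrow> x' \<in> V n' \<Longrightarrow>
      ball_iso \<phi> s n x n' x' \<Longrightarrow> y \<in> bl s n x \<Longrightarrow> A n x y = A n' x' (\<phi> y)"
  shows "local_kernel s A"
proof -
  have "A \<in> kernels_on G" using assms(2) by (simp add: kernels_on_def)
  moreover have "\<bar>A n x y\<bar> \<le> max m 0" for n x y
    using assms(2)[of x n y] assms(3)[of x n y] by (cases "x \<in> V n") auto
  moreover have "A n x y = A n' x' (\<phi> y)"
    if "good s n x" "x' \<in> V n'" "ball_iso \<phi> s n x n' x'" "y \<in> bl s n x" for n x n' x' \<phi> y
    using assms(5)[OF that(1) good_iso[OF that(1-3)] good_V[OF that(1)] that(2-4)] .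
  ultimately show ?thesis
    using assms(1,4) unfolding local_kernel_def by (intro conjI allI impI exI[of _ "max m 0"]) simp_all
qed

lemma local_kernel_bound:
  assumes "local_kernel s A" shows "\<exists>m\<ge>0. \<forall>n x y. \<bar>A n x y\<bar> \<le> m"
proof -
  obtain m where m: "\<forall>n x y. \<bar>A n x y\<bar> \<le> m" using local_kernelD(3)[OF assms] by blast
  have "\<bar>A 0 undefined undefined\<bar> \<le> m" using m by blast
  then have "0 \<le> m" by linarith
  with m show ?thesis by blast
qed

text \<open>Gives two sequences a common range. Between the old and the new range both entries
  vanish, since isomorphisms respect the smaller ball about the root.\<close>

lemma local_kernel_raise:
  assumes A: "local_kernel s A" and ss: "s \<le> s'"
  shows "local_kernel s' A"
proof -
  note L = local_kernelD[OF A]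
  obtain m where m': "0 \<le> m" "\<forall>n x y. \<bar>A n x y\<bar> \<le> m"
    using local_kernel_bound[OF A] by blast
  note m = m'(1) m'(2)[rule_format]
  have e: "(s' - s) + s = s'" using ss by simp
  show ?thesis
  proof (rule local_kernelI[of _ _ m])
    show "1 \<le> s'" using L(1) ss by simp
    show "A n x y = 0" if "x \<in> V n" "y \<notin> bl s' n x" for n x y
      using that L(4)[of x n y] ball_verts_mono[OF ss, of "G n" x] by blast
    fix n x n' x' \<phi> y
    assume g: "good s' n x" and x: "x \<in> V n" "x' \<in> V n'" and \<phi>: "ball_iso \<phi> s' n x n' x'"
      and y: "y \<in> bl s' n x"
    have root: "x \<in> bl (s' - s) n x" by (rule root_in_ball[OF x(1)])
    note r = ball_iso_neighbour[where s = "s' - s" and t = s, unfolded e, OF \<phi> x root, unfolded ball_iso_root[OF \<phi>]]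
    show "A n x y = A n' x' (\<phi> y)"
    proof (cases "y \<in> bl s n x")
      case True
      then show ?thesis using L(5)[OF good_mono[OF g L(1) ss] x(2) r(1)] by simp
    next
      case False
      then have "\<phi> y \<notin> bl s n' x'" using r(3)[OF y] by simp
      then show ?thesis using L(4)[OF x(1) False] L(4)[OF x(2)] by simp
    qed
  qed (use L(6) m in auto)
qed

lemma local_kernel_add:
  assumes A: "local_kernel s A" and B: "local_kernel s B"
  shows "local_kernel s (ks_add A B)"
proof -
  obtain m where m': "0 \<le> m" "\<forall>n x y. \<bar>A n x y\<bar> \<le> m"
    using local_kernel_bound[OF A] by blast
  note m = m'(1) m'(2)[rule_format]
  obtain k where k': "0 \<le> k" "\<forall>n x y. \<bar>B n x y\<bar> \<le> k"
    using local_kernel_bound[OF B] by blast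
  note k = k'(1) k'(2)[rule_format]
  show ?thesis
  proof (rule local_kernelI[of _ _ "m + k"])
    show "\<bar>ks_add A B n x y\<bar> \<le> m + k" for n x y
      using m(2)[of n x y] k(2)[of n x y] unfolding ks_add_def by linarith
    show "ks_add A B n x y = ks_add A B n' x' (\<phi> y)"
      if "good s n x" "x' \<in> V n'" "ball_iso \<phi> s n x n' x'" "y \<in> bl s n x" for n x n' x' \<phi> y
      using local_kernelD(5)[OF A that] local_kernelD(5)[OF B that] by (simp add: ks_add_def)
  qed (use local_kernelD(1,4,6)[OF A] local_kernelD(4,6)[OF B] in \<open>auto simp: ks_add_def\<close>)
qed

lemma local_kernel_scale:
  assumes A: "local_kernel s A"
  shows "local_kernel s (ks_scale c A)"
proof -
  obtain m where m': "0 \<le> m" "\<forall>n x y. \<bar>A n x y\<bar> \<le> m"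
    using local_kernel_bound[OF A] by blast
  note m = m'(1) m'(2)[rule_format]
  show ?thesis
  proof (rule local_kernelI[of _ _ "\<bar>c\<bar> * m"])
    show "\<bar>ks_scale c A n x y\<bar> \<le> \<bar>c\<bar> * m" for n x y
      unfolding ks_scale_def abs_mult by (rule mult_left_mono[OF m(2)]) simp
    show "ks_scale c A n x y = ks_scale c A n' x' (\<phi> y)"
      if "good s n x" "x' \<in> V n'" "ball_iso \<phi> s n x n' x'" "y \<in> bl s n x" for n x n' x' \<phi> y
      using local_kernelD(5)[OF A that] by (simp add: ks_scale_def)
  qed (use local_kernelD(1,4,6)[OF A] in \<open>auto simp: ks_scale_def\<close>)
qed

lemma local_kernel_one: "local_kernel 1 (ks_one G)"
proof (rule local_kernelI[of _ _ 1])
  show "ks_one G n x y = 0" if "x \<in> V n" "y \<notin> bl 1 n x" for n x y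
    using that root_in_ball[of x "G n" 1] by (auto simp: ks_one_def)
  fix n x n' x' \<phi> y
  assume x: "x \<in> V n" "x' \<in> V n'" and \<phi>: "ball_iso \<phi> 1 n x n' x'" and y: "y \<in> bl 1 n x"
  have "x = y \<longleftrightarrow> \<phi> x = \<phi> y"
    using ball_iso_bij[OF \<phi>] y root_in_ball[OF x(1), of 1] by (auto simp: bij_betw_def inj_on_def)
  then show "ks_one G n x y = ks_one G n' x' (\<phi> y)"
    using x ball_iso_root[OF \<phi>] by (simp add: ks_one_def)
qed (auto simp: ks_one_def)

lemma ks_mult_ball:
  assumes A: "local_kernel s A" and x: "x \<in> V n"
  shows "ks_mult G A B n x y = (\<Sum>z\<in>bl s n x. A n x z * B n z y)"
  unfolding ks_mult_def
  by (rule sum.mono_neutral_right) (use bl_V local_kernelD(4)[OF A x] in auto)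

text \<open>The second factor is evaluated in rows at vertices within s of the root, and their
  s-balls lie in the ball of radius s + s. \<open>good_neighbour\<close> makes these vertices good,
  so the second factor is invariant there.\<close>

lemma local_kernel_mult:
  assumes A: "local_kernel s A" and B: "local_kernel s B"
  shows "local_kernel (s + s) (ks_mult G A B)"
proof -
  note LA = local_kernelD[OF A] and LB = local_kernelD[OF B]
  obtain m where m': "0 \<le> m" "\<forall>n x y. \<bar>A n x y\<bar> \<le> m"
    using local_kernel_bound[OF A] by blast
  note m = m'(1) m'(2)[rule_format]
  obtain k where k': "0 \<le> k" "\<forall>n x y. \<bar>B n x y\<bar> \<le> k"
    using local_kernel_bound[OF B] by blast
  note k = k'(1) k'(2)[rule_format]
  show ?thesis
  proof (rule local_kernelI[of _ _ "real (Suc d ^ s) * (m * k)"])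
    show "1 \<le> s + s" using LA(1) by simp
    show "ks_mult G A B n x y = 0" if "x \<notin> V n \<or> y \<notin> V n" for n x y
      using that LA(6) LB(6) by (auto simp: ks_mult_def)
    show "\<bar>ks_mult G A B n x y\<bar> \<le> real (Suc d ^ s) * (m * k)" if x: "x \<in> V n" for n x y
    proof -
      have "\<bar>ks_mult G A B n x y\<bar> \<le> (\<Sum>z\<in>bl s n x. \<bar>A n x z * B n z y\<bar>)"
        unfolding ks_mult_ball[OF A x] by (rule sum_abs)
      also have "\<dots> \<le> (\<Sum>z\<in>bl s n x. m * k)"
        unfolding abs_mult by (intro sum_mono mult_mono m k) auto
      also have "\<dots> = real (card (bl s n x)) * (m * k)" by simp
      also have "\<dots> \<le> real (Suc d ^ s) * (m * k)"
        using m k by (intro mult_right_mono of_nat_mono card_bl x) auto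
      finally show ?thesis .
    qed
    show "ks_mult G A B n x y = 0" if x: "x \<in> V n" and y: "y \<notin> bl (s + s) n x" for n x y
      unfolding ks_mult_ball[OF A x]
    proof (intro sum.neutral ballI)
      fix z assume z: "z \<in> bl s n x"
      have "y \<notin> bl s n z" using y ball_verts_trans[OF z] by blast
      then show "A n x z * B n z y = 0" using LB(4)[of z n y] z bl_V by auto
    qed
    fix n x n' x' \<phi> y
    assume g: "good (s + s) n x" and x: "x \<in> V n" "x' \<in> V n'"
      and \<phi>: "ball_iso \<phi> (s + s) n x n' x'" and y: "y \<in> bl (s + s) n x"
    have root: "x \<in> bl s n x" by (rule root_in_ball[OF x(1)])
    have gs: "good s n x" by (rule good_neighbour[OF g root LA(1)])
    have \<phi>s: "ball_iso \<phi> s n x n' x'"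
      using ball_iso_neighbour(1)[OF \<phi> x root] ball_iso_root[OF \<phi>] by simp
    have "(\<Sum>z\<in>bl s n x. A n x z * B n z y) = (\<Sum>z\<in>bl s n x. A n' x' (\<phi> z) * B n' (\<phi> z) (\<phi> y))"
    proof (rule sum.cong[OF refl])
      fix z assume z: "z \<in> bl s n x"
      note r = ball_iso_neighbour[OF \<phi> x z]
      have zV: "z \<in> V n" "\<phi> z \<in> V n'" using z r(2) bl_V by auto
      have "B n z y = B n' (\<phi> z) (\<phi> y)"
      proof (cases "y \<in> bl s n z")
        case True
        then show ?thesis by (rule LB(5)[OF good_neighbour[OF g z LA(1)] zV(2) r(1)])
      next
        case False
        then show ?thesis using r(3)[OF y] LB(4)[OF zV(1)] LB(4)[OF zV(2)] by simp
      qed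
      then show "A n x z * B n z y = A n' x' (\<phi> z) * B n' (\<phi> z) (\<phi> y)"
        using LA(5)[OF gs x(2) \<phi>s z] by simp
    qed
    also have "\<dots> = (\<Sum>z\<in>bl s n' x'. A n' x' z * B n' z (\<phi> y))"
      by (rule sum.reindex_bij_betw[OF ball_iso_bij[OF \<phi>s]])
    finally show "ks_mult G A B n x y = ks_mult G A B n' x' (\<phi> y)"
      unfolding ks_mult_ball[OF A x(1)] ks_mult_ball[OF A x(2)] .
  qed
qed

text \<open>The entry \<open>A n y x\<close> is governed by the s-ball of y and not of x. For y
  within s of x that ball lies inside the ball of radius s + s about x, hence the larger
  range.\<close>

lemma local_kernel_adj:
  assumes A: "local_kernel s A"
  shows "local_kernel (s + s) (ks_adj A)"
proof -
  note L = local_kernelD[OF A]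
  obtain m where m': "0 \<le> m" "\<forall>n x y. \<bar>A n x y\<bar> \<le> m"
    using local_kernel_bound[OF A] by blast
  note m = m'(1) m'(2)[rule_format]
  have far: "A n y x = 0" if "x \<in> V n" "y \<notin> bl s n x" for n x y
    using that L(4)[of y n x] L(6)[of y n x] bl_sym[of y n x s] by blast
  show ?thesis
  proof (rule local_kernelI[of _ _ m])
    show "1 \<le> s + s" using L(1) by simp
    show "ks_adj A n x y = 0" if "x \<in> V n" "y \<notin> bl (s + s) n x" for n x y
      using that far[of x n y] ball_verts_mono[of s "s + s" "G n" x] by (auto simp: ks_adj_def)
    fix n x n' x' \<phi> y
    assume g: "good (s + s) n x" and x: "x \<in> V n" "x' \<in> V n'"
      and \<phi>: "ball_iso \<phi> (s + s) n x n' x'" and y: "y \<in> bl (s + s) n x"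
    have root: "x \<in> bl s n x" by (rule root_in_ball[OF x(1)])
    note rr = ball_iso_neighbour[OF \<phi> x root, unfolded ball_iso_root[OF \<phi>]]
    show "ks_adj A n x y = ks_adj A n' x' (\<phi> y)"
    proof (cases "y \<in> bl s n x")
      case True
      note r = ball_iso_neighbour[OF \<phi> x True]
      have yV: "y \<in> V n" "\<phi> y \<in> V n'" using True r(2) bl_V by auto
      have "x \<in> bl s n y" by (rule bl_sym[OF x(1) True])
      then have "A n y x = A n' (\<phi> y) (\<phi> x)"
        by (rule L(5)[OF good_neighbour[OF g True L(1)] yV(2) r(1)])
      then show ?thesis by (simp add: ks_adj_def ball_iso_root[OF \<phi>])
    next
      case False
      then show ?thesis using rr(3)[OF y] far[OF x(1)] far[OF x(2)] by (simp add: ks_adj_def)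
    qed
  qed (use L(6) m in \<open>auto simp: ks_adj_def\<close>)
qed

section \<open>Null kernels as a two-sided ideal\<close>

lemma null_kernelD: "null_kernel s A \<Longrightarrow> local_kernel s A" "null_kernel s A \<Longrightarrow> good s n x \<Longrightarrow> A n x y = 0"
  by (simp_all add: null_kernel_def)

lemma null_kernel_raise: "null_kernel s A \<Longrightarrow> s \<le> s' \<Longrightarrow> null_kernel s' A"
  unfolding null_kernel_def
  using local_kernel_raise good_mono local_kernelD(1) by blast

lemma null_kernel_add: "null_kernel s A \<Longrightarrow> null_kernel s B \<Longrightarrow> null_kernel s (ks_add A B)"
  unfolding null_kernel_def by (simp add: local_kernel_add) (simp add: ks_add_def)

lemma null_kernel_scale: "null_kernel s A \<Longrightarrow> null_kernel s (ks_scale c A)"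
  unfolding null_kernel_def by (simp add: local_kernel_scale) (simp add: ks_scale_def)

lemma null_kernel_mult_left:
  assumes A: "null_kernel s A" and B: "local_kernel s B"
  shows "null_kernel (s + s) (ks_mult G A B)"
proof -
  note L = null_kernelD(1)[OF A]
  have "ks_mult G A B n x y = 0" if "good (s + s) n x" for n x y
    using null_kernelD(2)[OF A good_mono[OF that local_kernelD(1)[OF L]]] by (simp add: ks_mult_def)
  then show ?thesis using local_kernel_mult[OF L B] by (simp add: null_kernel_def)
qed

text \<open>The rows of \<open>A\<close> that enter belong to vertices within s of x, and these are
  good when x is good for the radius s + s.\<close>

lemma null_kernel_mult_right:
  assumes A: "null_kernel s A" and B: "local_kernel s B"
  shows "null_kernel (s + s) (ks_mult G B A)"
proof -
  note L = null_kernelD(1)[OF A]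
  have "ks_mult G B A n x y = 0" if g: "good (s + s) n x" for n x y
    unfolding ks_mult_ball[OF B good_V[OF g]]
    using null_kernelD(2)[OF A good_neighbour[OF g _ local_kernelD(1)[OF L]]] by simp
  then show ?thesis using local_kernel_mult[OF B L] by (simp add: null_kernel_def)
qed

lemma null_kernel_adj:
  assumes A: "null_kernel s A"
  shows "null_kernel (s + s) (ks_adj A)"
proof -
  note L = null_kernelD(1)[OF A]
  have "ks_adj A n x y = 0" if g: "good (s + s) n x" for n x y
  proof (cases "x \<in> bl s n y \<and> y \<in> V n")
    case True
    then have "y \<in> bl s n x" using bl_sym by blast
    then show ?thesis
      using null_kernelD(2)[OF A good_neighbour[OF g _ local_kernelD(1)[OF L]]] by (simp add: ks_adj_def)
  next
    case False
    then show ?thesis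
      using local_kernelD(4)[OF L, of y n x] local_kernelD(6)[OF L, of y n x] by (auto simp: ks_adj_def)
  qed
  then show ?thesis using local_kernel_adj[OF L] by (simp add: null_kernel_def)
qed

section \<open>Normalized traces\<close>

abbreviation mean_trace :: "'v kernel_seq \<Rightarrow> nat \<Rightarrow> real" where
  "mean_trace A n \<equiv> (\<Sum>x\<in>V n. A n x x) / real (card (V n))"

text \<open>The diagonal is constant on the vertices of one frequent type, so their contribution is
  a multiple of a convergent frequency; a rare type contributes at most a bound times a null
  sequence.\<close>

lemma local_kernel_trace:
  assumes A: "local_kernel s A"
  shows "convergent (mean_trace A)"
proof -
  note L = local_kernelD[OF A]
  obtain m where m': "0 \<le> m" "\<forall>n x y. \<bar>A n x y\<bar> \<le> m"
    using local_kernel_bound[OF A] by blast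
  note m = m'(1) m'(2)[rule_format]
  let ?part = "\<lambda>\<alpha> n. (\<Sum>x\<in>{z \<in> V n. vtyp s n z = \<alpha>}. A n x x) / real (card (V n))"
  have "convergent (?part \<alpha>)" if \<alpha>: "\<alpha> \<in> typs s" for \<alpha>
  proof (cases "lim_freq G s \<alpha> = 0")
    case True
    have b: "norm (?part \<alpha> n) \<le> m * ball_freq (G n) s \<alpha>" for n
    proof -
      have "\<bar>\<Sum>x\<in>{z \<in> V n. vtyp s n z = \<alpha>}. A n x x\<bar> \<le> (\<Sum>x\<in>{z \<in> V n. vtyp s n z = \<alpha>}. m)"
        by (rule order_trans[OF sum_abs sum_mono]) (rule m)
      then show ?thesis
        by (simp add: freq_eq[OF \<alpha>] divide_right_mono mult.commute)
    qed
    have "(\<lambda>n. m * ball_freq (G n) s \<alpha>) \<longlonglongrightarrow> 0"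
      using tendsto_mult_left[OF freq_tendsto[OF L(1) \<alpha>], of m] True by simp
    from Lim_null_comparison[OF always_eventually[OF allI[OF b]] this]
    show ?thesis by (rule convergentI)
  next
    case False
    obtain k w where w: "good s k w" "vtyp s k w = \<alpha>" using type_inhabited[OF L(1) \<alpha> False] .
    have c: "A n x x = A k w w" if x: "x \<in> V n" "vtyp s n x = \<alpha>" for n x
    proof -
      obtain \<phi> where \<phi>: "ball_iso \<phi> s k w n x"
        using typ_eq_iff[OF good_V[OF w(1)] x(1), of s] x(2) w(2) by auto
      from L(5)[OF w(1) x(1) \<phi> root_in_ball[OF good_V[OF w(1)]]]
      show ?thesis by (simp add: ball_iso_root[OF \<phi>])
    qed
    have "?part \<alpha> n = A k w w * ball_freq (G n) s \<alpha>" for n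
    proof -
      have "(\<Sum>x\<in>{z \<in> V n. vtyp s n z = \<alpha>}. A n x x) = (\<Sum>x\<in>{z \<in> V n. vtyp s n z = \<alpha>}. A k w w)"
        by (rule sum.cong[OF refl]) (use c in blast)
      then show ?thesis by (simp add: freq_eq[OF \<alpha>])
    qed
    then show ?thesis
      using convergentI[OF tendsto_mult_left[OF freq_tendsto[OF L(1) \<alpha>], of "A k w w"]] by simp
  qed
  then have "convergent (\<lambda>n. \<Sum>\<alpha>\<in>typs s. ?part \<alpha> n)" by (rule convergent_sum)
  moreover have "mean_trace A n = (\<Sum>\<alpha>\<in>typs s. ?part \<alpha> n)" for n
    by (subst type_sum[of _ n s]) (simp add: sum_divide_distrib)
  ultimately show ?thesis by simp
qed

lemma null_kernel_trace:
  assumes A: "null_kernel s A"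
  shows "mean_trace A \<longlonglongrightarrow> 0"
proof -
  note L = null_kernelD(1)[OF A]
  obtain m where m': "0 \<le> m" "\<forall>n x y. \<bar>A n x y\<bar> \<le> m"
    using local_kernel_bound[OF L] by blast
  note m = m'(1) m'(2)[rule_format]
  have b: "norm (mean_trace A n) \<le> m * (real (card {z \<in> V n. \<not> good s n z}) / real (card (V n)))" for n
  proof -
    have "(\<Sum>x\<in>V n. A n x x) = (\<Sum>x\<in>{z \<in> V n. \<not> good s n z}. A n x x)"
      by (rule sum.mono_neutral_right) (use null_kernelD(2)[OF A] in auto)
    also have "\<bar>\<dots>\<bar> \<le> (\<Sum>x\<in>{z \<in> V n. \<not> good s n z}. m)"
      by (rule order_trans[OF sum_abs sum_mono]) (rule m)
    finally show ?thesis by (simp add: divide_right_mono mult.commute)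
  qed
  have "(\<lambda>n. m * (real (card {z \<in> V n. \<not> good s n z}) / real (card (V n)))) \<longlonglongrightarrow> 0"
    using tendsto_mult_left[OF bad_fraction_null[OF local_kernelD(1)[OF L]], of m] by simp
  from Lim_null_comparison[OF always_eventually[OF allI[OF b]] this] show ?thesis .
qed

end

section \<open>The pre-Hilbert space of operator sequences\<close>

lemma ks_mult_add_right: "ks_mult G A (ks_add B C) = ks_add (ks_mult G A B) (ks_mult G A C)"
  by (intro ext) (simp add: ks_mult_def ks_add_def distrib_left sum.distrib)

lemma ks_mult_add_left: "ks_mult G (ks_add A B) C = ks_add (ks_mult G A C) (ks_mult G B C)"
  by (intro ext) (simp add: ks_mult_def ks_add_def distrib_right sum.distrib)

lemma ks_mult_scale_right: "ks_mult G A (ks_scale c B) = ks_scale c (ks_mult G A B)"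
  by (intro ext) (simp add: ks_mult_def ks_scale_def sum_distrib_left mult_ac)

lemma ks_mult_scale_left: "ks_mult G (ks_scale c A) B = ks_scale c (ks_mult G A B)"
  by (intro ext) (simp add: ks_mult_def ks_scale_def sum_distrib_left mult_ac)

lemma ks_mult_column:
  "ks_mult G B A n z x = kernel_apply (verts (G n)) (B n) (\<lambda>y. A n y x) z"
  by (simp add: ks_mult_def kernel_apply_def)

text \<open>Left multiplication acts on each column separately, which reduces <B^j A, A> to
  quadratic forms of the matrix B_n at the columns of A_n.\<close>

lemma ks_mult_power_column:
  "(\<lambda>z. ((ks_mult G B ^^ j) A) n z x) = (kernel_apply (verts (G n)) (B n) ^^ j) (\<lambda>z. A n z x)"
  by (induction j) (simp_all add: ks_mult_column)

context graph_sequence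
begin

abbreviation ops :: "'v kernel_seq set" where "ops \<equiv> operator_seqs d G"
abbreviation nulls :: "'v kernel_seq set" where "nulls \<equiv> null_seqs d G"
abbreviation ks_diff :: "'v kernel_seq \<Rightarrow> 'v kernel_seq \<Rightarrow> 'v kernel_seq" where
  "ks_diff A B \<equiv> ks_add A (ks_scale (-1) B)"

lemma opsE:
  assumes "A \<in> ops" "B \<in> ops"
  shows "\<exists>s. local_kernel s A \<and> local_kernel s B"
proof -
  obtain s t where "local_kernel s A" "local_kernel t B" using assms operator_seqs_iff by blast
  then have "local_kernel (max s t) A" "local_kernel (max s t) B"
    using local_kernel_raise max.cobounded1 max.cobounded2 by blast+
  then show ?thesis by blast
qed

lemma nullsE:
  assumes "A \<in> nulls" "B \<in> ops"
  shows "\<exists>s. null_kernel s A \<and> local_kernel s B"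
proof -
  obtain s t where "null_kernel s A" "local_kernel t B"
    using assms operator_seqs_iff null_seqs_iff by blast
  then have "null_kernel (max s t) A" "local_kernel (max s t) B"
    using local_kernel_raise null_kernel_raise max.cobounded1 max.cobounded2 by blast+
  then show ?thesis by blast
qed

lemma nulls_ops: "A \<in> nulls \<Longrightarrow> A \<in> ops"
  using null_seqs_iff operator_seqs_iff null_kernelD(1) by blast

lemma ops_add: "A \<in> ops \<Longrightarrow> B \<in> ops \<Longrightarrow> ks_add A B \<in> ops"
  using opsE[of A B] local_kernel_add operator_seqs_iff by blast

lemma ops_scale: "A \<in> ops \<Longrightarrow> ks_scale c A \<in> ops"
  using local_kernel_scale operator_seqs_iff by blast

lemma ops_one: "ks_one G \<in> ops"
  using local_kernel_one operator_seqs_iff by blast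

lemma ops_mult: "A \<in> ops \<Longrightarrow> B \<in> ops \<Longrightarrow> ks_mult G A B \<in> ops"
  using opsE[of A B] local_kernel_mult operator_seqs_iff by blast

lemma ops_adj: "A \<in> ops \<Longrightarrow> ks_adj A \<in> ops"
  using local_kernel_adj operator_seqs_iff by blast

lemma nulls_add:
  assumes "A \<in> nulls" "B \<in> nulls" shows "ks_add A B \<in> nulls"
proof -
  obtain s t where "null_kernel s A" "null_kernel t B" using assms null_seqs_iff by blast
  then have "null_kernel (max s t) A" "null_kernel (max s t) B"
    using null_kernel_raise max.cobounded1 max.cobounded2 by blast+
  then show ?thesis using null_kernel_add null_seqs_iff by blast
qed

lemma nulls_scale: "A \<in> nulls \<Longrightarrow> ks_scale c A \<in> nulls"
  using null_kernel_scale null_seqs_iff by blast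

lemma nulls_mult_left: "A \<in> nulls \<Longrightarrow> B \<in> ops \<Longrightarrow> ks_mult G A B \<in> nulls"
  using nullsE[of A B] null_kernel_mult_left null_seqs_iff by blast

lemma nulls_mult_right: "A \<in> nulls \<Longrightarrow> B \<in> ops \<Longrightarrow> ks_mult G B A \<in> nulls"
  using nullsE[of A B] null_kernel_mult_right null_seqs_iff by blast

lemma nulls_adj: "A \<in> nulls \<Longrightarrow> ks_adj A \<in> nulls"
  using null_kernel_adj null_seqs_iff by blast

lemma trace_tendsto: "A \<in> ops \<Longrightarrow> mean_trace A \<longlonglongrightarrow> ks_trace G A"
  unfolding ks_trace_def using local_kernel_trace operator_seqs_iff convergent_LIMSEQ_iff by blast

lemma trace_null: "A \<in> nulls \<Longrightarrow> ks_trace G A = 0"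
  using null_kernel_trace null_seqs_iff trace_tendsto[OF nulls_ops] LIMSEQ_unique by blast

text \<open>Makes the inner product of classes independent of representatives.\<close>

lemma trace_diff:
  assumes "A \<in> ops" "B \<in> ops" "ks_diff A B \<in> nulls"
  shows "ks_trace G A = ks_trace G B"
proof -
  have "(\<lambda>n. mean_trace A n - mean_trace B n) \<longlonglongrightarrow> ks_trace G A - ks_trace G B"
    using assms by (intro tendsto_diff trace_tendsto)
  moreover have "mean_trace (ks_diff A B) n = mean_trace A n - mean_trace B n" for n
    by (simp add: ks_add_def ks_scale_def sum_subtractf diff_divide_distrib)
  moreover have "mean_trace (ks_diff A B) \<longlonglongrightarrow> 0"
    using trace_tendsto[OF nulls_ops[OF assms(3)]] trace_null[OF assms(3)] by simp
  ultimately have "ks_trace G A - ks_trace G B = 0" using LIMSEQ_unique by fastforce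
  then show ?thesis by simp
qed

lemma equiv_null_rel: "equiv ops (null_rel d G)"
proof (rule equivI)
  show "null_rel d G \<subseteq> ops \<times> ops" by (auto simp: null_rel_def)
  show "refl_on ops (null_rel d G)"
  proof (rule refl_onI)
    fix A assume A: "A \<in> ops"
    then obtain s where s: "local_kernel s (ks_diff A A)"
      using ops_add ops_scale operator_seqs_iff by blast
    have "null_kernel s (ks_diff A A)"
      unfolding null_kernel_def using s by (simp add: ks_add_def ks_scale_def)
    then show "(A, A) \<in> null_rel d G" using A null_seqs_iff by (auto simp: null_rel_def)
  qed
  show "sym (null_rel d G)"
  proof (rule symI)
    fix A B assume "(A, B) \<in> null_rel d G"
    then have *: "A \<in> ops" "B \<in> ops" "ks_diff A B \<in> nulls" by (auto simp: null_rel_def)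
    have "ks_diff B A = ks_scale (-1) (ks_diff A B)"
      by (intro ext) (simp add: ks_add_def ks_scale_def)
    then show "(B, A) \<in> null_rel d G" using * nulls_scale by (simp add: null_rel_def)
  qed
  show "trans (null_rel d G)"
  proof (rule transI)
    fix A B C assume "(A, B) \<in> null_rel d G" "(B, C) \<in> null_rel d G"
    then have *: "A \<in> ops" "C \<in> ops" "ks_diff A B \<in> nulls" "ks_diff B C \<in> nulls"
      by (auto simp: null_rel_def)
    have "ks_diff A C = ks_add (ks_diff A B) (ks_diff B C)"
      by (intro ext) (simp add: ks_add_def ks_scale_def)
    then show "(A, C) \<in> null_rel d G" using * nulls_add by (simp add: null_rel_def)
  qed
qed

section \<open>Operations on classes modulo null operators\<close>

abbreviation H :: "'v kernel_seq set ip_space" where "H \<equiv> pre_hilbert d G"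
abbreviation cl :: "'v kernel_seq \<Rightarrow> 'v kernel_seq set" where "cl A \<equiv> op_class d G A"

lemma null_relD: "(A, B) \<in> null_rel d G \<Longrightarrow> A \<in> ops \<and> B \<in> ops \<and> ks_diff A B \<in> nulls"
  by (simp add: null_rel_def)

lemma cl_eqI: "A \<in> ops \<Longrightarrow> B \<in> ops \<Longrightarrow> ks_diff A B \<in> nulls \<Longrightarrow> cl A = cl B"
  unfolding op_class_def by (rule equiv_class_eq[OF equiv_null_rel]) (simp add: null_rel_def)

lemma pts_H: "pts H = cl ` ops"
  by (auto simp: pre_hilbert_def quotient_def op_class_def)

lemma vadd_cl:
  assumes "A \<in> ops" "B \<in> ops" shows "vadd H (cl A) (cl B) = cl (ks_add A B)"
proof -
  have "(\<lambda>A B. cl (ks_add A B)) respects2 null_rel d G"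
  proof (rule congruent2I[OF equiv_null_rel equiv_null_rel])
    fix A A' C assume "(A, A') \<in> null_rel d G" and C: "C \<in> ops"
    note A = null_relD[OF this(1)]
    have "ks_diff (ks_add A C) (ks_add A' C) = ks_diff A A'" "ks_diff (ks_add C A) (ks_add C A') = ks_diff A A'"
      by (intro ext, simp add: ks_add_def ks_scale_def)+
    then show "cl (ks_add A C) = cl (ks_add A' C)" "cl (ks_add C A) = cl (ks_add C A')"
      by (intro cl_eqI ops_add, simp_all add: A C)+
  qed
  from UN_equiv_class2[OF equiv_null_rel equiv_null_rel this assms] show ?thesis
    by (simp add: pre_hilbert_def op_class_def)
qed

lemma vscale_cl:
  assumes "A \<in> ops" shows "vscale H c (cl A) = cl (ks_scale c A)"
proof -
  have "(\<lambda>A. cl (ks_scale c A)) respects null_rel d G"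
  proof (rule congruentI)
    fix A A' assume "(A, A') \<in> null_rel d G"
    note A = null_relD[OF this(1)]
    have "ks_diff (ks_scale c A) (ks_scale c A') = ks_scale c (ks_diff A A')"
      by (intro ext) (simp add: ks_add_def ks_scale_def algebra_simps)
    then show "cl (ks_scale c A) = cl (ks_scale c A')"
      by (intro cl_eqI ops_scale, simp_all add: A nulls_scale)
  qed
  from UN_equiv_class[OF equiv_null_rel this assms] show ?thesis
    by (simp add: pre_hilbert_def op_class_def)
qed

lemma left_mult_cl:
  assumes "A \<in> ops" "B \<in> ops" shows "left_mult d G (cl A) (cl B) = cl (ks_mult G A B)"
proof -
  have "(\<lambda>A B. cl (ks_mult G A B)) respects2 null_rel d G"
  proof (rule congruent2I[OF equiv_null_rel equiv_null_rel])
    fix A A' C assume "(A, A') \<in> null_rel d G" and C: "C \<in> ops"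
    note A = null_relD[OF this(1)]
    have "ks_diff (ks_mult G A C) (ks_mult G A' C) = ks_mult G (ks_diff A A') C"
      "ks_diff (ks_mult G C A) (ks_mult G C A') = ks_mult G C (ks_diff A A')"
      by (simp_all only: ks_mult_add_left ks_mult_add_right ks_mult_scale_left ks_mult_scale_right)
    then show "cl (ks_mult G A C) = cl (ks_mult G A' C)" "cl (ks_mult G C A) = cl (ks_mult G C A')"
      by (intro cl_eqI ops_mult, simp_all add: A C nulls_mult_left nulls_mult_right)+
  qed
  from UN_equiv_class2[OF equiv_null_rel equiv_null_rel this assms] show ?thesis
    by (simp add: left_mult_def op_class_def)
qed

lemma ip_cl:
  assumes "A \<in> ops" "B \<in> ops" shows "ip H (cl A) (cl B) = ks_trace G (ks_mult G (ks_adj B) A)"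
proof -
  have "(\<lambda>A B. {ks_trace G (ks_mult G (ks_adj B) A)}) respects2 null_rel d G"
  proof (rule congruent2I[OF equiv_null_rel equiv_null_rel])
    fix A A' C assume "(A, A') \<in> null_rel d G" and C: "C \<in> ops"
    note A = null_relD[OF this(1)]
    have "ks_diff (ks_mult G (ks_adj C) A) (ks_mult G (ks_adj C) A') = ks_mult G (ks_adj C) (ks_diff A A')"
      by (simp only: ks_mult_add_right ks_mult_scale_right)
    then show "{ks_trace G (ks_mult G (ks_adj C) A)} = {ks_trace G (ks_mult G (ks_adj C) A')}"
      using A C trace_diff[OF ops_mult ops_mult] nulls_mult_right ops_adj by simp
    have "ks_diff (ks_mult G (ks_adj A) C) (ks_mult G (ks_adj A') C) = ks_mult G (ks_adj (ks_diff A A')) C"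
      by (intro ext) (simp add: ks_mult_def ks_adj_def ks_add_def ks_scale_def sum_subtractf left_diff_distrib)
    then show "{ks_trace G (ks_mult G (ks_adj A) C)} = {ks_trace G (ks_mult G (ks_adj A') C)}"
      using A C trace_diff[OF ops_mult ops_mult] nulls_mult_left nulls_adj ops_adj by simp
  qed
  from UN_equiv_class2[OF equiv_null_rel equiv_null_rel this assms] show ?thesis
    by (simp add: pre_hilbert_def op_class_def)
qed

text \<open>The normalized Hilbert-Schmidt inner product of the n-th matrices; the inner product of
  classes is its limit.\<close>

abbreviation mean_ip :: "'v kernel_seq \<Rightarrow> 'v kernel_seq \<Rightarrow> nat \<Rightarrow> real" where
  "mean_ip A B n \<equiv> (\<Sum>x\<in>V n. \<Sum>z\<in>V n. A n z x * B n z x) / real (card (V n))"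

lemma ip_cl_tendsto:
  assumes "A \<in> ops" "B \<in> ops" shows "mean_ip A B \<longlonglongrightarrow> ip H (cl A) (cl B)"
proof -
  have "mean_ip A B = mean_trace (ks_mult G (ks_adj B) A)"
    by (intro ext) (simp add: ks_mult_def ks_adj_def mult.commute)
  then show ?thesis
    using trace_tendsto[OF ops_mult[OF ops_adj[OF assms(2)] assms(1)]] ip_cl[OF assms] by simp
qed

lemma ip_cl_eqI: "A \<in> ops \<Longrightarrow> B \<in> ops \<Longrightarrow> mean_ip A B \<longlonglongrightarrow> c \<Longrightarrow> ip H (cl A) (cl B) = c"
  using ip_cl_tendsto LIMSEQ_unique by blast

text \<open>The laws of the form hold for the Hilbert-Schmidt inner products at every n and pass to
  the limit.\<close>

lemma semi_inner_space_H: "semi_inner_space H"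
proof
  show "pts H \<noteq> {}" using ops_one by (auto simp: pts_H)
  fix U W assume "U \<in> pts H" "W \<in> pts H"
  then obtain A C where A: "U = cl A" "A \<in> ops" and C: "W = cl C" "C \<in> ops" by (auto simp: pts_H)
  show "vadd H U W \<in> pts H" using A C by (auto simp: pts_H vadd_cl ops_add)
  show "vscale H c U \<in> pts H" for c using A by (auto simp: pts_H vscale_cl ops_scale)
  have "mean_ip A C = mean_ip C A" by (simp add: mult.commute)
  then show "ip H U W = ip H W U"
    unfolding A C using ip_cl_tendsto[OF C(2) A(2)] by (intro ip_cl_eqI A C) simp
  show "ip H (vscale H c U) W = c * ip H U W" for c
  proof -
    have "mean_ip (ks_scale c A) C = (\<lambda>n. c * mean_ip A C n)"
      by (intro ext) (simp add: ks_scale_def sum_distrib_left mult.assoc)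
    then show ?thesis
      unfolding A C vscale_cl[OF A(2)]
      using tendsto_mult_left[OF ip_cl_tendsto[OF A(2) C(2)], of c]
      by (intro ip_cl_eqI ops_scale A C) simp
  qed
  show "0 \<le> ip H U U"
    unfolding A by (rule LIMSEQ_le_const[OF ip_cl_tendsto[OF A(2) A(2)]])
      (auto intro!: sum_nonneg divide_nonneg_nonneg)
  fix U' assume "U' \<in> pts H"
  then obtain A' where A': "U' = cl A'" "A' \<in> ops" by (auto simp: pts_H)
  have "mean_ip (ks_add A A') C = (\<lambda>n. mean_ip A C n + mean_ip A' C n)"
    by (intro ext) (simp add: ks_add_def distrib_right sum.distrib add_divide_distrib)
  then show "ip H (vadd H U U') W = ip H U W + ip H U' W"
    unfolding A A' C vadd_cl[OF A(2) A'(2)]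
    using tendsto_add[OF ip_cl_tendsto[OF A(2) C(2)] ip_cl_tendsto[OF A'(2) C(2)]]
    by (intro ip_cl_eqI ops_add A A' C) simp
qed

end

section \<open>The limit operator and its moments\<close>

locale selfadjoint_sequence = graph_sequence d G
  for d :: nat and G :: "nat \<Rightarrow> ('v, 'x::finite, 's::finite) xs_graph" +
  fixes B :: "'v kernel_seq"
  assumes B: "B \<in> operator_seqs d G"
    and B_sym: "x \<in> verts (G n) \<Longrightarrow> y \<in> verts (G n) \<Longrightarrow> B n x y = B n y x"
begin

interpretation H: semi_inner_space H by (rule semi_inner_space_H)

abbreviation T :: "'v kernel_seq set \<Rightarrow> 'v kernel_seq set" where "T \<equiv> left_mult d G (cl B)"

text \<open>A row has at most (d+1)^s entries within the range, each at most m in modulus. The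
  interval [-K, K] originates here.\<close>

lemma row_sum_bound: "\<exists>K\<ge>0. \<forall>n. \<forall>x\<in>V n. (\<Sum>y\<in>V n. \<bar>B n x y\<bar>) \<le> K"
proof -
  obtain s where s: "local_kernel s B" using B operator_seqs_iff by blast
  obtain m where m: "0 \<le> m" "\<forall>n x y. \<bar>B n x y\<bar> \<le> m" using local_kernel_bound[OF s] by blast
  have "(\<Sum>y\<in>V n. \<bar>B n x y\<bar>) \<le> real (Suc d ^ s) * m" if x: "x \<in> V n" for n x
  proof -
    have "(\<Sum>y\<in>V n. \<bar>B n x y\<bar>) = (\<Sum>y\<in>bl s n x. \<bar>B n x y\<bar>)"
      by (rule sum.mono_neutral_right) (use bl_V local_kernelD(4)[OF s x] in auto)
    also have "\<dots> \<le> real (card (bl s n x)) * m" by (rule sum_bounded_above) (use m in blast)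
    also have "\<dots> \<le> real (Suc d ^ s) * m"
      using m by (intro mult_right_mono of_nat_mono card_bl x) auto
    finally show ?thesis .
  qed
  then show ?thesis using m(1) by (intro exI[of _ "real (Suc d ^ s) * m"]) simp
qed

lemma mult_power_ops: "A \<in> ops \<Longrightarrow> (ks_mult G B ^^ j) A \<in> ops"
  by (induction j) (auto simp: ops_mult B)

lemma T_power_cl: "A \<in> ops \<Longrightarrow> (T ^^ j) (cl A) = cl ((ks_mult G B ^^ j) A)"
  by (induction j) (auto simp: left_mult_cl B mult_power_ops)

lemma T_symmetric:
  assumes "U \<in> pts H" "W \<in> pts H" shows "ip H (T U) W = ip H U (T W)"
proof -
  obtain A C where A: "U = cl A" "A \<in> ops" and C: "W = cl C" "C \<in> ops" using assms by (auto simp: pts_H)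
  have "mean_ip (ks_mult G B A) C n = mean_ip A (ks_mult G B C) n" for n
  proof -
    have "(\<Sum>z\<in>V n. ks_mult G B A n z x * C n z x) = (\<Sum>z\<in>V n. A n z x * ks_mult G B C n z x)" for x
    proof -
      have "(\<Sum>z\<in>V n. ks_mult G B A n z x * C n z x) =
          (\<Sum>z\<in>V n. \<Sum>y\<in>V n. B n z y * A n y x * C n z x)"
        by (simp add: ks_mult_def sum_distrib_right)
      also have "\<dots> = (\<Sum>y\<in>V n. \<Sum>z\<in>V n. B n z y * A n y x * C n z x)" by (rule sum.swap)
      also have "\<dots> = (\<Sum>y\<in>V n. \<Sum>z\<in>V n. A n y x * (B n y z * C n z x))"
        by (intro sum.cong refl) (simp add: B_sym mult_ac)
      finally show ?thesis by (simp add: ks_mult_def sum_distrib_left)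
    qed
    then show ?thesis by simp
  qed
  then have "mean_ip (ks_mult G B A) C = mean_ip A (ks_mult G B C)" by blast
  then show ?thesis
    unfolding A C left_mult_cl[OF B A(2)] left_mult_cl[OF B C(2)]
    using ip_cl_tendsto[OF A(2) ops_mult[OF B C(2)]] by (intro ip_cl_eqI ops_mult A B C) simp
qed

text \<open>\<open>l n\<close> and \<open>w n\<close> stand for eigenvalues and unit eigenvectors of
  the n-th matrix. One choice with a common bound serves every operator sequence and every
  power.\<close>

definition spectral_data where
  "spectral_data K l w \<longleftrightarrow> (\<forall>n. (\<forall>i<card (V n). \<bar>l n i\<bar> \<le> K) \<and>
    (\<forall>t. eigenvalue_distribution (V n) (B n) t =
      real (card {i. i < card (V n) \<and> l n i \<le> t}) / real (card (V n))) \<and>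
    (\<forall>a j. (\<Sum>x\<in>V n. (kernel_apply (V n) (B n) ^^ j) a x * a x) =
       (\<Sum>i<card (V n). (\<Sum>x\<in>V n. a x * w n i x)\<^sup>2 * l n i ^ j)) \<and>
    (\<forall>i<card (V n). (\<Sum>x\<in>V n. (w n i x)\<^sup>2) = 1))"

lemma spectral_data_exists: "\<exists>K\<ge>0. \<exists>l w. spectral_data K l w"
proof -
  obtain K where K: "0 \<le> K" "\<forall>n. \<forall>x\<in>V n. (\<Sum>y\<in>V n. \<bar>B n x y\<bar>) \<le> K" using row_sum_bound by blast
  have "\<forall>n. \<exists>l w. (\<forall>i<card (V n). \<bar>l i\<bar> \<le> K) \<and>
    (\<forall>t. eigenvalue_distribution (V n) (B n) t =
      real (card {i. i < card (V n) \<and> l i \<le> t}) / real (card (V n))) \<and>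
    (\<forall>a j. (\<Sum>x\<in>V n. (kernel_apply (V n) (B n) ^^ j) a x * a x) =
       (\<Sum>i<card (V n). (\<Sum>x\<in>V n. a x * w i x)\<^sup>2 * l i ^ j)) \<and>
    (\<forall>i<card (V n). (\<Sum>x\<in>V n. (w i x)\<^sup>2) = 1)"
    by (intro allI symmetric_kernel_spectral[OF finite_V]) (use B_sym K in auto)
  from choice[OF this] obtain l where "\<forall>n. \<exists>w. (\<forall>i<card (V n). \<bar>l n i\<bar> \<le> K) \<and>
    (\<forall>t. eigenvalue_distribution (V n) (B n) t =
      real (card {i. i < card (V n) \<and> l n i \<le> t}) / real (card (V n))) \<and>
    (\<forall>a j. (\<Sum>x\<in>V n. (kernel_apply (V n) (B n) ^^ j) a x * a x) =
       (\<Sum>i<card (V n). (\<Sum>x\<in>V n. a x * w i x)\<^sup>2 * l n i ^ j)) \<and>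
    (\<forall>i<card (V n). (\<Sum>x\<in>V n. (w i x)\<^sup>2) = 1)" ..
  from choice[OF this] obtain w where "spectral_data K l w" unfolding spectral_data_def ..
  with K show ?thesis by blast
qed

lemma spectral_dataD:
  assumes "spectral_data K l w"
  shows "i < card (V n) \<Longrightarrow> \<bar>l n i\<bar> \<le> K"
    "eigenvalue_distribution (V n) (B n) t =
      real (card {i. i < card (V n) \<and> l n i \<le> t}) / real (card (V n))"
    "(\<Sum>x\<in>V n. (kernel_apply (V n) (B n) ^^ j) a x * a x) =
       (\<Sum>i<card (V n). (\<Sum>x\<in>V n. a x * w n i x)\<^sup>2 * l n i ^ j)"
    "i < card (V n) \<Longrightarrow> (\<Sum>x\<in>V n. (w n i x)\<^sup>2) = 1"
  using assms unfolding spectral_data_def by blast+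

text \<open>The squared coefficients of all columns of A_n at the i-th eigenvector, divided by the
  number of vertices. They are the weights of an atomic measure whose moments tend to those of the
  class of A.\<close>

definition weight :: "(nat \<Rightarrow> nat \<Rightarrow> 'v \<Rightarrow> real) \<Rightarrow> 'v kernel_seq \<Rightarrow> nat \<Rightarrow> nat \<Rightarrow> real" where
  "weight w A n i = (\<Sum>x\<in>V n. (\<Sum>z\<in>V n. A n z x * w n i z)\<^sup>2) / real (card (V n))"

lemma weight_nonneg: "0 \<le> weight w A n i"
  by (auto simp: weight_def intro!: divide_nonneg_nonneg sum_nonneg)

lemma power_ip_tendsto:
  assumes S: "spectral_data K l w" and A: "A \<in> ops"
  shows "(\<lambda>n. \<Sum>i<card (V n). weight w A n i * l n i ^ j) \<longlonglongrightarrow> ip H ((T ^^ j) (cl A)) (cl A)"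
proof -
  have "mean_ip ((ks_mult G B ^^ j) A) A n = (\<Sum>i<card (V n). weight w A n i * l n i ^ j)" for n
  proof -
    have "(\<Sum>z\<in>V n. ((ks_mult G B ^^ j) A) n z x * A n z x) =
        (\<Sum>i<card (V n). (\<Sum>z\<in>V n. A n z x * w n i z)\<^sup>2 * l n i ^ j)" for x
      using spectral_dataD(3)[OF S, of j n "\<lambda>z. A n z x"] fun_cong[OF ks_mult_power_column[where G = G and B = B and j = j and A = A and n = n and x = x]]
      by simp
    then have "mean_ip ((ks_mult G B ^^ j) A) A n =
        (\<Sum>x\<in>V n. \<Sum>i<card (V n). (\<Sum>z\<in>V n. A n z x * w n i z)\<^sup>2 * l n i ^ j) / real (card (V n))"
      by simp
    also have "\<dots> = (\<Sum>i<card (V n). \<Sum>x\<in>V n. (\<Sum>z\<in>V n. A n z x * w n i z)\<^sup>2 * l n i ^ j) / real (card (V n))"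
      by (subst sum.swap) (rule refl)
    also have "\<dots> = (\<Sum>i<card (V n). weight w A n i * l n i ^ j)"
      by (simp add: weight_def sum_divide_distrib sum_distrib_right)
    finally show ?thesis .
  qed
  then have "mean_ip ((ks_mult G B ^^ j) A) A = (\<lambda>n. \<Sum>i<card (V n). weight w A n i * l n i ^ j)" by blast
  then show ?thesis
    using ip_cl_tendsto[OF mult_power_ops[OF A] A, of j] T_power_cl[OF A, of j] by simp
qed

text \<open>For fixed n the moments are exactly those of the atomic measure with these weights, and
  approximability is closed under limits.\<close>

lemma approximable_cl:
  assumes S: "spectral_data K l w" and A: "A \<in> ops"
  shows "approximable_moments K (\<lambda>j. ip H ((T ^^ j) (cl A)) (cl A))"
proof (rule approximable_moments_limit)
  show "(\<lambda>n. \<Sum>i<card (V n). weight w A n i * l n i ^ j) \<longlonglongrightarrow> ip H ((T ^^ j) (cl A)) (cl A)" for j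
    by (rule power_ip_tendsto[OF S A])
  show "approximable_moments K (\<lambda>j. \<Sum>i<card (V n). weight w A n i * l n i ^ j)" for n
    unfolding approximable_moments_def
  proof (intro allI impI)
    fix J and e :: real assume "0 < e"
    then show "\<exists>N w' l'. (\<forall>i<N. 0 \<le> w' i \<and> \<bar>l' i\<bar> \<le> K) \<and>
        (\<forall>j\<le>J. \<bar>(\<Sum>i<(N::nat). w' i * l' i ^ j) - (\<Sum>i<card (V n). weight w A n i * l n i ^ j)\<bar> < e)"
      using spectral_dataD(1)[OF S] weight_nonneg
      by (intro exI[of _ "card (V n)"] exI[of _ "weight w A n"] exI[of _ "l n"]) simp
  qed
qed

text \<open>Second and zeroth moments of a measure on [-K, K] are compared; by symmetry of T the
  second moment is the squared norm of the image.\<close>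

lemma T_bounded_square:
  assumes S: "spectral_data K l w" and A: "A \<in> ops"
  shows "ip H (T (cl A)) (T (cl A)) \<le> K\<^sup>2 * ip H (cl A) (cl A)"
proof -
  have p: "cl A \<in> pts H" "T (cl A) \<in> pts H"
    using A ops_mult[OF B A] by (auto simp: pts_H left_mult_cl[OF B A])
  have "ip H ((T ^^ 2) (cl A)) (cl A) \<le> K\<^sup>2 * ip H ((T ^^ 0) (cl A)) (cl A)"
  proof (rule LIMSEQ_le[OF power_ip_tendsto[OF S A] tendsto_mult_left[OF power_ip_tendsto[OF S A]]])
    have "(\<Sum>i<card (V n). weight w A n i * l n i ^ 2) \<le>
        K\<^sup>2 * (\<Sum>i<card (V n). weight w A n i * l n i ^ 0)" for n
      unfolding sum_distrib_left
    proof (rule sum_mono)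
      fix i assume "i \<in> {..<card (V n)}"
      then have "\<bar>l n i\<bar> \<le> \<bar>K\<bar>" using spectral_dataD(1)[OF S, of i n] by simp
      then have "(l n i)\<^sup>2 \<le> K\<^sup>2" by (simp add: abs_le_square_iff)
      then show "weight w A n i * (l n i)\<^sup>2 \<le> K\<^sup>2 * (weight w A n i * l n i ^ 0)"
        using mult_left_mono[OF _ weight_nonneg, of "(l n i)\<^sup>2" "K\<^sup>2" w A n i] by (simp add: mult.commute)
    qed
    then show "\<exists>N. \<forall>n\<ge>N. (\<Sum>i<card (V n). weight w A n i * l n i ^ 2) \<le>
        K\<^sup>2 * (\<Sum>i<card (V n). weight w A n i * l n i ^ 0)" by blast
  qed
  then show ?thesis using T_symmetric[OF p(2) p(1)] by (simp add: numeral_2_eq_2)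
qed

lemma T_selfadjoint: "selfadjoint_operator H T"
proof -
  obtain K l w where K: "0 \<le> K" and S: "spectral_data K l w" using spectral_data_exists by blast
  show ?thesis
    unfolding selfadjoint_operator_def bounded_operator_def
  proof (intro conjI ballI allI exI[of _ K] T_symmetric)
    fix U assume U: "U \<in> pts H"
    then obtain A where A: "U = cl A" "A \<in> ops" by (auto simp: pts_H)
    show TU: "T U \<in> pts H" unfolding A left_mult_cl[OF B A(2)] using ops_mult[OF B A(2)] by (simp add: pts_H)
    show "T (vscale H c U) = vscale H c (T U)" for c
      unfolding A vscale_cl[OF A(2)] left_mult_cl[OF B A(2)] left_mult_cl[OF B ops_scale[OF A(2)]]
        vscale_cl[OF ops_mult[OF B A(2)]] ks_mult_scale_right ..
    show "ip_norm H (T U) \<le> K * ip_norm H U"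
    proof (rule power2_le_imp_le)
      show "(ip_norm H (T U))\<^sup>2 \<le> (K * ip_norm H U)\<^sup>2"
        using T_bounded_square[OF S A(2)] U TU by (simp add: A(1)[symmetric] H.norm_square power_mult_distrib)
    qed (use K H.norm_nonneg U in simp)
    fix W assume "W \<in> pts H"
    then obtain C where C: "W = cl C" "C \<in> ops" by (auto simp: pts_H)
    show "T (vadd H U W) = vadd H (T U) (T W)"
      unfolding A C vadd_cl[OF A(2) C(2)] left_mult_cl[OF B A(2)] left_mult_cl[OF B C(2)]
        left_mult_cl[OF B ops_add[OF A(2) C(2)]] vadd_cl[OF ops_mult[OF B A(2)] ops_mult[OF B C(2)]]
        ks_mult_add_right ..
  qed
qed

lemma T_bounded: "bounded_operator H T"
  using T_selfadjoint by (simp add: selfadjoint_operator_def)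

lemma limit_operator_eq: "limit_operator d G B = completion_map H T"
  by (simp add: limit_operator_def)

lemma limit_operator_power_cls:
  assumes u: "u \<in> cauchy_seqs H"
  shows "(\<lambda>i. (T ^^ j) (u i)) \<in> cauchy_seqs H"
    and "(limit_operator d G B ^^ j) (H.cls u) = H.cls (\<lambda>i. (T ^^ j) (u i))"
proof (induction j)
  case 0
  { case 1 then show ?case using u by simp }
  { case 2 then show ?case by simp }
next
  case (Suc j)
  { case 1 then show ?case using H.cauchy_seqs_bounded_operator[OF T_bounded Suc(1)] by simp }
  { case 2 then show ?case
      using Suc H.completion_map_cls[OF T_bounded Suc(1)] by (simp add: limit_operator_eq) }
qed

text \<open>A vector of the completion is a limit of classes, so its moments are limits of
  approximable ones: the closure property is used a second time, along the Cauchy sequence.\<close>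

lemma moment_operator_limit:
  assumes K: "0 \<le> K" and S: "spectral_data K l w"
  shows "moment_operator (gns_space d G) (limit_operator d G B) K"
proof -
  have "approximable_moments K (\<lambda>j. ip (gns_space d G) ((limit_operator d G B ^^ j) U) U)"
    if U: "U \<in> pts (gns_space d G)" for U
  proof -
    obtain u where u: "U = H.cls u" "u \<in> cauchy_seqs H"
      using U unfolding gns_space_def H.pts_completion by blast
    show ?thesis
    proof (rule approximable_moments_limit)
      fix i
      obtain A where "u i = cl A" "A \<in> ops" using H.cauchy_seqs_pts[OF u(2), of i] by (auto simp: pts_H)
      then show "approximable_moments K (\<lambda>j. ip H ((T ^^ j) (u i)) (u i))"
        using approximable_cl[OF S] by simp
    next
      fix j
      show "(\<lambda>i. ip H ((T ^^ j) (u i)) (u i)) \<longlonglongrightarrow> ip (gns_space d G) ((limit_operator d G B ^^ j) U) U"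
        unfolding u(1) limit_operator_power_cls(2)[OF u(2)] gns_space_def
        by (rule H.ip_cls_tendsto[OF limit_operator_power_cls(1)[OF u(2)] u(2)])
    qed
  qed
  moreover have "selfadjoint_operator (gns_space d G) (limit_operator d G B)"
    unfolding gns_space_def limit_operator_eq by (rule H.completion_map_selfadjoint[OF T_selfadjoint])
  moreover have "carrier_hilbert_space (gns_space d G)"
    unfolding gns_space_def by (rule H.carrier_hilbert_space_completion)
  ultimately show ?thesis using K by (simp add: moment_operator_def moment_operator_axioms_def)
qed

lemma vn_one_pts: "vn_one d G \<in> pts (gns_space d G)"
  unfolding vn_one_def completion_embed_def gns_space_def
  by (intro H.cls_pts H.cauchy_seqs_const) (use ops_one in \<open>auto simp: pts_H\<close>)

text \<open>The columns of the identity are the standard basis, so every eigenvector receives the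
  weight 1 / |V_n|, and the atomic measures are the eigenvalue distributions.\<close>

lemma vn_one_moments:
  assumes S: "spectral_data K l w"
  shows "(\<lambda>n. \<Sum>i<card (V n). 1 / real (card (V n)) * l n i ^ j) \<longlonglongrightarrow>
    ip (gns_space d G) ((limit_operator d G B ^^ j) (vn_one d G)) (vn_one d G)"
proof -
  have c: "(\<lambda>_. cl (ks_one G)) \<in> cauchy_seqs H"
    by (rule H.cauchy_seqs_const) (use ops_one in \<open>auto simp: pts_H\<close>)
  have "ip (gns_space d G) ((limit_operator d G B ^^ j) (vn_one d G)) (vn_one d G) =
      ip H ((T ^^ j) (cl (ks_one G))) (cl (ks_one G))"
    unfolding vn_one_def completion_embed_def gns_space_def limit_operator_power_cls(2)[OF c]
    by (rule H.ip_cls_eqI[OF limit_operator_power_cls(1)[OF c] c tendsto_const])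
  moreover have "weight w (ks_one G) n i = 1 / real (card (V n))" if i: "i < card (V n)" for n i
  proof -
    have "(\<Sum>z\<in>V n. ks_one G n z x * w n i z) = w n i x" if x: "x \<in> V n" for x
    proof -
      have "(\<Sum>z\<in>V n. ks_one G n z x * w n i z) = (\<Sum>z\<in>V n. if z = x then w n i x else 0)"
        by (intro sum.cong refl) (auto simp: ks_one_def)
      then show ?thesis using x by simp
    qed
    then show ?thesis using spectral_dataD(4)[OF S i] by (simp add: weight_def)
  qed
  ultimately show ?thesis using power_ip_tendsto[OF S ops_one, of j] by simp
qed

text \<open>In each weak neighbourhood the operator is approximated by itself.\<close>

lemma limit_operator_in_vn_algebra: "limit_operator d G B \<in> vn_algebra d G"
proof -
  have "bounded_operator (gns_space d G) (limit_operator d G B)"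
    unfolding gns_space_def limit_operator_eq by (rule H.completion_map_bounded[OF T_bounded])
  then show ?thesis unfolding vn_algebra_def using B by (auto intro!: bexI[of _ B])
qed

end

text \<open>A real distribution is determined by its distribution function, so the definite
  description denotes \<open>M\<close>.\<close>

lemma distribution_with_cdf_eq:
  assumes "real_distribution M" "\<And>t. measure M {..t} = F t"
  shows "distribution_with_cdf F = M"
  unfolding distribution_with_cdf_def
proof (rule the_equality)
  show "real_distribution M \<and> (\<forall>t. measure M {..t} = F t)" using assms by simp
  fix N assume "real_distribution N \<and> (\<forall>t. measure N {..t} = F t)"
  then show "N = M" using assms by (intro cdf_unique) (auto simp: cdf_def fun_eq_iff)
qed

theorem theorem1:
  fixes G :: "nat \<Rightarrow> ('v, 'x::finite, 's::finite) xs_graph"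
    and d :: nat
    and B :: "'v kernel_seq"
  assumes "weakly_convergent d G"
    and "B \<in> operator_seqs d G"
    and "\<And>n x y. x \<in> verts (G n) \<Longrightarrow> y \<in> verts (G n) \<Longrightarrow> B n x y = B n y x"
  shows "limit_operator d G B \<in> vn_algebra d G \<and>
    weak_conv_m
      (\<lambda>n. distribution_with_cdf (eigenvalue_distribution (verts (G n)) (B n)))
      (distribution_with_cdf (limit_spectral_distribution d G B)) \<and>
    (\<forall>t. isCont (limit_spectral_distribution d G B) t \<longrightarrow>
      (\<lambda>n. eigenvalue_distribution (verts (G n)) (B n) t)
        \<longlonglongrightarrow> vn_trace d G (spectral_projection_upto d G B t))"
proof -
  interpret selfadjoint_sequence d G B by unfold_locales (use assms in auto)
  obtain K l w where K: "0 \<le> K" and S: "spectral_data K l w" using spectral_data_exists by blast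
  interpret T: moment_operator "gns_space d G" "limit_operator d G B" K
    by (rule moment_operator_limit[OF K S])
  let ?M = "T.\<mu> (vn_one d G)"
  have cdf_M: "measure ?M {..t} = limit_spectral_distribution d G B t" for t
    using T.spectral_projection_cdf[OF vn_one_pts, of t]
    by (simp add: limit_spectral_distribution_def vn_trace_def spectral_projection_upto_def)
  interpret M: finite_borel_measure ?M by (rule T.finite_borel_mu[OF vn_one_pts])
  \<comment> \<open>The zeroth moments are 1 for all n, so the measure at the trace vector, so far
    only finite, is a probability measure.\<close>
  have "(\<lambda>n. \<Sum>i<card (verts (G n)). 1 / real (card (verts (G n))) * l n i ^ 0) \<longlonglongrightarrow> measure ?M UNIV"
    using vn_one_moments[OF S, of 0] by (simp add: T.measure_mu_UNIV[OF vn_one_pts])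
  moreover have "(\<Sum>i<card (verts (G n)). 1 / real (card (verts (G n))) * l n i ^ 0) = 1" for n
    using card_V[of n] by (simp add: card_gt_0_iff)
  ultimately have "measure ?M UNIV = 1" by (simp add: LIMSEQ_const_iff)
  then have M: "real_distribution ?M"
    unfolding real_distribution_def real_distribution_axioms_def
    by (auto intro!: prob_spaceI simp: M.emeasure_eq_measure T.sets_mu[OF vn_one_pts] M.borel_UNIV)
  \<comment> \<open>Equal weights on the eigenvalues listed with multiplicity turn the distribution
    function into the normalized eigenvalue count.\<close>
  define \<mu>n where "\<mu>n n = atomic_measure (card (verts (G n))) (\<lambda>_. 1 / real (card (verts (G n)))) (l n)" for n
  have mu_dist: "real_distribution (\<mu>n n)" for n
    unfolding \<mu>n_def by (rule atomic_measure(3)) (use card_V[of n] in \<open>simp_all add: card_gt_0_iff\<close>)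
  have mu_supp: "supported_measure K (\<mu>n n)" for n
    unfolding \<mu>n_def by (rule atomic_measure(4)) (use spectral_dataD(1)[OF S] in simp_all)
  have mu_cdf: "measure (\<mu>n n) {..t} = eigenvalue_distribution (verts (G n)) (B n) t" for n t
    unfolding \<mu>n_def by (subst atomic_measure(2)) (simp_all add: spectral_dataD(2)[OF S])
  have mu_mom: "(\<integral>t. t ^ j \<partial>\<mu>n n) = (\<Sum>i<card (verts (G n)). 1 / real (card (verts (G n))) * l n i ^ j)" for n j
    unfolding \<mu>n_def by (rule atomic_measure(1)) simp_all
  have conv: "weak_conv_m \<mu>n ?M"
  proof (rule weak_conv_from_moments[OF mu_supp mu_dist T.supported_mu[OF vn_one_pts] M])
    show "(\<lambda>n. \<integral>t. t ^ j \<partial>\<mu>n n) \<longlonglongrightarrow> (\<integral>t. t ^ j \<partial>?M)" for j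
      unfolding mu_mom T.moments_mu[OF vn_one_pts] by (rule vn_one_moments[OF S])
  qed
  have "distribution_with_cdf (eigenvalue_distribution (verts (G n)) (B n)) = \<mu>n n" for n
    by (rule distribution_with_cdf_eq[OF mu_dist mu_cdf])
  moreover have "distribution_with_cdf (limit_spectral_distribution d G B) = ?M"
    by (rule distribution_with_cdf_eq[OF M cdf_M])
  moreover have "(\<lambda>n. eigenvalue_distribution (verts (G n)) (B n) t) \<longlonglongrightarrow>
      vn_trace d G (spectral_projection_upto d G B t)"
    if t: "isCont (limit_spectral_distribution d G B) t" for t
  proof -
    \<comment> \<open>\<open>weak_conv_m\<close> is by definition convergence at the continuity
      points of the limit distribution function.\<close>
    have "cdf ?M = limit_spectral_distribution d G B" by (simp add: cdf_def cdf_M fun_eq_iff)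
    then have "(\<lambda>n. cdf (\<mu>n n) t) \<longlonglongrightarrow> cdf ?M t"
      using conv t by (simp add: weak_conv_m_def weak_conv_def)
    then show ?thesis by (simp add: cdf_def mu_cdf cdf_M limit_spectral_distribution_def)
  qed
  ultimately show ?thesis using limit_operator_in_vn_algebra conv by simp
qed

end
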